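(* Let $T(\lambda)=\lambda^2F+\lambda G+S$ be a strongly elliptic pencil on a separable Hilbert space $\mathcal H$. Then there exist positive numbers $\phi$ and $\delta$ such that the union $\Lambda_\phi\cup B_\delta$, with the possible exception of finitely many normal eigenvalues, belongs to the classical resolvent set of $T(\lambda)$ (and hence to the generalized resolvent set). Moreover, if $r_0$ is large enough, the estimate $$|\lambda|^2\,\|T^{-1}(\lambda)\|+|\lambda|\,\|H^{1/2}T^{-1}(\lambda)\|+\|H^{1/2}T^{-1}(\lambda)H^{1/2}\|\le \mathrm{const}$$ holds for all $\lambda\in\Lambda_\phi$ with $|\lambda|>r_0$.
   Context: Standing assumptions on the pencil: $\mathcal H$ is a separable complex Hilbert space; $F$ is bounded and uniformly positive; $H=H^*$ is uniformly positive with domain $\mathcal D(H)$; $G$ is symmetric with $\mathcal D(G)\supset\mathcal D(H^{1/2})$; $S=S^*$, $\mathcal D(S)=\mathcal D(H)$ and $(S-H)H^{-1}$ is compact. For $\theta\ge0$, $\mathcal H_\theta=\mathcal D(H^{\theta/2})$ with norm $\|H^{\theta/2}x\|$, and $\mathcal H_{-\theta}$ is the dual of $\mathcal H_\theta$ with respect to $\mathcal H$; $F,G,S$ extend to bounded operators $\mathcal H_1\to\mathcal H_{-1}$. Inequalities are understood for quadratic forms on $\mathcal D(H)$. $T(\lambda)$ is uniformly positive if $T(\lambda)\ge\varepsilon(\lambda^2+H)$ for all $\lambda\in\mathbb R$ and some $\varepsilon>0$; it is strongly elliptic if there is an $H$-compact positive operator $V$ ($\mathcal D(V)\supset\mathcal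 D(H)$, $VH^{-1}$ compact) such that $T(\lambda)+V$ is uniformly positive. A point $\mu$ belongs to the classical resolvent set if $T(\mu)$, with domain $\mathcal D(H)$, has a bounded inverse in $\mathcal H$; it belongs to the generalized resolvent set if $T(\mu)$, considered in $\mathcal H_{-1}$ with domain $\mathcal H_1$, has a bounded inverse in $\mathcal H_{-1}$. A normal eigenvalue is an isolated point of the spectrum which is an eigenvalue of finite algebraic multiplicity. In the last term of the estimate $T^{-1}(\lambda)$ is understood as acting from $\mathcal H_{-1}$ to $\mathcal H_1$ (equivalently, the bounded closure of $H^{1/2}T^{-1}(\lambda)H^{1/2}$ is taken). $B_\delta=\{\lambda:|\lambda|\le\delta\}$, $\Lambda_\phi=\{\lambda:|\arg\lambda|<\phi\}\cup\{\lambda:|\pi-\arg\lambda|<\phi\}$, $0<\phi\le\pi/2$. *)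

theory Defs
  imports "HOL-Analysis.Analysis" "HOL-Library.Complex_Order"
begin

section \<open>Complex Hilbert spaces\<close>

text \<open>The inner product \<open>cinner\<close> is linear in the first argument; the real inner product and the
  norm of the underlying real Hilbert space are the ones it induces.\<close>

class chilbert_space = real_inner + complete_space +
  fixes scaleC :: "complex \<Rightarrow> 'a \<Rightarrow> 'a" (infixr \<open>*\<^sub>C\<close> 75)
    and cinner :: "'a \<Rightarrow> 'a \<Rightarrow> complex"
  assumes scaleC_add_right: "c *\<^sub>C (x + y) = c *\<^sub>C x + c *\<^sub>C y"
    and scaleC_add_left: "(c + d) *\<^sub>C x = c *\<^sub>C x + d *\<^sub>C x"
    and scaleC_scaleC: "c *\<^sub>C (d *\<^sub>C x) = (c * d) *\<^sub>C x"
    and scaleC_of_real: "of_real r *\<^sub>C x = r *\<^sub>R x"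
    and cinner_commute: "cinner x y = cnj (cinner y x)"
    and cinner_add_left: "cinner (x + y) z = cinner x z + cinner y z"
    and cinner_scaleC_left: "cinner (c *\<^sub>C x) y = c * cinner x y"
    and inner_eq_Re_cinner: "inner x y = Re (cinner x y)"

instantiation complex :: chilbert_space
begin
definition scaleC_complex :: "complex \<Rightarrow> complex \<Rightarrow> complex" where "scaleC_complex c x = c * x"
definition cinner_complex :: "complex \<Rightarrow> complex \<Rightarrow> complex" where "cinner_complex x y = x * cnj y"
instance
  by standard
    (auto simp: scaleC_complex_def cinner_complex_def algebra_simps inner_complex_def scaleR_conv_of_real)
end

definition bounded_clinear :: "('a::chilbert_space \<Rightarrow> 'a) \<Rightarrow> bool" where
  "bounded_clinear f \<longleftrightarrow> bounded_linear f \<and> (\<forall>c x. f (c *\<^sub>C x) = c *\<^sub>C f x)"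

definition compact_op :: "('a::chilbert_space \<Rightarrow> 'a) \<Rightarrow> bool" where
  "compact_op K \<longleftrightarrow> bounded_clinear K \<and> compact (closure (K ` cball 0 1))"


section \<open>Unbounded operators\<close>

text \<open>An unbounded operator is a partial function with domain \<open>dom A\<close>, so that equality of
  operators and the composition \<open>A \<circ>\<^sub>m B\<close> include the domains. Inequalities between forms
  use the order on \<^typ>\<open>complex\<close> and therefore contain the assertion that the form is real.\<close>

definition linear_op :: "('a::chilbert_space \<rightharpoonup> 'a) \<Rightarrow> bool" where
  "linear_op A \<longleftrightarrow> module.subspace scaleC (dom A) \<and>
     (\<forall>x\<in>dom A. \<forall>y\<in>dom A. the (A (x + y)) = the (A x) + the (A y)) \<and>
     (\<forall>c. \<forall>x\<in>dom A. the (A (c *\<^sub>C x)) = c *\<^sub>C the (A x))"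

definition densely_defined :: "('a::chilbert_space \<rightharpoonup> 'a) \<Rightarrow> bool" where
  "densely_defined A \<longleftrightarrow> closure (dom A) = UNIV"

definition symmetric_op :: "('a::chilbert_space \<rightharpoonup> 'a) \<Rightarrow> bool" where
  "symmetric_op A \<longleftrightarrow> linear_op A \<and> densely_defined A \<and>
     (\<forall>x\<in>dom A. \<forall>y\<in>dom A. cinner (the (A x)) y = cinner x (the (A y)))"

definition adjoint_op :: "('a::chilbert_space \<rightharpoonup> 'a) \<Rightarrow> ('a \<rightharpoonup> 'a)" where
  "adjoint_op A = (\<lambda>y.
     if \<exists>z. \<forall>x\<in>dom A. cinner (the (A x)) y = cinner x z
     then Some (THE z. \<forall>x\<in>dom A. cinner (the (A x)) y = cinner x z) else None)"

definition selfadjoint_op :: "('a::chilbert_space \<rightharpoonup> 'a) \<Rightarrow> bool" where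
  "selfadjoint_op A \<longleftrightarrow> linear_op A \<and> densely_defined A \<and> adjoint_op A = A"

definition nonneg_on :: "'a set \<Rightarrow> ('a::chilbert_space \<Rightarrow> 'a) \<Rightarrow> bool" where
  "nonneg_on D f \<longleftrightarrow> (\<forall>x\<in>D. 0 \<le> cinner (f x) x)"

definition uniformly_positive_on :: "'a set \<Rightarrow> ('a::chilbert_space \<Rightarrow> 'a) \<Rightarrow> bool" where
  "uniformly_positive_on D f \<longleftrightarrow>
     (\<exists>\<epsilon>>0. \<forall>x\<in>D. complex_of_real (\<epsilon> * (norm x)\<^sup>2) \<le> cinner (f x) x)"

definition inv_op :: "('a::chilbert_space \<rightharpoonup> 'a) \<Rightarrow> ('a \<Rightarrow> 'a)" where
  "inv_op A = inv_into (dom A) (\<lambda>x. the (A x))"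

text \<open>The square root is the unique nonnegative self-adjoint one.\<close>

definition sqrt_op :: "('a::chilbert_space \<rightharpoonup> 'a) \<Rightarrow> ('a \<rightharpoonup> 'a)" where
  "sqrt_op A = (THE R. selfadjoint_op R \<and> nonneg_on (dom R) (\<lambda>x. the (R x)) \<and> R \<circ>\<^sub>m R = A)"

definition relatively_compact_op ::
    "('a::chilbert_space \<rightharpoonup> 'a) \<Rightarrow> ('a \<rightharpoonup> 'a) \<Rightarrow> bool" where
  "relatively_compact_op H V \<longleftrightarrow> dom H \<subseteq> dom V \<and> compact_op (\<lambda>y. the (V (inv_op H y)))"

text \<open>Operator norm of \<open>f\<close> on a space \<open>X\<close> with norm \<open>nX\<close>, measured by \<open>nY\<close>;
  it is \<open>\<infinity>\<close> when \<open>f\<close> is unbounded.\<close>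

definition op_norm :: "'x set \<Rightarrow> ('x \<Rightarrow> real) \<Rightarrow> ('y \<Rightarrow> real) \<Rightarrow> ('x \<Rightarrow> 'y) \<Rightarrow> ennreal" where
  "op_norm X nX nY f = (SUP x\<in>{x\<in>X. nX x \<le> 1}. ennreal (nY (f x)))"


section \<open>The spaces \<open>H\<^sub>1\<close> and \<open>H\<^sub>-\<^sub>1\<close>\<close>

definition space1 :: "('a::chilbert_space \<rightharpoonup> 'a) \<Rightarrow> 'a set" where
  "space1 H = dom (sqrt_op H)"

definition norm1 :: "('a::chilbert_space \<rightharpoonup> 'a) \<Rightarrow> 'a \<Rightarrow> real" where
  "norm1 H x = norm (the (sqrt_op H x))"

text \<open>The dual space consists of the bounded conjugate-linear functionals on \<open>space1 H\<close>, normalised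
  to vanish off \<open>space1 H\<close> so that equality of functions is equality of functionals.\<close>

definition space_dual :: "('a::chilbert_space \<rightharpoonup> 'a) \<Rightarrow> ('a \<Rightarrow> complex) set" where
  "space_dual H = {f. (\<forall>v\<in>space1 H. \<forall>w\<in>space1 H. f (v + w) = f v + f w) \<and>
     (\<forall>c. \<forall>v\<in>space1 H. f (c *\<^sub>C v) = cnj c * f v) \<and>
     (\<exists>C. \<forall>v\<in>space1 H. cmod (f v) \<le> C * norm1 H v) \<and>
     (\<forall>v. v \<notin> space1 H \<longrightarrow> f v = 0)}"

definition norm_dual :: "('a::chilbert_space \<rightharpoonup> 'a) \<Rightarrow> ('a \<Rightarrow> complex) \<Rightarrow> real" where
  "norm_dual H f = (SUP v\<in>{v\<in>space1 H. norm1 H v \<le> 1}. cmod (f v))"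

definition embed_dual :: "('a::chilbert_space \<rightharpoonup> 'a) \<Rightarrow> 'a \<Rightarrow> ('a \<Rightarrow> complex)" where
  "embed_dual H h = (\<lambda>v. if v \<in> space1 H then cinner h v else 0)"

text \<open>\<open>extend_op H A\<close> is the bounded operator from \<open>space1 H\<close> to \<open>space_dual H\<close> that extends \<open>A\<close>
  from \<open>dom H\<close>.\<close>

definition extend_op :: "('a::chilbert_space \<rightharpoonup> 'a) \<Rightarrow> ('a \<Rightarrow> 'a) \<Rightarrow> ('a \<Rightarrow> 'a \<Rightarrow> complex)" where
  "extend_op H A = (THE B.
     (\<forall>x\<in>space1 H. B x \<in> space_dual H) \<and>
     (\<forall>x\<in>space1 H. \<forall>y\<in>space1 H. \<forall>v. B (x + y) v = B x v + B y v) \<and>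
     (\<forall>c. \<forall>x\<in>space1 H. \<forall>v. B (c *\<^sub>C x) v = c * B x v) \<and>
     (\<exists>C. \<forall>x\<in>space1 H. norm_dual H (B x) \<le> C * norm1 H x) \<and>
     (\<forall>x\<in>dom H. B x = embed_dual H (A x)) \<and>
     (\<forall>x. x \<notin> space1 H \<longrightarrow> B x = (\<lambda>_. 0)))"


section \<open>The quadratic pencil\<close>

definition pencil_assms ::
    "('a::chilbert_space \<Rightarrow> 'a) \<Rightarrow> ('a \<rightharpoonup> 'a) \<Rightarrow> ('a \<rightharpoonup> 'a) \<Rightarrow> ('a \<rightharpoonup> 'a) \<Rightarrow> bool" where
  "pencil_assms F G H S \<longleftrightarrow>
     bounded_clinear F \<and> uniformly_positive_on UNIV F \<and>
     selfadjoint_op H \<and> uniformly_positive_on (dom H) (\<lambda>x. the (H x)) \<and>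
     symmetric_op G \<and> dom (sqrt_op H) \<subseteq> dom G \<and>
     selfadjoint_op S \<and> dom S = dom H \<and>
     compact_op (\<lambda>y. the (S (inv_op H y)) - the (H (inv_op H y)))"

text \<open>The values of the pencil are operators with domain \<open>dom H\<close>; \<open>pencil\<close> is only used there.\<close>

definition pencil :: "('a::chilbert_space \<Rightarrow> 'a) \<Rightarrow> ('a \<rightharpoonup> 'a) \<Rightarrow> ('a \<rightharpoonup> 'a) \<Rightarrow> complex \<Rightarrow> 'a \<Rightarrow> 'a" where
  "pencil F G S \<mu> x = \<mu>\<^sup>2 *\<^sub>C F x + \<mu> *\<^sub>C the (G x) + the (S x)"

definition gen_pencil ::
    "('a::chilbert_space \<Rightarrow> 'a) \<Rightarrow> ('a \<rightharpoonup> 'a) \<Rightarrow> ('a \<rightharpoonup> 'a) \<Rightarrow> ('a \<rightharpoonup> 'a) \<Rightarrow> complex \<Rightarrow> 'a \<Rightarrow> 'a \<Rightarrow> complex" where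
  "gen_pencil F G H S \<mu> x = (\<lambda>v. \<mu>\<^sup>2 * extend_op H F x v
     + \<mu> * extend_op H (\<lambda>x. the (G x)) x v + extend_op H (\<lambda>x. the (S x)) x v)"

definition uniformly_positive_pencil ::
    "('a::chilbert_space \<rightharpoonup> 'a) \<Rightarrow> (complex \<Rightarrow> 'a \<Rightarrow> 'a) \<Rightarrow> bool" where
  "uniformly_positive_pencil H T \<longleftrightarrow> (\<exists>\<epsilon>>0. \<forall>t::real. \<forall>x\<in>dom H.
     of_real \<epsilon> * (of_real (t\<^sup>2 * (norm x)\<^sup>2) + cinner (the (H x)) x) \<le> cinner (T (of_real t) x) x)"

definition strongly_elliptic ::
    "('a::chilbert_space \<Rightarrow> 'a) \<Rightarrow> ('a \<rightharpoonup> 'a) \<Rightarrow> ('a \<rightharpoonup> 'a) \<Rightarrow> ('a \<rightharpoonup> 'a) \<Rightarrow> bool" where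
  "strongly_elliptic F G H S \<longleftrightarrow> (\<exists>V. linear_op V \<and> relatively_compact_op H V \<and>
     nonneg_on (dom H) (\<lambda>x. the (V x)) \<and>
     uniformly_positive_pencil H (\<lambda>\<mu> x. pencil F G S \<mu> x + the (V x)))"

definition resolvent_set ::
    "('a::chilbert_space \<Rightarrow> 'a) \<Rightarrow> ('a \<rightharpoonup> 'a) \<Rightarrow> ('a \<rightharpoonup> 'a) \<Rightarrow> ('a \<rightharpoonup> 'a) \<Rightarrow> complex set" where
  "resolvent_set F G H S = {\<mu>. bij_betw (pencil F G S \<mu>) (dom H) UNIV \<and>
     (\<exists>C. \<forall>x\<in>dom H. norm x \<le> C * norm (pencil F G S \<mu> x))}"

definition gen_resolvent_set ::
    "('a::chilbert_space \<Rightarrow> 'a) \<Rightarrow> ('a \<rightharpoonup> 'a) \<Rightarrow> ('a \<rightharpoonup> 'a) \<Rightarrow> ('a \<rightharpoonup> 'a) \<Rightarrow> complex set" where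
  "gen_resolvent_set F G H S = {\<mu>. bij_betw (gen_pencil F G H S \<mu>) (space1 H) (space_dual H) \<and>
     (\<exists>C. \<forall>x\<in>space1 H. norm_dual H (embed_dual H x) \<le> C * norm_dual H (gen_pencil F G H S \<mu> x))}"

definition pencil_inv ::
    "('a::chilbert_space \<Rightarrow> 'a) \<Rightarrow> ('a \<rightharpoonup> 'a) \<Rightarrow> ('a \<rightharpoonup> 'a) \<Rightarrow> ('a \<rightharpoonup> 'a) \<Rightarrow> complex \<Rightarrow> 'a \<Rightarrow> 'a" where
  "pencil_inv F G H S \<mu> = inv_into (dom H) (pencil F G S \<mu>)"

definition gen_pencil_inv ::
    "('a::chilbert_space \<Rightarrow> 'a) \<Rightarrow> ('a \<rightharpoonup> 'a) \<Rightarrow> ('a \<rightharpoonup> 'a) \<Rightarrow> ('a \<rightharpoonup> 'a) \<Rightarrow> complex \<Rightarrow> ('a \<Rightarrow> complex) \<Rightarrow> 'a" where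
  "gen_pencil_inv F G H S \<mu> = inv_into (space1 H) (gen_pencil F G H S \<mu>)"


section \<open>Normal eigenvalues\<close>

definition pencil_kernel ::
    "('a::chilbert_space \<Rightarrow> 'a) \<Rightarrow> ('a \<rightharpoonup> 'a) \<Rightarrow> ('a \<rightharpoonup> 'a) \<Rightarrow> ('a \<rightharpoonup> 'a) \<Rightarrow> complex \<Rightarrow> 'a set" where
  "pencil_kernel F G H S \<mu> = {x\<in>dom H. pencil F G S \<mu> x = 0}"

definition eigenvalues ::
    "('a::chilbert_space \<Rightarrow> 'a) \<Rightarrow> ('a \<rightharpoonup> 'a) \<Rightarrow> ('a \<rightharpoonup> 'a) \<Rightarrow> ('a \<rightharpoonup> 'a) \<Rightarrow> complex set" where
  "eigenvalues F G H S = {\<mu>. \<exists>x\<in>pencil_kernel F G H S \<mu>. x \<noteq> 0}"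

text \<open>\<open>pencil_taylor F G S \<mu> j\<close> is the Taylor coefficient \<open>T\<^sup>(\<^sup>j\<^sup>)(\<mu>) / j!\<close> of the pencil at \<open>\<mu>\<close>.\<close>

definition pencil_taylor ::
    "('a::chilbert_space \<Rightarrow> 'a) \<Rightarrow> ('a \<rightharpoonup> 'a) \<Rightarrow> ('a \<rightharpoonup> 'a) \<Rightarrow> complex \<Rightarrow> nat \<Rightarrow> 'a \<Rightarrow> 'a" where
  "pencil_taylor F G S \<mu> j x =
     (if j = 0 then pencil F G S \<mu> x
      else if j = 1 then (2 * \<mu>) *\<^sub>C F x + the (G x)
      else if j = 2 then F x
      else 0)"

text \<open>Chains of an eigenvector and associated vectors in the sense of Keldysh.\<close>

definition jordan_chain ::
    "('a::chilbert_space \<Rightarrow> 'a) \<Rightarrow> ('a \<rightharpoonup> 'a) \<Rightarrow> ('a \<rightharpoonup> 'a) \<Rightarrow> ('a \<rightharpoonup> 'a) \<Rightarrow> complex \<Rightarrow> 'a list \<Rightarrow> bool" where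
  "jordan_chain F G H S \<mu> xs \<longleftrightarrow> xs \<noteq> [] \<and> hd xs \<noteq> 0 \<and> set xs \<subseteq> dom H \<and>
     (\<forall>l<length xs. (\<Sum>j\<le>l. pencil_taylor F G S \<mu> j (xs ! (l - j))) = 0)"

definition eigvec_rank ::
    "('a::chilbert_space \<Rightarrow> 'a) \<Rightarrow> ('a \<rightharpoonup> 'a) \<Rightarrow> ('a \<rightharpoonup> 'a) \<Rightarrow> ('a \<rightharpoonup> 'a) \<Rightarrow> complex \<Rightarrow> 'a \<Rightarrow> enat" where
  "eigvec_rank F G H S \<mu> x =
     (SUP xs\<in>{xs. jordan_chain F G H S \<mu> xs \<and> hd xs = x}. enat (length xs))"

text \<open>A canonical system is a finite basis of the kernel in which each vector has maximal rank among
  the eigenvectors outside the span of its predecessors. The algebraic multiplicity is the sum of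
  the ranks of a canonical system (and infinite if there is no finite one).\<close>

definition canonical_system ::
    "('a::chilbert_space \<Rightarrow> 'a) \<Rightarrow> ('a \<rightharpoonup> 'a) \<Rightarrow> ('a \<rightharpoonup> 'a) \<Rightarrow> ('a \<rightharpoonup> 'a) \<Rightarrow> complex \<Rightarrow> 'a list \<Rightarrow> bool" where
  "canonical_system F G H S \<mu> es \<longleftrightarrow> distinct es \<and> \<not> module.dependent scaleC (set es) \<and>
     module.span scaleC (set es) = pencil_kernel F G H S \<mu> \<and>
     (\<forall>i<length es. \<forall>y \<in> pencil_kernel F G H S \<mu> - module.span scaleC (set (take i es)).
        eigvec_rank F G H S \<mu> y \<le> eigvec_rank F G H S \<mu> (es ! i))"

definition finite_alg_multiplicity ::
    "('a::chilbert_space \<Rightarrow> 'a) \<Rightarrow> ('a \<rightharpoonup> 'a) \<Rightarrow> ('a \<rightharpoonup> 'a) \<Rightarrow> ('a \<rightharpoonup> 'a) \<Rightarrow> complex \<Rightarrow> bool" where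
  "finite_alg_multiplicity F G H S \<mu> \<longleftrightarrow>
     (\<exists>es. canonical_system F G H S \<mu> es \<and> (\<Sum>e\<leftarrow>es. eigvec_rank F G H S \<mu> e) < \<infinity>)"

definition normal_eigenvalues ::
    "('a::chilbert_space \<Rightarrow> 'a) \<Rightarrow> ('a \<rightharpoonup> 'a) \<Rightarrow> ('a \<rightharpoonup> 'a) \<Rightarrow> ('a \<rightharpoonup> 'a) \<Rightarrow> complex set" where
  "normal_eigenvalues F G H S = {\<mu>. \<mu> isolated_in (- resolvent_set F G H S) \<and>
     \<mu> \<in> eigenvalues F G H S \<and> finite_alg_multiplicity F G H S \<mu>}"


section \<open>The double sector\<close>

text \<open>Arguments are taken modulo \<open>2\<pi>\<close>: with the principal branch \<open>Arg\<close> the condition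
  \<open>\<bar>pi - t\<bar> < \<phi>\<close> would only see the upper half of the left sector.\<close>

definition double_sector :: "real \<Rightarrow> complex set" where
  "double_sector \<phi> = {z. z \<noteq> 0 \<and> (\<exists>t. is_Arg z t \<and> (\<bar>t\<bar> < \<phi> \<or> \<bar>pi - t\<bar> < \<phi>))}"

end

theory Submission
  imports Defs "HOL-Complex_Analysis.Complex_Analysis" "Jordan_Normal_Form.Determinant"
begin

text \<open>Put \<open>J = H\<^sup>-\<^sup>1\<^sup>/\<^sup>2\<close>. The map \<open>y \<mapsto> J y\<close> is an isometry of the given Hilbert space onto \<open>H\<^sub>1\<close>, and
  by the Riesz theorem the dual \<open>H\<^sub>-\<^sub>1\<close> is identified with the same Hilbert space, so the pencil acting
  from \<open>H\<^sub>1\<close> to \<open>H\<^sub>-\<^sub>1\<close> becomes the pencil of bounded operators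
  \<open>T \<mu> = \<mu>\<^sup>2 J F J + \<mu> J G J + J S J\<close>. Here \<open>G J\<close> is bounded by the uniform boundedness principle, because
  \<open>G\<close> is symmetric, and \<open>J S J\<close> stands for a bounded closure: \<open>(S - H) H\<^sup>-\<^sup>1\<close> is bounded and symmetric
  for the weaker inner product of \<open>H\<^sub>-\<^sub>1\<close>, so by a lemma of Lax (\<open>lax_symmetrizable\<close>) it is also bounded for
  the weaker norm, with the same constant. Invertibility of \<open>T \<mu>\<close> puts \<open>\<mu>\<close> into the generalized
  resolvent set, and also into the classical one, since a weak solution whose right-hand side is a
  vector of the Hilbert space lies in the domain of the adjoint of \<open>S\<close>, which is the domain of \<open>H\<close>
  (\<open>weak_solution_regular\<close>).

  The positive \<open>H\<close>-compact operator \<open>V\<close> of strong ellipticity is realised in the same way as a bounded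
  operator. The realisation is a norm limit of operators of finite rank, and its form is bounded by
  \<open>\<eta> |y|\<^sup>2 + C |J y|\<^sup>2\<close> with \<open>\<eta>\<close> as small as desired (\<open>perturbation_realisation\<close>). The inequality
  \<open>T t + V \<ge> \<epsilon> (t\<^sup>2 + H)\<close> on the real axis survives a small change of the argument of the parameter
  and a small change near \<open>0\<close>, so \<open>T + V\<close> is coercive on the union \<open>\<Omega>\<close> of a double cone and a disk
  (\<open>coercivity_regions\<close>). For large \<open>|\<mu>|\<close> in the cone the term \<open>\<epsilon> |\<mu>|\<^sup>2 |J y|\<^sup>2\<close> absorbs \<open>V\<close>, \<open>T\<close> itself
  is coercive, and testing the equation with its solution gives the three resolvent estimates
  (\<open>uniform_estimate\<close>).

  Let \<open>V\<^sub>1\<close> be a finite-rank approximation of \<open>V\<close>. On all of \<open>\<Omega>\<close> the operator \<open>L = T + V\<^sub>1\<close> is still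
  coercive, and the invertibility of \<open>T = L - V\<^sub>1\<close> is decided by the determinant of a finite matrix that
  is holomorphic in \<open>\<mu>\<close>. The determinant does not vanish for large parameters in the cone, hence its
  zeros are isolated, and only finitely many lie in the compact part of a smaller cone and disk. At a
  zero there is an eigenvector. Cramer's rule bounds the inverse of \<open>T\<close> nearby by the reciprocal of
  the determinant; comparing this with the polynomial built from a Jordan chain bounds the length of
  the chain by the order of the zero, so the algebraic multiplicity is finite
  (\<open>normal_eigenvalue_if_determinant_zero\<close>).\<close>

section \<open>Complex inner products and bounded operators\<close>

instance chilbert_space \<subseteq> banach ..

interpretation cvs: vector_space "scaleC :: complex \<Rightarrow> 'a \<Rightarrow> 'a::chilbert_space"
proof
  fix a b :: complex and x y :: 'a
  show "a *\<^sub>C (x + y) = a *\<^sub>C x + a *\<^sub>C y" by (rule scaleC_add_right)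
  show "(a + b) *\<^sub>C x = a *\<^sub>C x + b *\<^sub>C x" by (rule scaleC_add_left)
  show "a *\<^sub>C (b *\<^sub>C x) = (a * b) *\<^sub>C x" by (rule scaleC_scaleC)
  show "1 *\<^sub>C x = x" using scaleC_of_real[of 1 x] by simp
qed

lemma cinner_add_right: "cinner x (y + z) = cinner x y + cinner x z"
  by (metis cinner_add_left cinner_commute complex_cnj_add)

lemma cinner_scaleC_right: "cinner x (c *\<^sub>C y) = cnj c * cinner x y"
  by (metis cinner_scaleC_left cinner_commute complex_cnj_mult)

lemma cinner_zero_left [simp]: "cinner 0 x = 0"
  using cinner_scaleC_left[of 0 x x] by simp

lemma cinner_zero_right [simp]: "cinner x 0 = 0"
  using cinner_commute[of x 0] by simp

lemma cinner_minus_left: "cinner (- x) y = - cinner x y"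
  using cinner_scaleC_left[of "-1" x y] by simp

lemma cinner_minus_right: "cinner x (- y) = - cinner x y"
  using cinner_scaleC_right[of x "-1" y] by simp

lemma cinner_diff_left: "cinner (x - y) z = cinner x z - cinner y z"
  using cinner_add_left[of x "- y" z] by (simp add: cinner_minus_left)

lemma cinner_diff_right: "cinner x (y - z) = cinner x y - cinner x z"
  using cinner_add_right[of x y "- z"] by (simp add: cinner_minus_right)

lemma cinner_scaleR_left: "cinner (r *\<^sub>R x) y = of_real r * cinner x y"
  by (metis cinner_scaleC_left scaleC_of_real)

lemma cinner_scaleR_right: "cinner x (r *\<^sub>R y) = of_real r * cinner x y"
  by (metis cinner_scaleC_right scaleC_of_real complex_cnj_complex_of_real)

lemma cinner_sum_left: "cinner (\<Sum>i\<in>I. f i) y = (\<Sum>i\<in>I. cinner (f i) y)"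
  by (induction I rule: infinite_finite_induct) (auto simp: cinner_add_left)

lemma cinner_sum_right: "cinner y (\<Sum>i\<in>I. f i) = (\<Sum>i\<in>I. cinner y (f i))"
  by (induction I rule: infinite_finite_induct) (auto simp: cinner_add_right)

lemmas cinner_simps = cinner_add_left cinner_add_right cinner_scaleC_left cinner_scaleC_right
  cinner_minus_left cinner_minus_right cinner_diff_left cinner_diff_right
  cinner_scaleR_left cinner_scaleR_right cinner_sum_left cinner_sum_right

lemma cinner_self: "cinner x x = of_real ((norm x)\<^sup>2)"
proof -
  have "Im (cinner x x) = 0"
    using arg_cong[OF cinner_commute[of x x], of Im] by simp
  moreover have "Re (cinner x x) = (norm x)\<^sup>2"
    by (metis inner_eq_Re_cinner power2_norm_eq_inner)
  ultimately show ?thesis by (simp add: complex_eq_iff)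
qed

lemma norm_scaleC: "norm (c *\<^sub>C x) = cmod c * norm (x::'a::chilbert_space)"
proof -
  have "of_real ((norm (c *\<^sub>C x))\<^sup>2) = c * cnj c * of_real ((norm x)\<^sup>2)"
    by (simp only: cinner_self[symmetric] cinner_scaleC_left cinner_scaleC_right ac_simps)
  also have "\<dots> = of_real ((cmod c * norm x)\<^sup>2)"
    by (simp add: complex_norm_square[symmetric] power_mult_distrib)
  finally have "(norm (c *\<^sub>C x))\<^sup>2 = (cmod c * norm x)\<^sup>2"
    using of_real_eq_iff by blast
  then show ?thesis by simp
qed

lemma Cauchy_Schwarz_cinner: "cmod (cinner x y) \<le> norm x * norm (y::'a::chilbert_space)"
proof (cases "cinner x y = 0")
  case False
  \<comment> \<open>Rotating \<open>x\<close> makes the inner product real and nonnegative, which reduces to the real case.\<close>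
  define c where "c = cnj (sgn (cinner x y))"
  have c1: "cmod c = 1" using False by (simp add: c_def norm_sgn)
  have "cinner (c *\<^sub>C x) y = of_real (cmod (cinner x y))"
  proof -
    have "cnj w * w = of_real (cmod w) * of_real (cmod w)" for w
      using complex_norm_square[of w] by (simp add: power2_eq_square mult.commute)
    then show ?thesis
      using False by (simp add: c_def cinner_scaleC_left sgn_eq)
  qed
  then have "cmod (cinner x y) = inner (c *\<^sub>C x) y"
    by (simp add: inner_eq_Re_cinner)
  also have "\<dots> \<le> norm (c *\<^sub>C x) * norm y" by (rule norm_cauchy_schwarz)
  finally show ?thesis by (simp add: norm_scaleC c1)
qed simp

lemma scaleC_scaleR_commute: "c *\<^sub>C (r *\<^sub>R x) = r *\<^sub>R (c *\<^sub>C x)"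
  by (simp add: scaleC_of_real[symmetric] scaleC_scaleC mult.commute)

lemma bounded_linear_scaleC: "bounded_linear (\<lambda>x::'a::chilbert_space. c *\<^sub>C x)"
  by (rule bounded_linear_intro[where K="cmod c"])
     (auto simp: scaleC_add_right scaleC_scaleR_commute norm_scaleC mult.commute)

lemma bounded_bilinear_scaleC: "bounded_bilinear (scaleC :: complex \<Rightarrow> 'a \<Rightarrow> 'a::chilbert_space)"
proof
  show "(r *\<^sub>R a) *\<^sub>C b = r *\<^sub>R a *\<^sub>C b" for r a and b :: 'a
    by (simp add: scaleR_conv_of_real scaleC_of_real[symmetric])
  show "\<exists>K. \<forall>a b. norm (a *\<^sub>C b :: 'a) \<le> norm a * norm b * K"
    by (rule exI[of _ 1]) (simp add: norm_scaleC)
qed (simp_all add: scaleC_add_right scaleC_add_left scaleC_scaleR_commute)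

lemma bounded_bilinear_cinner: "bounded_bilinear (cinner :: 'a \<Rightarrow> 'a \<Rightarrow> complex)" for dummy :: "'a::chilbert_space"
proof
  show "\<exists>K. \<forall>a b::'a. norm (cinner a b) \<le> norm a * norm b * K"
    by (rule exI[of _ 1]) (simp add: Cauchy_Schwarz_cinner)
qed (simp_all add: cinner_simps scaleR_conv_of_real)

lemmas tendsto_cinner = bounded_bilinear.tendsto[OF bounded_bilinear_cinner]
lemmas tendsto_scaleC = bounded_bilinear.tendsto[OF bounded_bilinear_scaleC]
lemmas bounded_linear_cinner_left = bounded_bilinear.bounded_linear_left[OF bounded_bilinear_cinner]
lemmas bounded_linear_cinner_right = bounded_bilinear.bounded_linear_right[OF bounded_bilinear_cinner]

lemma inner_eq_Im_cinner: "Im (cinner x y) = inner x (\<i> *\<^sub>C y)"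
  by (simp add: inner_eq_Re_cinner cinner_scaleC_right)

lemma cinner_eqI:
  assumes "\<And>z. cinner x z = cinner y z"
  shows "x = (y::'a::chilbert_space)"
proof -
  have "cinner (x - y) (x - y) = 0" using assms by (simp add: cinner_diff_left)
  then show ?thesis by (simp add: cinner_self)
qed

lemma bounded_clinear_simps:
  assumes "bounded_clinear f"
  shows "f (x + y) = f x + f y" "f (x - y) = f x - f y" "f 0 = 0" "f (- x) = - f x"
    "f (c *\<^sub>C x) = c *\<^sub>C f x" "f (r *\<^sub>R x) = r *\<^sub>R f x" "f (\<Sum>i\<in>I. g i) = (\<Sum>i\<in>I. f (g i))"
  using assms unfolding bounded_clinear_def
  by (auto simp: linear_simps bounded_linear.linear linear_sum)

lemma bounded_clinear_linear: "bounded_clinear f \<Longrightarrow> bounded_linear f"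
  by (simp add: bounded_clinear_def)

lemma bounded_clinear_bound:
  assumes "bounded_clinear f"
  obtains C where "C > 0" "\<And>x. norm (f x) \<le> C * norm x"
  using bounded_linear.pos_bounded[OF bounded_clinear_linear[OF assms]] by (metis mult.commute)

lemma bounded_clinearI:
  assumes "\<And>x y. f (x + y) = f x + f y" "\<And>c x. f (c *\<^sub>C x) = c *\<^sub>C f x"
    and "\<And>x. norm (f x) \<le> C * norm x"
  shows "bounded_clinear f"
proof -
  have "f (r *\<^sub>R x) = r *\<^sub>R f x" for r x by (metis assms(2) scaleC_of_real)
  then show ?thesis unfolding bounded_clinear_def
    using assms by (auto intro!: bounded_linear_intro[where K=C] simp: mult.commute)
qed

lemma bounded_clinear_compose: "bounded_clinear f \<Longrightarrow> bounded_clinear g \<Longrightarrow> bounded_clinear (\<lambda>x. f (g x))"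
  unfolding bounded_clinear_def using bounded_linear_compose[of f g] by auto

lemma bounded_clinear_add: "bounded_clinear f \<Longrightarrow> bounded_clinear g \<Longrightarrow> bounded_clinear (\<lambda>x. f x + g x)"
  unfolding bounded_clinear_def using bounded_linear_add[of f g] by (auto simp: scaleC_add_right)

lemma bounded_clinear_diff: "bounded_clinear f \<Longrightarrow> bounded_clinear g \<Longrightarrow> bounded_clinear (\<lambda>x. f x - g x)"
  unfolding bounded_clinear_def using bounded_linear_sub[of f g] by (auto simp: cvs.scale_right_diff_distrib)

lemma bounded_clinear_scaleC: "bounded_clinear f \<Longrightarrow> bounded_clinear (\<lambda>x. c *\<^sub>C f x)"
  unfolding bounded_clinear_def
  using bounded_linear_compose[OF bounded_linear_scaleC[of c], of f] by (auto simp: scaleC_scaleC mult.commute)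

lemma bounded_clinear_scaleR: "bounded_clinear f \<Longrightarrow> bounded_clinear (\<lambda>x. r *\<^sub>R f x)"
  using bounded_clinear_scaleC[of f "of_real r"] by (simp add: scaleC_of_real)

lemma bounded_clinear_ident: "bounded_clinear (\<lambda>x. x)"
  by (simp add: bounded_clinear_def bounded_linear_ident)

lemma bounded_clinear_sum:
  "(\<And>i. i \<in> I \<Longrightarrow> bounded_clinear (f i)) \<Longrightarrow> bounded_clinear (\<lambda>x. \<Sum>i\<in>I. f i x)"
proof (induction I rule: infinite_finite_induct)
  case (insert i I)
  then show ?case using bounded_clinear_add[of "f i" "\<lambda>x. \<Sum>i\<in>I. f i x"] by auto
qed (auto simp: bounded_clinear_def)

lemma bounded_clinear_rank_one: "bounded_clinear (\<lambda>x. cinner x f *\<^sub>C g)"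
  by (rule bounded_clinearI[where C="norm f * norm g"])
     (auto simp: cinner_simps scaleC_add_left scaleC_scaleC norm_scaleC
       intro!: order_trans[OF mult_right_mono[OF Cauchy_Schwarz_cinner]])

lemmas bounded_clinear_intros = bounded_clinear_add bounded_clinear_diff
  bounded_clinear_scaleC bounded_clinear_scaleR bounded_clinear_ident bounded_clinear_rank_one
  bounded_clinear_sum

text \<open>Polarization: it is enough to test the form on the diagonal because the scalars are complex.\<close>

lemma symmetric_if_form_real:
  assumes add: "\<And>x y. x \<in> D \<Longrightarrow> y \<in> D \<Longrightarrow> x + y \<in> D \<and> b (x + y) = b x + b y"
    and scale: "\<And>c x. x \<in> D \<Longrightarrow> c *\<^sub>C x \<in> D \<and> b (c *\<^sub>C x) = c *\<^sub>C b x"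
    and real: "\<And>x. x \<in> D \<Longrightarrow> Im (cinner (b x) x) = 0"
    and "x \<in> D" "y \<in> D"
  shows "cinner (b x) y = cinner x (b y)"
proof -
  have 1: "Im (cinner (b u) v) + Im (cinner (b v) u) = 0" if "u \<in> D" "v \<in> D" for u v
    using real[of "u + v"] real[of u] real[of v] add[OF that] that by (simp add: cinner_simps)
  have 2: "Im (cinner (b x) y) + Im (cinner (b y) x) = 0" using 1 assms by blast
  have 3: "Im (cinner (b (\<i> *\<^sub>C x)) y) + Im (cinner (b y) (\<i> *\<^sub>C x)) = 0" using 1 assms by blast
  then have "Re (cinner (b x) y) - Re (cinner (b y) x) = 0"
    using scale[OF \<open>x \<in> D\<close>, of \<i>] by (simp add: cinner_simps)
  with 2 have "cinner (b x) y = cnj (cinner (b y) x)" by (simp add: complex_eq_iff)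
  then show ?thesis by (metis cinner_commute)
qed

section \<open>Riesz representation, coercivity, and compactness\<close>

text \<open>The representing vector minimizes \<open>|x|\<^sup>2 - 2 f x\<close> over \<open>M\<close>: a minimizing sequence is Cauchy by the
  parallelogram identity, and the minimum is stationary. Taking \<open>M = UNIV\<close> gives the Riesz theorem,
  taking \<open>f = inner x\<close> the orthogonal projection onto \<open>M\<close>.\<close>

lemma riesz_on_closed_subspace:
  fixes f :: "'a::{real_inner,complete_space} \<Rightarrow> real"
  assumes M: "subspace M" "closed M" and f: "bounded_linear f"
  obtains w where "w \<in> M" "\<And>m. m \<in> M \<Longrightarrow> f m = inner w m"
proof -
  define q where "q x = inner x x - 2 * f x" for x
  obtain C where C: "\<And>x. norm (f x) \<le> norm x * C" "C > 0"
    using bounded_linear.pos_bounded[OF f] by blast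
  have q_lower: "- C\<^sup>2 \<le> q x" for x
  proof -
    have "f x \<le> norm x * C" using C(1)[of x] by simp
    moreover have "0 \<le> (norm x - C)\<^sup>2" by simp
    ultimately show ?thesis by (simp add: q_def power2_norm_eq_inner[symmetric] power2_diff)
  qed
  define d where "d = Inf (q ` M)"
  have bdd: "bdd_below (q ` M)" using q_lower by (intro bdd_belowI[of _ "- C\<^sup>2"]) auto
  have d_le: "d \<le> q x" if "x \<in> M" for x
    unfolding d_def using bdd that by (auto intro: cInf_lower)
  have "\<exists>x\<in>M. q x < d + 1 / Suc n" for n
  proof -
    have "Inf (q ` M) < d + 1 / Suc n" unfolding d_def[symmetric] by simp
    moreover have "q ` M \<noteq> {}" using subspace_0[OF M(1)] by blast
    ultimately obtain v where "v \<in> q ` M" "v < d + 1 / Suc n" by (meson cInf_lessD)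
    then show ?thesis by auto
  qed
  then obtain x where x: "x n \<in> M" "q (x n) < d + 1 / Suc n" for n by metis
  have par: "(norm (u - v))\<^sup>2 = 2 * (q u + q v - 2 * q ((1/2) *\<^sub>R (u + v)))" for u v
  proof -
    have "f ((1/2) *\<^sub>R (u + v)) = (f u + f v) / 2"
      using f by (simp add: linear_simps)
    then show ?thesis unfolding q_def power2_norm_eq_inner
      by (simp add: inner_simps inner_commute field_simps)
  qed
  have dist: "(norm (x m - x n))\<^sup>2 < 2 * (1 / Suc m + 1 / Suc n)" for m n
  proof -
    have "(1/2) *\<^sub>R (x m + x n) \<in> M" using M(1) x(1) by (simp add: subspace_add subspace_scale)
    from d_le[OF this] show ?thesis using par[of "x m" "x n"] x(2)[of m] x(2)[of n] by argo
  qed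
  have "Cauchy x"
  proof (rule metric_CauchyI)
    fix e :: real assume e: "e > 0"
    obtain N where N: "1 / Suc N < e\<^sup>2 / 4"
      using reals_Archimedean[of "e\<^sup>2 / 4"] e by (auto simp: inverse_eq_divide)
    show "\<exists>N. \<forall>m\<ge>N. \<forall>n\<ge>N. dist (x m) (x n) < e"
    proof (intro exI allI impI)
      fix m n assume "N \<le> m" "N \<le> n"
      then have "1 / real (Suc m) \<le> 1 / Suc N" "1 / real (Suc n) \<le> 1 / Suc N"
        by (auto simp: frac_le)
      moreover have "q < E" if "a \<le> c" "b \<le> c" "q < 2 * (a + b)" "c < E / 4" for a b c q E :: real
      proof -
        have "2 * (a + b) \<le> 4 * c" using that(1,2) by simp
        with that(3,4) show ?thesis by simp
      qed
      ultimately have "(norm (x m - x n))\<^sup>2 < e\<^sup>2" using dist[of m n] N by blast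
      then show "dist (x m) (x n) < e" using e by (simp add: dist_norm power_less_imp_less_base)
    qed
  qed
  then obtain w where w: "x \<longlonglongrightarrow> w" by (meson Cauchy_convergent convergentD)
  have "w \<in> M" using closed_sequentially[OF M(2) _ w] x(1) by blast
  have "(\<lambda>n. q (x n)) \<longlonglongrightarrow> q w"
    unfolding q_def using w by (intro tendsto_intros bounded_linear.tendsto[OF f])
  moreover have "(\<lambda>n. d + 1 / Suc n) \<longlonglongrightarrow> d + 0"
    by (intro tendsto_intros LIMSEQ_Suc[OF lim_1_over_n])
  ultimately have qw: "q w \<le> d"
    using x(2) LIMSEQ_le[of "\<lambda>n. q (x n)" "q w" "\<lambda>n. d + 1 / Suc n" "d + 0"] by (simp add: less_imp_le)
  have "f m = inner w m" if m: "m \<in> M" for m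
  proof -
    define a where "a = inner w m - f m"
    define b where "b = inner m m"
    have b: "b \<ge> 0" by (simp add: b_def)
    have *: "0 \<le> 2 * t * a + t\<^sup>2 * b" for t
    proof -
      have "w + t *\<^sub>R m \<in> M" using \<open>w \<in> M\<close> m M(1) by (simp add: subspace_add subspace_scale)
      then have "q w \<le> q (w + t *\<^sub>R m)" using d_le qw by fastforce
      moreover have "f (w + t *\<^sub>R m) = f w + t * f m" using f by (simp add: linear_simps)
      ultimately show ?thesis
        by (simp add: q_def a_def b_def inner_simps inner_commute algebra_simps power2_eq_square)
    qed
    \<comment> \<open>The minimizing \<open>t = - a / b\<close> is undefined for \<open>b = 0\<close>; the denominator \<open>b + 1\<close> serves all cases.\<close>
    have "0 \<le> 2 * (- a / (b + 1)) * a + (- a / (b + 1))\<^sup>2 * b" by (rule *)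
    also have "\<dots> = - (a\<^sup>2 * (b + 2) / (b + 1)\<^sup>2)"
    proof -
      define s where "s = b + 1"
      have "s \<noteq> 0" "b = s - 1" using b by (auto simp: s_def)
      then show ?thesis unfolding \<open>b = s - 1\<close> by (simp add: field_simps power2_eq_square)
    qed
    finally have "a\<^sup>2 * (b + 2) / (b + 1)\<^sup>2 \<le> 0" by simp
    then have "a = 0" using b by (simp add: divide_le_0_iff mult_le_0_iff)
    then show ?thesis by (simp add: a_def)
  qed
  with \<open>w \<in> M\<close> show thesis using that by blast
qed

lemma subspace_closure:
  fixes M :: "'a::real_normed_vector set"
  assumes M: "subspace M"
  shows "subspace (closure M)"
proof (rule subspaceI)
  show "0 \<in> closure M" using subspace_0[OF M] closure_subset by blast
  show "x + y \<in> closure M" if xy: "x \<in> closure M" "y \<in> closure M" for x y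
  proof -
    obtain u v where "\<forall>n. u n \<in> M" "u \<longlonglongrightarrow> x" "\<forall>n. v n \<in> M" "v \<longlonglongrightarrow> y"
      using xy by (auto simp: closure_sequential)
    then show ?thesis unfolding closure_sequential
      by (intro exI[of _ "\<lambda>n. u n + v n"]) (auto intro: tendsto_add subspace_add[OF M])
  qed
  show "c *\<^sub>R x \<in> closure M" if x: "x \<in> closure M" for c x
  proof -
    obtain u where "\<forall>n. u n \<in> M" "u \<longlonglongrightarrow> x" using x by (auto simp: closure_sequential)
    then show ?thesis unfolding closure_sequential
      by (intro exI[of _ "\<lambda>n. c *\<^sub>R u n"]) (auto intro: tendsto_scaleR subspace_scale[OF M])
  qed
qed

lemma dense_if_orthogonal_complement_trivial:
  fixes M :: "'a::{real_inner,complete_space} set"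
  assumes M: "subspace M" and orth: "\<And>z. (\<And>m. m \<in> M \<Longrightarrow> inner z m = 0) \<Longrightarrow> z = 0"
  shows "closure M = UNIV"
proof -
  have "x \<in> closure M" for x
  proof -
    obtain w where w: "w \<in> closure M" "\<And>m. m \<in> closure M \<Longrightarrow> inner x m = inner w m"
      using riesz_on_closed_subspace[of "closure M" "inner x"] M
      by (auto simp: subspace_closure bounded_linear_inner_right)
    have "x - w = 0"
      using w(2) subsetD[OF closure_subset[of M]] by (intro orth) (simp add: inner_diff_left)
    with w(1) show ?thesis by simp
  qed
  then show ?thesis by blast
qed

text \<open>Lax--Milgram: the range is closed because \<open>T\<close> is bounded below, and it is dense because a vector
  \<open>z\<close> orthogonal to it is orthogonal to \<open>T z\<close>.\<close>

lemma bij_if_coercive: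
  fixes T :: "'a::{real_inner,complete_space} \<Rightarrow> 'a"
  assumes T: "bounded_linear T" and c: "c > 0" and coer: "\<And>y. c * (norm y)\<^sup>2 \<le> inner (T y) y"
  shows "bij T"
proof -
  have bd: "c * norm y \<le> norm (T y)" for y
  proof (cases "y = 0")
    case False
    have "c * (norm y)\<^sup>2 \<le> norm (T y) * norm y"
      using coer[of y] norm_cauchy_schwarz[of "T y" y] by linarith
    then show ?thesis using False by (simp add: power2_eq_square)
  qed simp
  have "inj T"
  proof (rule injI)
    fix x y assume "T x = T y"
    then have "c * norm (x - y) \<le> 0" using bd[of "x - y"] T by (simp add: linear_simps)
    then show "x = y" using c by (simp add: mult_le_0_iff)
  qed
  have "complete (range T)"
    using complete_isometric_image[OF c subspace_UNIV T] bd complete_UNIV by auto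
  then have "closed (range T)" by (rule complete_imp_closed)
  moreover have "closure (range T) = UNIV"
  proof (rule dense_if_orthogonal_complement_trivial)
    show "subspace (range T)"
      using T by (simp add: bounded_linear.linear linear_subspace_image)
    fix z assume "\<And>m. m \<in> range T \<Longrightarrow> inner z m = 0"
    from this[of "T z"] have "inner (T z) z = 0" by (simp add: inner_commute)
    then show "z = 0" using coer[of z] c by (simp add: mult_le_0_iff)
  qed
  ultimately show ?thesis using \<open>inj T\<close> by (simp add: bij_def)
qed

text \<open>The real part of \<open>\<phi>\<close> is represented by the real Riesz theorem, and \<open>Im (\<phi> x) = - Re (\<phi> (\<i> x))\<close>
  recovers the imaginary part.\<close>

lemma riesz_representation:
  fixes \<phi> :: "'a::chilbert_space \<Rightarrow> complex"
  assumes add: "\<And>x y. \<phi> (x + y) = \<phi> x + \<phi> y" and scale: "\<And>c x. \<phi> (c *\<^sub>C x) = c * \<phi> x"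
    and bound: "\<And>x. cmod (\<phi> x) \<le> C * norm x"
  obtains w where "\<And>x. \<phi> x = cinner x w"
proof -
  have "bounded_linear (\<lambda>x. Re (\<phi> x))"
  proof (rule bounded_linear_intro[where K=C])
    show "Re (\<phi> (r *\<^sub>R x)) = r *\<^sub>R Re (\<phi> x)" for r x
      using scale[of "of_real r" x] by (simp add: scaleC_of_real)
    show "norm (Re (\<phi> x)) \<le> norm x * C" for x
      using bound[of x] abs_Re_le_cmod[of "\<phi> x"] by (simp add: mult.commute)
  qed (simp add: add)
  then obtain w where w: "\<And>x. Re (\<phi> x) = inner w x"
    using riesz_on_closed_subspace[of UNIV "\<lambda>x. Re (\<phi> x)"] by auto
  have re: "Re (\<phi> x) = Re (cinner x w)" for x
    using w[of x] by (simp add: inner_commute inner_eq_Re_cinner[symmetric])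
  have "Im (\<phi> x) = Im (cinner x w)" for x
    using re[of "\<i> *\<^sub>C x"] by (simp add: scale cinner_simps)
  with re have "\<phi> x = cinner x w" for x by (simp add: complex_eq_iff)
  then show thesis using that by blast
qed

lemma bounded_adjoint_vector:
  assumes "bounded_clinear A"
  obtains f where "\<And>x. cinner (A x) e = cinner x f"
proof -
  obtain C where C: "\<And>x. norm (A x) \<le> C * norm x" using bounded_clinear_bound[OF assms] by blast
  have "cmod (cinner (A x) e) \<le> (C * norm e) * norm x" for x
    using Cauchy_Schwarz_cinner[of "A x" e] mult_right_mono[OF C[of x], of "norm e"]
    by (simp add: ac_simps)
  then show thesis
    using riesz_representation[of "\<lambda>x. cinner (A x) e"] that
    by (auto simp: cinner_simps bounded_clinear_simps[OF assms])
qed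

text \<open>The uniform boundedness principle for functionals: by the Baire category theorem one of the closed sets
  on which all functionals are bounded by \<open>n\<close> contains a ball.\<close>

lemma weakly_bounded_imp_bounded:
  fixes W :: "'a::{real_inner,complete_space} set"
  assumes weak: "\<And>y. \<exists>C. \<forall>w\<in>W. \<bar>inner y w\<bar> \<le> C"
  obtains C where "\<And>w. w \<in> W \<Longrightarrow> norm w \<le> C"
proof -
  define S where "S n = {y. \<forall>w\<in>W. \<bar>inner y w\<bar> \<le> real n}" for n :: nat
  have closed: "closed (S n)" for n
  proof -
    have "S n = (\<Inter>w\<in>W. {y. \<bar>inner y w\<bar> \<le> real n})" by (auto simp: S_def)
    then show ?thesis by (auto intro!: closed_INT closed_Collect_le continuous_intros)
  qed
  have cover: "(\<Inter>n. - S n) = {}"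
  proof -
    have "\<exists>n. y \<in> S n" for y
    proof -
      obtain C where C: "\<forall>w\<in>W. \<bar>inner y w\<bar> \<le> C" using weak by blast
      obtain n where "C \<le> real n" using real_arch_simple by blast
      then show ?thesis using C by (auto simp: S_def intro: order_trans)
    qed
    then show ?thesis by blast
  qed
  have "\<exists>n. closure (- S n) \<noteq> UNIV"
  proof (rule ccontr)
    assume "\<not> ?thesis"
    then have "closure (\<Inter>(range (\<lambda>n. - S n))) = UNIV"
      using Met_TC.metric_Baire_category[of "range (\<lambda>n. - S n)"] closed
      by (auto simp: closed_def complete_UNIV)
    then show False using cover by simp
  qed
  then obtain n where "interior (S n) \<noteq> {}" by (auto simp: closure_complement)
  then obtain y0 e where e: "e > 0" "ball y0 e \<subseteq> S n"
    by (metis ex_in_conv mem_interior)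
  have "norm w \<le> 4 * n / e" if w: "w \<in> W" for w
  proof (cases "w = 0")
    case False
    define u where "u = (e / 2 / norm w) *\<^sub>R w"
    have nu: "norm u = e / 2" using False e by (simp add: u_def)
    have "y0 + u \<in> ball y0 e" "y0 \<in> ball y0 e" using e nu by (auto simp: dist_norm)
    then have "y0 + u \<in> S n" "y0 \<in> S n" using e by blast+
    then have "\<bar>inner (y0 + u) w\<bar> \<le> n" "\<bar>inner y0 w\<bar> \<le> n" using w by (auto simp: S_def)
    then have "\<bar>inner u w\<bar> \<le> 2 * n" by (simp add: inner_add_left)
    moreover have "inner u w = e / 2 * norm w"
      using False by (simp add: u_def power2_norm_eq_inner[symmetric] power2_eq_square)
    ultimately show ?thesis using e by (simp add: field_simps)
  qed (use e in simp)
  then show thesis using that by blast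
qed

text \<open>Lax's lemma. Symmetry makes the sequence \<open>a n = |J (A\<^sup>n x)|\<close> logarithmically convex, so its growth ratio
  can only increase. If the first ratio exceeded \<open>C\<close>, the sequence would outgrow \<open>C\<^sup>n\<close>, which
  the bound on the powers of \<open>A\<close> forbids.\<close>

lemma lax_symmetrizable:
  fixes J :: "'a::real_inner \<Rightarrow> 'b::real_inner"
  assumes J: "bounded_linear J"
    and C: "C \<ge> 0" "\<And>x. norm (A x) \<le> C * norm x"
    and sym: "\<And>x y. inner (J (A x)) (J y) = inner (J x) (J (A y))"
  shows "norm (J (A x)) \<le> C * norm (J x)"
proof (rule ccontr)
  assume neg: "\<not> ?thesis"
  define a where "a n = norm (J ((A ^^ n) x))" for n
  have a0: "a n \<ge> 0" for n by (simp add: a_def)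
  have convex: "(a (Suc n))\<^sup>2 \<le> a n * a (Suc (Suc n))" for n
  proof -
    have "(a (Suc n))\<^sup>2 = inner (J ((A ^^ n) x)) (J ((A ^^ Suc (Suc n)) x))"
      using sym[of "(A ^^ n) x" "(A ^^ Suc n) x"] by (simp add: a_def power2_norm_eq_inner)
    also have "\<dots> \<le> a n * a (Suc (Suc n))" unfolding a_def by (rule norm_cauchy_schwarz)
    finally show ?thesis .
  qed
  have a1: "a 1 > C * a 0" using neg by (simp add: a_def)
  have "a 0 \<noteq> 0"
  proof
    assume "a 0 = 0"
    then have "a 1 = 0" using convex[of 0] by simp
    with a1 \<open>a 0 = 0\<close> show False by simp
  qed
  then have a0pos: "a 0 > 0" using a0[of 0] by simp
  define r where "r = a 1 / a 0"
  have r: "r > C" using a1 a0pos by (simp add: r_def field_simps)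
  have grow: "a n > 0 \<and> r * a n \<le> a (Suc n)" for n
  proof (induction n)
    case 0 then show ?case using a0pos by (simp add: r_def)
  next
    case (Suc n)
    then have pos: "a (Suc n) > 0" using r C(1) by (smt (verit) mult_pos_pos)
    have "a n * (r * a (Suc n)) \<le> a (Suc n) * a (Suc n)" using Suc pos by (simp add: mult.assoc[symmetric] mult.commute[of "a n"])
    also have "\<dots> \<le> a n * a (Suc (Suc n))" using convex[of n] by (simp add: power2_eq_square)
    finally show ?case using Suc pos by simp
  qed
  have lower: "r ^ n * a 0 \<le> a n" for n
  proof (induction n)
    case (Suc n)
    have "r ^ Suc n * a 0 \<le> r * a n" using mult_left_mono[OF Suc, of r] r C(1) by simp
    then show ?case using grow[of n] by simp
  qed simp
  obtain K where K: "K > 0" "\<And>x. norm (J x) \<le> norm x * K"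
    using bounded_linear.pos_bounded[OF J] by blast
  have "norm ((A ^^ n) x) \<le> C ^ n * norm x" for n
  proof (induction n)
    case (Suc n)
    have "norm ((A ^^ Suc n) x) \<le> C * norm ((A ^^ n) x)" using C(2) by simp
    also have "\<dots> \<le> C * (C ^ n * norm x)" using Suc C(1) by (rule mult_left_mono)
    finally show ?case by simp
  qed simp
  then have upper: "a n \<le> C ^ n * norm x * K" for n
    using K(2)[of "(A ^^ n) x"] mult_right_mono[of _ _ K] K(1) unfolding a_def by (meson less_imp_le order_trans)
  have "C \<noteq> 0"
    using upper[of 1] a1 C(1) a0pos by auto
  with C(1) have Cpos: "C > 0" by simp
  obtain n where n: "norm x * K / a 0 < (r / C) ^ n"
    using real_arch_pow[of "r / C" "norm x * K / a 0"] r Cpos by auto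
  have "r ^ n * a 0 \<le> C ^ n * (norm x * K)" using lower[of n] upper[of n] by (simp add: mult.assoc)
  then have "(r / C) ^ n \<le> norm x * K / a 0"
    using a0pos Cpos by (simp add: power_divide field_simps)
  with n show False by simp
qed

definition orthonormal_family :: "nat \<Rightarrow> (nat \<Rightarrow> 'a::chilbert_space) \<Rightarrow> bool" where
  "orthonormal_family n e \<longleftrightarrow> (\<forall>i<n. \<forall>j<n. cinner (e i) (e j) = (if i = j then 1 else 0))"

text \<open>Gram--Schmidt: the span of finitely many vectors is the range of an orthogonal projection written in
  coordinates.\<close>

lemma orthonormal_family_spanning:
  assumes "finite B"
  obtains n e where "orthonormal_family n e" "\<And>k. k \<in> B \<Longrightarrow> (\<Sum>i<n. cinner k (e i) *\<^sub>C e i) = k"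
proof -
  have "\<exists>n e. orthonormal_family n e \<and> (\<forall>k\<in>B. (\<Sum>i<n. cinner k (e i) *\<^sub>C e i) = k)"
    using assms
  proof induction
    case empty
    show ?case by (rule exI[of _ 0]) (simp add: orthonormal_family_def)
  next
    case (insert b B)
    then obtain n e where e: "orthonormal_family n e"
      "\<And>k. k \<in> B \<Longrightarrow> (\<Sum>i<n. cinner k (e i) *\<^sub>C e i) = k" by blast
    define r where "r = b - (\<Sum>i<n. cinner b (e i) *\<^sub>C e i)"
    show ?case
    proof (cases "r = 0")
      case True
      then show ?thesis using e by (intro exI[of _ n] exI[of _ e]) (auto simp: r_def)
    next
      case False
      have perp: "cinner r (e j) = 0" if "j < n" for j
      proof -
        have "(\<Sum>i<n. cinner b (e i) * cinner (e i) (e j)) = (\<Sum>i<n. if i = j then cinner b (e j) else 0)"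
          using e(1) that by (intro sum.cong) (auto simp: orthonormal_family_def)
        then show ?thesis using that by (simp add: r_def cinner_simps)
      qed
      then have perp': "cinner (e j) r = 0" if "j < n" for j using that by (metis cinner_commute complex_cnj_zero)
      define s where "s = (1 / norm r) *\<^sub>R r"
      define e' where "e' = e(n := s)"
      have "cinner s s = 1" using False by (simp add: s_def cinner_simps cinner_self power2_eq_square)
      then have on: "orthonormal_family (Suc n) e'"
        using e(1) perp perp' unfolding orthonormal_family_def
        by (auto simp: e'_def less_Suc_eq s_def cinner_simps)
      have sum: "(\<Sum>i<Suc n. cinner k (e' i) *\<^sub>C e' i) = (\<Sum>i<n. cinner k (e i) *\<^sub>C e i) + cinner k s *\<^sub>C s" for k
        by (simp add: e'_def)
      have kB: "cinner k s = 0" if "k \<in> B" for k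
      proof -
        have "cinner k r = cinner (\<Sum>i<n. cinner k (e i) *\<^sub>C e i) r" using e(2)[OF that] by simp
        also have "\<dots> = 0" using perp' by (simp add: cinner_simps)
        finally show ?thesis by (simp add: s_def cinner_simps)
      qed
      have "cinner b r = cinner r r"
      proof -
        define p where "p = (\<Sum>i<n. cinner b (e i) *\<^sub>C e i)"
        have "cinner p r = 0" using perp' by (simp add: p_def cinner_simps)
        moreover have "b = r + p" by (simp add: r_def p_def)
        ultimately show ?thesis by (metis cinner_add_left add.right_neutral)
      qed
      then have "cinner b s *\<^sub>C s = r"
      proof -
        have "cinner b s = of_real (norm r)"
          using False \<open>cinner b r = cinner r r\<close> by (simp add: s_def cinner_scaleR_right cinner_self power2_eq_square)
        then show ?thesis using False by (simp add: scaleC_of_real s_def)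
      qed
      then have "(\<Sum>i<Suc n. cinner b (e' i) *\<^sub>C e' i) = b" unfolding sum by (simp add: r_def)
      then show ?thesis using on sum kB e(2)
        by (intro exI[of _ "Suc n"] exI[of _ e']) auto
    qed
  qed
  then show thesis using that by blast
qed

lemma orthonormal_residual_le:
  assumes "orthonormal_family n e"
  shows "norm (y - (\<Sum>i<n. cinner y (e i) *\<^sub>C e i)) \<le> norm y"
proof -
  define p where "p = (\<Sum>i<n. cinner y (e i) *\<^sub>C e i)"
  have "cinner (e j) p = cinner (e j) y" if "j < n" for j
  proof -
    have "cinner (e j) p = (\<Sum>i<n. if i = j then cinner (e j) y else 0)"
      unfolding p_def cinner_sum_right using assms that
      by (intro sum.cong) (auto simp: orthonormal_family_def cinner_simps cinner_commute[of y])
    then show ?thesis using that by simp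
  qed
  then have "cinner p p = cinner p y"
    by (subst (1 3) p_def) (simp add: cinner_simps)
  then have "inner p p = inner p y" by (simp add: inner_eq_Re_cinner)
  then have "(norm (y - p))\<^sup>2 = (norm y)\<^sup>2 - (norm p)\<^sup>2"
    by (simp add: power2_norm_eq_inner inner_simps inner_commute)
  then have "(norm (y - p))\<^sup>2 \<le> (norm y)\<^sup>2" by simp
  then show ?thesis unfolding p_def by (rule power2_le_imp_le) simp
qed

text \<open>Project onto the span of the centres of a finite \<open>\<eta>\<close>-net of the image of the unit ball: the residual of a
  vector is at most its distance to the nearest centre.\<close>

lemma compact_op_finite_rank_approx:
  assumes "compact_op K" "\<eta> > 0"
  obtains n :: nat and e where "\<And>y. norm (K y - (\<Sum>i<n. cinner (K y) (e i) *\<^sub>C e i)) \<le> \<eta> * norm y"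
proof -
  have K: "bounded_clinear K" "compact (closure (K ` cball 0 1))"
    using assms(1) by (auto simp: compact_op_def)
  obtain B where B: "finite B" "closure (K ` cball 0 1) \<subseteq> (\<Union>k\<in>B. ball k \<eta>)"
    using K(2) assms(2) unfolding compact_eq_totally_bounded by blast
  obtain n e where e: "orthonormal_family n e" "\<And>k. k \<in> B \<Longrightarrow> (\<Sum>i<n. cinner k (e i) *\<^sub>C e i) = k"
    using orthonormal_family_spanning[OF B(1)] by blast
  define R where "R y = y - (\<Sum>i<n. cinner y (e i) *\<^sub>C e i)" for y
  have R: "bounded_clinear R" unfolding R_def by (intro bounded_clinear_intros)
  have unit: "norm (R (K y)) \<le> \<eta>" if y: "norm y \<le> 1" for y
  proof -
    have "K y \<in> closure (K ` cball 0 1)" using y by (intro subsetD[OF closure_subset]) auto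
    then obtain k where k: "k \<in> B" "dist k (K y) < \<eta>" using B(2) by auto
    have "R k = 0" using e(2)[OF k(1)] by (simp add: R_def)
    then have "R (K y) = R (K y - k)" by (simp add: bounded_clinear_simps[OF R])
    also have "norm \<dots> \<le> norm (K y - k)" unfolding R_def by (rule orthonormal_residual_le[OF e(1)])
    finally show ?thesis using k(2) by (simp add: dist_norm norm_minus_commute)
  qed
  have "norm (R (K y)) \<le> \<eta> * norm y" for y
  proof (cases "y = 0")
    case False
    have "norm (R (K ((1 / norm y) *\<^sub>R y))) \<le> \<eta>" using False by (intro unit) simp
    moreover have "R (K ((1 / norm y) *\<^sub>R y)) = (1 / norm y) *\<^sub>R R (K y)"
      by (simp only: bounded_clinear_simps(6)[OF R] bounded_clinear_simps(6)[OF K(1)])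
    ultimately show ?thesis using False by (simp add: field_simps)
  qed (simp add: bounded_clinear_simps(3)[OF R] bounded_clinear_simps(3)[OF K(1)])
  then show thesis using that[of e n] by (simp add: R_def)
qed

section \<open>Square roots of positive operators\<close>

text \<open>The Cauchy--Schwarz inequality for the form of \<open>N\<close>, applied to \<open>x\<close> and \<open>N x\<close>.\<close>

lemma psd_norm_le:
  fixes N :: "'a::real_inner \<Rightarrow> 'a"
  assumes N: "linear N" and sym: "\<And>x y. inner (N x) y = inner x (N y)"
    and nonneg: "\<And>x. 0 \<le> inner (N x) x" and bound: "\<And>x. inner (N x) x \<le> C * (norm x)\<^sup>2"
  shows "(norm (N x))\<^sup>2 \<le> C * inner (N x) x"
proof (cases "N x = 0")
  case False
  define a where "a = inner (N x) x"
  define b where "b = inner (N (N x)) (N x)"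
  define n where "n = (norm (N x))\<^sup>2"
  have n: "n > 0" using False by (simp add: n_def)
  have b: "0 \<le> b" "b \<le> C * n" using nonneg bound by (auto simp: b_def n_def)
  have quad: "0 \<le> a - 2 * t * n + t\<^sup>2 * b" for t
  proof -
    have "0 \<le> inner (N (x - t *\<^sub>R N x)) (x - t *\<^sub>R N x)" by (rule nonneg)
    also have "\<dots> = a - 2 * t * n + t\<^sup>2 * b"
      using sym[of "N x" x] N
      by (simp add: linear_diff linear_scale inner_diff_left inner_diff_right a_def b_def n_def
          dot_square_norm power2_eq_square algebra_simps)
    finally show ?thesis .
  qed
  have "C * n \<ge> 0" using b by simp
  then have "C \<ge> 0" using n by (simp add: zero_le_mult_iff)
  show ?thesis
  proof (cases "b = 0")
    case True
    \<comment> \<open>For \<open>b = 0\<close> the quadratic polynomial is affine with slope \<open>- 2 * n < 0\<close>, so it takes the value \<open>- 1\<close>.\<close>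
    have "0 \<le> a - 2 * ((a + 1) / (2 * n)) * n" using quad[of "(a + 1) / (2 * n)"] True by simp
    also have "\<dots> = - 1" using n by (simp add: field_simps)
    finally show ?thesis by simp
  next
    case False
    then have bp: "b > 0" using b by simp
    have "0 \<le> a - 2 * (n / b) * n + (n / b)\<^sup>2 * b" by (rule quad)
    also have "\<dots> = a - n\<^sup>2 / b" using bp by (simp add: field_simps power2_eq_square)
    finally have "n\<^sup>2 \<le> a * b" using bp by (simp add: field_simps)
    also have "\<dots> \<le> a * (C * n)" using b(2) nonneg[of x] by (simp add: a_def mult_left_mono)
    finally have "n * n \<le> (C * a) * n" by (simp add: power2_eq_square ac_simps)
    then have "n \<le> C * a" using n by (rule mult_right_le_imp_le)
    then show ?thesis by (simp add: n_def a_def)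
  qed
next
  case True
  then show ?thesis by simp
qed

text \<open>The iteration solves \<open>Y = (B + Y\<^sup>2) / 2\<close>, that is \<open>(1 - Y)\<^sup>2 = 1 - B\<close>.\<close>

primrec sqrt_iter :: "('a::real_normed_vector \<Rightarrow> 'a) \<Rightarrow> nat \<Rightarrow> 'a \<Rightarrow> 'a" where
  "sqrt_iter B 0 x = 0"
| "sqrt_iter B (Suc n) x = (1/2) *\<^sub>R (B x + sqrt_iter B n (sqrt_iter B n x))"

text \<open>The iteration for the scalar \<open>B = 1\<close>. It is increasing and bounded, and its increments dominate those
  of the operator iteration.\<close>

primrec sqrt_majorant :: "nat \<Rightarrow> real" where
  "sqrt_majorant 0 = 0"
| "sqrt_majorant (Suc n) = (1 + (sqrt_majorant n)\<^sup>2) / 2"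

lemma sqrt_majorant_bounds: "0 \<le> sqrt_majorant n \<and> sqrt_majorant n \<le> 1"
proof (induction n)
  case (Suc n)
  then have "(sqrt_majorant n)\<^sup>2 \<le> 1" by (simp add: power_le_one)
  then show ?case by simp
qed simp

lemma sqrt_majorant_mono: "sqrt_majorant n \<le> sqrt_majorant (Suc n)"
proof -
  have "0 \<le> (1 - sqrt_majorant n)\<^sup>2" by simp
  then show ?thesis by (simp add: power2_diff)
qed

lemma sqrt_iter_linear: "linear B \<Longrightarrow> linear (sqrt_iter B n)"
proof (induction n)
  case 0
  then show ?case by (simp add: linear_iff)
next
  case (Suc n)
  then show ?case by (auto simp: linear_iff algebra_simps)
qed

lemma sqrt_iter_commute:
  assumes "linear C" "\<And>x. C (B x) = B (C x)"
  shows "C (sqrt_iter B n x) = sqrt_iter B n (C x)"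
  by (induction n arbitrary: x) (simp_all add: linear_scale linear_add linear_0 assms)

lemma sqrt_iter_norm:
  assumes "\<And>x. norm (B x) \<le> norm x"
  shows "norm (sqrt_iter B n x) \<le> sqrt_majorant n * norm x"
proof (induction n arbitrary: x)
  case (Suc n)
  have "norm (sqrt_iter B n (sqrt_iter B n x)) \<le> sqrt_majorant n * (sqrt_majorant n * norm x)"
    using Suc[of "sqrt_iter B n x"] mult_left_mono[OF Suc[of x]] sqrt_majorant_bounds[of n]
    by (meson order_trans)
  then have "norm (B x + sqrt_iter B n (sqrt_iter B n x)) \<le> (1 + (sqrt_majorant n)\<^sup>2) * norm x"
    using assms[of x] norm_triangle_ineq[of "B x" "sqrt_iter B n (sqrt_iter B n x)"]
    by (simp add: power2_eq_square algebra_simps)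
  then show ?case by simp
qed simp

text \<open>All iterates commute, so
  \<open>Q\<^sup>2 - P\<^sup>2 = (Q - P) (Q + P)\<close> for consecutive iterates, exactly as for the scalar majorant.\<close>

lemma sqrt_iter_step:
  assumes B: "linear B" "\<And>x. norm (B x) \<le> norm x"
  shows "norm (sqrt_iter B (Suc n) x - sqrt_iter B n x) \<le> (sqrt_majorant (Suc n) - sqrt_majorant n) * norm x"
proof (induction n arbitrary: x)
  case 0
  show ?case using B(2)[of x] by simp
next
  case (Suc n)
  define P where "P = sqrt_iter B n"
  define Q where "Q = sqrt_iter B (Suc n)"
  have lin: "linear P" "linear Q" using B(1) by (simp_all only: P_def Q_def sqrt_iter_linear)
  have PB: "P (B x) = B (P x)" for x unfolding P_def by (rule sqrt_iter_commute[OF B(1), symmetric]) (rule refl)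
  have QP: "P (Q x) = Q (P x)" for x unfolding Q_def by (rule sqrt_iter_commute[of P B, OF lin(1) PB])
  have "Q (Q x) - P (P x) = Q (Q x + P x) - P (Q x + P x)"
    using lin QP by (simp add: linear_add)
  also have "norm \<dots> \<le> (sqrt_majorant (Suc n) - sqrt_majorant n) * norm (Q x + P x)"
    using Suc[of "Q x + P x"] by (simp only: P_def Q_def)
  also have "\<dots> \<le> (sqrt_majorant (Suc n) - sqrt_majorant n) * ((sqrt_majorant (Suc n) + sqrt_majorant n) * norm x)"
  proof (rule mult_left_mono)
    show "norm (Q x + P x) \<le> (sqrt_majorant (Suc n) + sqrt_majorant n) * norm x"
      using norm_triangle_ineq[of "Q x" "P x"] sqrt_iter_norm[OF B(2), of "Suc n" x] sqrt_iter_norm[OF B(2), of n x]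
      unfolding P_def Q_def distrib_right by linarith
  qed (use sqrt_majorant_mono[of n] in linarith)
  finally have main: "norm (Q (Q x) - P (P x)) \<le> ((sqrt_majorant (Suc n))\<^sup>2 - (sqrt_majorant n)\<^sup>2) * norm x"
    by (simp only: power2_eq_square algebra_simps)
  have "sqrt_iter B (Suc (Suc n)) x - sqrt_iter B (Suc n) x = (1/2) *\<^sub>R (Q (Q x) - P (P x))"
    unfolding P_def Q_def sqrt_iter.simps(2)[of B "Suc n" x] sqrt_iter.simps(2)[of B n x]
    by (simp only: scaleR_diff_right[symmetric] add_diff_cancel_left)
  then have "norm (sqrt_iter B (Suc (Suc n)) x - sqrt_iter B (Suc n) x) = norm (Q (Q x) - P (P x)) / 2" by simp
  also have "\<dots> \<le> ((sqrt_majorant (Suc n))\<^sup>2 - (sqrt_majorant n)\<^sup>2) * norm x / 2" using main by simp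
  also have "\<dots> = (sqrt_majorant (Suc (Suc n)) - sqrt_majorant (Suc n)) * norm x"
    unfolding sqrt_majorant.simps(2)[of "Suc n"] sqrt_majorant.simps(2)[of n] by (simp add: field_simps)
  finally show ?case .
qed

lemma sqrt_iter_diff:
  assumes B: "linear B" "\<And>x. norm (B x) \<le> norm x" and "n \<le> m"
  shows "norm (sqrt_iter B m x - sqrt_iter B n x) \<le> (sqrt_majorant m - sqrt_majorant n) * norm x"
  using \<open>n \<le> m\<close>
proof (induction m rule: dec_induct)
  case (step m)
  have "norm (sqrt_iter B (Suc m) x - sqrt_iter B n x)
    \<le> norm (sqrt_iter B (Suc m) x - sqrt_iter B m x) + norm (sqrt_iter B m x - sqrt_iter B n x)"
    using norm_triangle_ineq[of "sqrt_iter B (Suc m) x - sqrt_iter B m x" "sqrt_iter B m x - sqrt_iter B n x"]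
    by (simp only: diff_add_cancel add_diff_eq)
  also have "\<dots> \<le> (sqrt_majorant (Suc m) - sqrt_majorant m) * norm x + (sqrt_majorant m - sqrt_majorant n) * norm x"
    using step.IH sqrt_iter_step[OF B, of m x] by (rule add_mono[rotated])
  also have "\<dots> = (sqrt_majorant (Suc m) - sqrt_majorant n) * norm x"
    by (simp only: distrib_right[symmetric]) simp
  finally show ?case .
qed simp

lemma sqrt_iter_limit:
  fixes B :: "'a::{real_normed_vector,complete_space} \<Rightarrow> 'a"
  assumes B: "linear B" "\<And>x. norm (B x) \<le> norm x"
  obtains Y where "\<And>x. (\<lambda>n. sqrt_iter B n x) \<longlonglongrightarrow> Y x" "\<And>x. norm (Y x) \<le> norm x"
    "\<And>x. 2 *\<^sub>R Y x = B x + Y (Y x)"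
proof -
  have "convergent sqrt_majorant"
    by (rule Bseq_mono_convergent)
       (auto intro!: BseqI'[of _ 1] lift_Suc_mono_le sqrt_majorant_mono simp: sqrt_majorant_bounds)
  then have maj: "Cauchy sqrt_majorant" by (rule convergent_Cauchy)
  have "Cauchy (\<lambda>n. sqrt_iter B n x)" for x
  proof (rule metric_CauchyI)
    fix e :: real assume e: "e > 0"
    have "norm x + 1 > 0" using norm_ge_zero[of x] by linarith
    with e obtain N where N: "\<And>m n. m \<ge> N \<Longrightarrow> n \<ge> N \<Longrightarrow> dist (sqrt_majorant m) (sqrt_majorant n) < e / (norm x + 1)"
      using metric_CauchyD[OF maj, of "e / (norm x + 1)"]
      by (meson divide_pos_pos)
    have lt: "dist (sqrt_iter B m x) (sqrt_iter B n x) < e" if "N \<le> n" "n \<le> m" for m n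
    proof -
      have "dist (sqrt_iter B m x) (sqrt_iter B n x) \<le> \<bar>sqrt_majorant m - sqrt_majorant n\<bar> * norm x"
        unfolding dist_norm using sqrt_iter_diff[OF B that(2), of x]
        by (meson abs_ge_self mult_right_mono norm_ge_zero order_trans)
      also have "\<dots> \<le> e / (norm x + 1) * norm x"
        using N[of m n] that by (intro mult_right_mono) (auto simp: dist_real_def)
      also have "\<dots> < e" using e \<open>norm x + 1 > 0\<close> by (simp add: pos_divide_less_eq algebra_simps)
      finally show ?thesis .
    qed
    show "\<exists>N. \<forall>m\<ge>N. \<forall>n\<ge>N. dist (sqrt_iter B m x) (sqrt_iter B n x) < e"
      using lt by (metis dist_commute nle_le)
  qed
  then have "\<exists>l. (\<lambda>n. sqrt_iter B n x) \<longlonglongrightarrow> l" for x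
    by (meson Cauchy_convergent convergentD)
  then obtain Y where Y: "\<And>x. (\<lambda>n. sqrt_iter B n x) \<longlonglongrightarrow> Y x" by metis
  have contr: "norm (sqrt_iter B n x) \<le> norm x" for n x
    using sqrt_iter_norm[OF B(2), of n x] sqrt_majorant_bounds[of n]
    by (meson mult_left_le_one_le norm_ge_zero order_trans)
  have nY: "norm (Y x) \<le> norm x" for x
    by (rule LIMSEQ_le_const2[OF tendsto_norm[OF Y[of x]]]) (use contr in auto)
  have "(\<lambda>n. sqrt_iter B n (sqrt_iter B n x)) \<longlonglongrightarrow> Y (Y x)" for x
  proof -
    have "(\<lambda>n. norm (sqrt_iter B n x - Y x)) \<longlonglongrightarrow> 0"
      using tendsto_norm_zero[OF LIM_zero[OF Y[of x]]] .
    then have "(\<lambda>n. sqrt_iter B n (sqrt_iter B n x - Y x)) \<longlonglongrightarrow> 0"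
      by (rule Lim_null_comparison[OF always_eventually, rotated]) (rule allI, rule contr)
    then have "(\<lambda>n. sqrt_iter B n (sqrt_iter B n x - Y x) + sqrt_iter B n (Y x)) \<longlonglongrightarrow> 0 + Y (Y x)"
      by (intro tendsto_add Y)
    then show ?thesis
      using sqrt_iter_linear[OF B(1)] by (simp add: linear_diff)
  qed
  then have "(\<lambda>n. sqrt_iter B (Suc n) x) \<longlonglongrightarrow> (1/2) *\<^sub>R (B x + Y (Y x))" for x
    unfolding sqrt_iter.simps(2) by (intro tendsto_scaleR tendsto_add tendsto_const)
  then have half: "Y x = (1/2) *\<^sub>R (B x + Y (Y x))" for x
    using LIMSEQ_unique[OF LIMSEQ_Suc[OF Y[of x]]] by blast
  have "2 *\<^sub>R Y x = B x + Y (Y x)" for x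
    by (subst (1) half) simp
  with Y nY show thesis using that by blast
qed

text \<open>If \<open>A \<le> c\<close> then \<open>B = 1 - A / c\<close> is a positive contraction, and the limit \<open>Y\<close> of the iteration gives
  the root \<open>J = sqrt c (1 - Y)\<close>. Everything that commutes with \<open>A\<close> commutes with the iterates,
  in particular multiplication by complex scalars, which yields complex linearity of \<open>J\<close>.\<close>

lemma positive_sqrt_exists:
  fixes A :: "'a::chilbert_space \<Rightarrow> 'a"
  assumes A: "bounded_clinear A" and sym: "\<And>x y. inner (A x) y = inner x (A y)"
    and nonneg: "\<And>x. 0 \<le> inner (A x) x"
  obtains J where "bounded_clinear J" "\<And>x. J (J x) = A x" "\<And>x y. inner (J x) y = inner x (J y)"
    "\<And>x. 0 \<le> inner (J x) x"
    "\<And>C x. bounded_linear C \<Longrightarrow> (\<And>x. C (A x) = A (C x)) \<Longrightarrow> C (J x) = J (C x)"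
proof -
  obtain c where c: "c > 0" "\<And>x. norm (A x) \<le> c * norm x" using bounded_clinear_bound[OF A] by blast
  define B where "B x = x - (1/c) *\<^sub>R A x" for x
  have Blin: "linear B" unfolding B_def
    using bounded_clinear_linear[OF A]
    by (intro linear_compose_sub linear_ident linear_compose_scale_right bounded_linear.linear)
  have Bsym: "inner (B x) y = inner x (B y)" for x y
    by (simp add: B_def inner_diff_left inner_diff_right sym)
  have Ac: "inner (A x) x \<le> c * (norm x)\<^sup>2" for x
    using norm_cauchy_schwarz[of "A x" x] mult_right_mono[OF c(2)[of x] norm_ge_zero[of x]]
    by (simp add: power2_eq_square)
  have Bform: "inner (B x) x = (norm x)\<^sup>2 - inner (A x) x / c" for x
    by (simp add: B_def inner_diff_left power2_norm_eq_inner)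
  have Bpos: "0 \<le> inner (B x) x" for x using Ac[of x] c(1) by (simp add: Bform field_simps)
  have Bup: "inner (B x) x \<le> 1 * (norm x)\<^sup>2" for x using nonneg[of x] c(1) by (simp add: Bform)
  have Bcontr: "norm (B x) \<le> norm x" for x
  proof -
    have "(norm (B x))\<^sup>2 \<le> 1 * inner (B x) x" by (rule psd_norm_le[OF Blin Bsym Bpos Bup])
    also have "\<dots> \<le> (norm x)\<^sup>2" using Bup[of x] by simp
    finally show ?thesis by (rule power2_le_imp_le) simp
  qed
  obtain Y where Y: "\<And>x. (\<lambda>n. sqrt_iter B n x) \<longlonglongrightarrow> Y x" "\<And>x. norm (Y x) \<le> norm x"
    "\<And>x. 2 *\<^sub>R Y x = B x + Y (Y x)"
    using sqrt_iter_limit[OF Blin Bcontr] by blast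
  have Yadd: "Y (x + y) = Y x + Y y" for x y
    using tendsto_add[OF Y(1)[of x] Y(1)[of y]] Y(1)[of "x + y"] sqrt_iter_linear[OF Blin]
    by (simp add: linear_add) (metis LIMSEQ_unique)
  have Ycomm: "C (Y x) = Y (C x)" if C: "bounded_linear C" "\<And>x. C (A x) = A (C x)" for C x
  proof -
    have CB: "C (B x) = B (C x)" for x using C by (simp add: B_def linear_simps)
    have "(\<lambda>n. C (sqrt_iter B n x)) \<longlonglongrightarrow> C (Y x)" by (rule bounded_linear.tendsto[OF C(1) Y(1)])
    then have "(\<lambda>n. sqrt_iter B n (C x)) \<longlonglongrightarrow> C (Y x)"
      using sqrt_iter_commute[of C B, OF bounded_linear.linear[OF C(1)] CB] by simp
    then show ?thesis using Y(1)[of "C x"] LIMSEQ_unique by blast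
  qed
  have Yscale: "Y (k *\<^sub>C x) = k *\<^sub>C Y x" for k x
    using Ycomm[OF bounded_linear_scaleC, of k x] bounded_clinear_simps(5)[OF A] by simp
  have Yclin: "bounded_clinear Y"
    using Yadd Yscale Y(2) by (intro bounded_clinearI[where C=1]) auto
  have iter_sym: "inner (sqrt_iter B n x) y = inner x (sqrt_iter B n y)" for n x y
    by (induction n arbitrary: x y) (simp_all add: inner_add_left inner_add_right Bsym)
  have Ysym: "inner (Y x) y = inner x (Y y)" for x y
  proof (rule LIMSEQ_unique)
    show "(\<lambda>n. inner (sqrt_iter B n x) y) \<longlonglongrightarrow> inner (Y x) y" by (intro tendsto_inner Y tendsto_const)
    show "(\<lambda>n. inner (sqrt_iter B n x) y) \<longlonglongrightarrow> inner x (Y y)"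
      unfolding iter_sym by (intro tendsto_inner Y tendsto_const)
  qed
  define J where "J x = sqrt c *\<^sub>R (x - Y x)" for x
  have Jclin: "bounded_clinear J"
    unfolding J_def using Yclin by (intro bounded_clinear_intros)
  have JJ: "J (J x) = A x" for x
  proof -
    have "J (J x) = (sqrt c * sqrt c) *\<^sub>R (x - Y x - (Y x - Y (Y x)))"
      by (simp add: J_def bounded_clinear_simps(2,6)[OF Yclin] scaleR_diff_right)
    also have "\<dots> = c *\<^sub>R (x - 2 *\<^sub>R Y x + Y (Y x))"
      using c(1) by (simp add: scaleR_2 algebra_simps)
    also have "\<dots> = c *\<^sub>R (x - B x)" by (simp add: Y(3))
    also have "\<dots> = A x" using c(1) by (simp add: B_def)
    finally show ?thesis .
  qed
  have Jsym: "inner (J x) y = inner x (J y)" for x y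
    by (simp add: J_def inner_diff_left inner_diff_right Ysym)
  have Jpos: "0 \<le> inner (J x) x" for x
  proof -
    have "inner (Y x) x \<le> (norm x)\<^sup>2"
      using norm_cauchy_schwarz[of "Y x" x] mult_right_mono[OF Y(2)[of x] norm_ge_zero[of x]]
      by (simp add: power2_eq_square)
    then show ?thesis using c(1) by (simp add: J_def inner_diff_left power2_norm_eq_inner)
  qed
  have Jcomm: "C (J x) = J (C x)" if C: "bounded_linear C" "\<And>x. C (A x) = A (C x)" for C x
    using Ycomm[OF C] C(1) by (simp add: J_def linear_simps)
  show thesis by (rule that[OF Jclin JJ Jsym Jpos Jcomm])
qed

text \<open>For \<open>d = (P - Q) x\<close> commutation gives \<open>(P + Q) d = 0\<close>; both forms are nonnegative, hence
  \<open>P d = Q d = 0\<close> and \<open>|d|\<^sup>2 = inner x ((P - Q) d) = 0\<close>.\<close>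

lemma positive_sqrt_unique:
  fixes P Q :: "'a::real_inner \<Rightarrow> 'a"
  assumes P: "bounded_linear P" "\<And>x y. inner (P x) y = inner x (P y)" "\<And>x. 0 \<le> inner (P x) x"
    and Q: "bounded_linear Q" "\<And>x y. inner (Q x) y = inner x (Q y)" "\<And>x. 0 \<le> inner (Q x) x"
    and eq: "\<And>x. P (P x) = Q (Q x)" and comm: "\<And>x. P (Q x) = Q (P x)"
  shows "P x = Q x"
proof -
  define d where "d = P x - Q x"
  have zero: "N d = 0" if N: "bounded_linear N" "\<And>x y. inner (N x) y = inner x (N y)" "\<And>x. 0 \<le> inner (N x) x"
      and Nd: "inner (N d) d = 0" for N
  proof -
    obtain K where K: "\<And>x. norm (N x) \<le> norm x * K"
      using bounded_linear.bounded[OF N(1)] by blast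
    have "inner (N x) x \<le> K * (norm x)\<^sup>2" for x
      using norm_cauchy_schwarz[of "N x" x] mult_right_mono[OF K[of x] norm_ge_zero[of x]]
      by (simp add: power2_eq_square ac_simps)
    then have "(norm (N d))\<^sup>2 \<le> K * inner (N d) d"
      using psd_norm_le[OF bounded_linear.linear[OF N(1)] N(2,3)] by blast
    then show ?thesis using Nd by simp
  qed
  have "P d + Q d = 0"
    using P(1) Q(1) by (simp add: d_def linear_simps eq comm)
  then have "inner (P d) d + inner (Q d) d = 0" by (simp add: inner_add_left[symmetric])
  then have "inner (P d) d = 0" "inner (Q d) d = 0" using P(3)[of d] Q(3)[of d] by linarith+
  then have "P d = 0" "Q d = 0" using zero P Q by auto
  then have "inner d d = 0"
    by (subst (1) d_def) (simp add: inner_diff_left P(2) Q(2))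
  then show ?thesis by (simp add: d_def)
qed

section \<open>The inverse square root of the unbounded operator\<close>

lemma cinner_dense_eqI:
  assumes "closure D = UNIV" "\<And>x. x \<in> D \<Longrightarrow> cinner x z = cinner x z'"
  shows "z = (z' :: 'a::chilbert_space)"
proof -
  have "closed {x. cinner x z = cinner x z'}"
    by (intro closed_Collect_eq linear_continuous_on bounded_linear_cinner_left)
  then have "closure D \<subseteq> {x. cinner x z = cinner x z'}"
    using assms(2) by (intro closure_minimal) auto
  then have "cinner x z = cinner x z'" for x using assms(1) by auto
  then have "cinner z x = cinner z' x" for x by (metis cinner_commute)
  then show ?thesis by (rule cinner_eqI)
qed

lemma adjoint_op_eq_Some_iff:
  assumes "densely_defined A"
  shows "adjoint_op A y = Some z \<longleftrightarrow> (\<forall>x\<in>dom A. cinner (the (A x)) y = cinner x z)"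
proof -
  have uniq: "z = z'" if "\<forall>x\<in>dom A. cinner (the (A x)) y = cinner x z"
      "\<forall>x\<in>dom A. cinner (the (A x)) y = cinner x z'" for z z'
    using cinner_dense_eqI[of "dom A" z z'] that assms by (auto simp: densely_defined_def)
  show ?thesis
  proof (cases "\<exists>w. \<forall>x\<in>dom A. cinner (the (A x)) y = cinner x w")
    case True
    then obtain w where w: "\<forall>x\<in>dom A. cinner (the (A x)) y = cinner x w" by (elim exE)
    have "adjoint_op A y = Some (THE w. \<forall>x\<in>dom A. cinner (the (A x)) y = cinner x w)"
      unfolding adjoint_op_def by (rule if_P) (rule True)
    also have "(THE w. \<forall>x\<in>dom A. cinner (the (A x)) y = cinner x w) = w"
      using w uniq by (intro the_equality)
    finally have adj: "adjoint_op A y = Some w" .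
    show ?thesis
    proof
      assume "adjoint_op A y = Some z"
      with adj have "w = z" by (simp only: option.inject)
      with w show "\<forall>x\<in>dom A. cinner (the (A x)) y = cinner x z" by (simp only:)
    next
      assume "\<forall>x\<in>dom A. cinner (the (A x)) y = cinner x z"
      with w have "w = z" by (rule uniq)
      with adj show "adjoint_op A y = Some z" by (simp only:)
    qed
  next
    case False
    then have "adjoint_op A y = None" unfolding adjoint_op_def by (rule if_not_P)
    moreover have "\<not> (\<forall>x\<in>dom A. cinner (the (A x)) y = cinner x z)"
      using False by (rule contrapos_nn) (rule exI)
    ultimately show ?thesis by (simp only: option.distinct)
  qed
qed

lemma selfadjoint_op_symmetric:
  assumes "selfadjoint_op A" "x \<in> dom A" "y \<in> dom A"
  shows "cinner (the (A x)) y = cinner x (the (A y))"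
proof -
  have "adjoint_op A y = Some (the (A y))" using assms by (auto simp: selfadjoint_op_def)
  then show ?thesis using assms adjoint_op_eq_Some_iff[of A y] by (auto simp: selfadjoint_op_def)
qed

lemma selfadjoint_op_maximal:
  assumes "selfadjoint_op A" "\<And>x. x \<in> dom A \<Longrightarrow> cinner (the (A x)) y = cinner x z"
  shows "A y = Some z"
  using assms adjoint_op_eq_Some_iff[of A y z] by (auto simp: selfadjoint_op_def)

lemma linear_op_simps:
  assumes "linear_op A"
  shows "x \<in> dom A \<Longrightarrow> y \<in> dom A \<Longrightarrow> x + y \<in> dom A"
    "x \<in> dom A \<Longrightarrow> c *\<^sub>C x \<in> dom A" "0 \<in> dom A"
    "x \<in> dom A \<Longrightarrow> y \<in> dom A \<Longrightarrow> the (A (x + y)) = the (A x) + the (A y)"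
    "x \<in> dom A \<Longrightarrow> the (A (c *\<^sub>C x)) = c *\<^sub>C the (A x)"
    "x \<in> dom A \<Longrightarrow> y \<in> dom A \<Longrightarrow> x - y \<in> dom A"
    "x \<in> dom A \<Longrightarrow> y \<in> dom A \<Longrightarrow> the (A (x - y)) = the (A x) - the (A y)"
    "the (A 0) = 0"
proof -
  have S: "cvs.subspace (dom A)" using assms by (simp add: linear_op_def)
  show add: "x + y \<in> dom A" if "x \<in> dom A" "y \<in> dom A" for x y
    using cvs.subspace_add[OF S that] .
  show sc: "c *\<^sub>C x \<in> dom A" if "x \<in> dom A" for c x using cvs.subspace_scale[OF S that] .
  show zero: "0 \<in> dom A" using cvs.subspace_0[OF S] .
  show Aadd: "the (A (x + y)) = the (A x) + the (A y)" if "x \<in> dom A" "y \<in> dom A" for x y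
    using assms that by (auto simp: linear_op_def)
  show Asc: "the (A (c *\<^sub>C x)) = c *\<^sub>C the (A x)" if "x \<in> dom A" for c x
    using assms that by (auto simp: linear_op_def)
  have neg: "- v = (-1) *\<^sub>C v" for v :: 'a by simp
  show "x - y \<in> dom A" if "x \<in> dom A" "y \<in> dom A" for x y
    using add[OF that(1) sc[OF that(2), of "-1"]] by simp
  show "the (A (x - y)) = the (A x) - the (A y)" if "x \<in> dom A" "y \<in> dom A" for x y
    using Aadd[OF that(1) sc[OF that(2), of "-1"]] Asc[OF that(2), of "-1"] by simp
  show "the (A 0) = 0" using Asc[OF zero, of 0] by simp
qed

text \<open>The range is closed because \<open>H\<close> is bounded below and closed, being an adjoint; it is dense because
  the orthogonal complement of the range is the kernel of the adjoint, and \<open>H\<close> is injective.\<close>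

lemma selfadjoint_uniformly_positive_bij:
  fixes H :: "'a::chilbert_space \<rightharpoonup> 'a"
  assumes H: "selfadjoint_op H" and pos: "uniformly_positive_on (dom H) (\<lambda>x. the (H x))"
  shows "bij_betw (\<lambda>x. the (H x)) (dom H) UNIV"
    and "\<exists>C. \<forall>x\<in>dom H. norm x \<le> C * norm (the (H x))"
proof -
  have lin: "linear_op H" and dd: "densely_defined H" using H by (auto simp: selfadjoint_op_def)
  obtain \<epsilon> where eps: "\<epsilon> > 0" "\<And>x. x \<in> dom H \<Longrightarrow> complex_of_real (\<epsilon> * (norm x)\<^sup>2) \<le> cinner (the (H x)) x"
    using pos by (auto simp: uniformly_positive_on_def)
  have lower: "\<epsilon> * norm x \<le> norm (the (H x))" if "x \<in> dom H" for x
  proof (cases "x = 0")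
    case False
    have "\<epsilon> * (norm x)\<^sup>2 \<le> Re (cinner (the (H x)) x)" using eps(2)[OF that] by (simp add: less_eq_complex_def)
    also have "\<dots> \<le> norm (the (H x)) * norm x"
      using Cauchy_Schwarz_cinner complex_Re_le_cmod order_trans by blast
    finally show ?thesis using False by (simp add: power2_eq_square)
  qed simp
  then show "\<exists>C. \<forall>x\<in>dom H. norm x \<le> C * norm (the (H x))"
    using eps(1) by (intro exI[of _ "1 / \<epsilon>"]) (auto simp: field_simps)
  have inj: "inj_on (\<lambda>x. the (H x)) (dom H)"
  proof (rule inj_onI)
    fix x y assume "x \<in> dom H" "y \<in> dom H" "the (H x) = the (H y)"
    then have "\<epsilon> * norm (x - y) \<le> 0"
      using lower[of "x - y"] linear_op_simps[OF lin] by simp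
    then show "x = y" using eps(1) by (simp add: mult_le_0_iff)
  qed
  define M where "M = (\<lambda>x. the (H x)) ` dom H"
  have Msub: "subspace M"
  proof (rule subspaceI)
    show "0 \<in> M" unfolding M_def using linear_op_simps(3,8)[OF lin] by (metis image_eqI)
    show "u + v \<in> M" if "u \<in> M" "v \<in> M" for u v
      using that linear_op_simps(1,4)[OF lin] unfolding M_def by (smt (verit) image_iff)
    show "r *\<^sub>R u \<in> M" if u: "u \<in> M" for r u
    proof -
      obtain x where x: "x \<in> dom H" "u = the (H x)" using u unfolding M_def by blast
      have "r *\<^sub>R u = the (H (of_real r *\<^sub>C x))"
        by (subst linear_op_simps(5)[OF lin x(1)]) (simp only: x(2) scaleC_of_real)
      moreover have "of_real r *\<^sub>C x \<in> dom H" by (rule linear_op_simps(2)[OF lin x(1)])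
      ultimately show ?thesis unfolding M_def by (rule image_eqI)
    qed
  qed
  have "closed M"
    unfolding closed_sequential_limits
  proof (intro allI impI, elim conjE)
    fix s l assume s: "\<forall>n. s n \<in> M" "s \<longlonglongrightarrow> l"
    have "\<forall>n. \<exists>x. x \<in> dom H \<and> s n = the (H x)" using s(1) unfolding M_def image_iff by blast
    then obtain x where x: "\<And>n. x n \<in> dom H" "\<And>n. s n = the (H (x n))" by metis
    have "Cauchy x"
    proof (rule metric_CauchyI)
      fix e :: real assume e: "e > 0"
      then obtain N where N: "\<And>m n. N \<le> m \<Longrightarrow> N \<le> n \<Longrightarrow> dist (s m) (s n) < \<epsilon> * e"
        using metric_CauchyD[OF LIMSEQ_imp_Cauchy[OF s(2)], of "\<epsilon> * e"] eps(1) by auto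
      have "dist (x m) (x n) < e" if "N \<le> m" "N \<le> n" for m n
      proof -
        have "\<epsilon> * norm (x m - x n) \<le> norm (s m - s n)"
          using lower[of "x m - x n"] linear_op_simps(6,7)[OF lin x(1) x(1)] by (simp add: x(2))
        then have "\<epsilon> * norm (x m - x n) < \<epsilon> * e" using N[OF that] by (simp add: dist_norm)
        then show ?thesis using eps(1) by (simp add: dist_norm)
      qed
      then show "\<exists>N. \<forall>m\<ge>N. \<forall>n\<ge>N. dist (x m) (x n) < e" by blast
    qed
    then obtain y where y: "x \<longlonglongrightarrow> y" by (meson Cauchy_convergent convergentD)
    have "H y = Some l"
    proof (rule selfadjoint_op_maximal[OF H])
      fix u assume u: "u \<in> dom H"
      have "(\<lambda>n. cinner (the (H u)) (x n)) \<longlonglongrightarrow> cinner (the (H u)) y"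
        by (intro tendsto_cinner tendsto_const y)
      moreover have "(\<lambda>n. cinner (the (H u)) (x n)) \<longlonglongrightarrow> cinner u l"
        unfolding selfadjoint_op_symmetric[OF H u x(1)] x(2)[symmetric]
        by (intro tendsto_cinner tendsto_const s(2))
      ultimately show "cinner (the (H u)) y = cinner u l" by (rule LIMSEQ_unique)
    qed
    then show "l \<in> M" unfolding M_def by (metis domI image_eqI option.sel)
  qed
  moreover have "closure M = UNIV"
  proof (rule dense_if_orthogonal_complement_trivial[OF Msub])
    fix z assume z: "\<And>m. m \<in> M \<Longrightarrow> inner z m = 0"
    have "cinner (the (H x)) z = cinner x 0" if x: "x \<in> dom H" for x
    proof -
      have "the (H x) \<in> M" "the (H (\<i> *\<^sub>C x)) \<in> M"
        using x linear_op_simps(2)[OF lin] by (auto simp: M_def)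
      then have "inner (the (H x)) z = 0" "inner (\<i> *\<^sub>C the (H x)) z = 0"
        using z linear_op_simps(5)[OF lin x] by (metis inner_commute)+
      then show ?thesis by (simp add: inner_eq_Re_cinner cinner_scaleC_left complex_eq_iff)
    qed
    then have "H z = Some 0" by (rule selfadjoint_op_maximal[OF H])
    then have "\<epsilon> * norm z \<le> 0" using lower[of z] by auto
    then show "z = 0" using eps(1) by (simp add: mult_le_0_iff)
  qed
  ultimately have "M = UNIV" by simp
  then show "bij_betw (\<lambda>x. the (H x)) (dom H) UNIV"
    using inj by (simp add: bij_betw_def M_def)
qed

text \<open>\<open>J\<close> stands for \<open>H\<^sup>-\<^sup>1\<^sup>/\<^sup>2\<close>. Through the commutation property \<open>J\<close> commutes with the inverse of
  any other square root of \<open>H\<close>; this is what identifies \<open>sqrt_op H\<close> with the inverse of \<open>J\<close>.\<close>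

locale inverse_sqrt =
  fixes H :: "'a::chilbert_space \<rightharpoonup> 'a" and J :: "'a \<Rightarrow> 'a"
  assumes selfadjoint: "selfadjoint_op H"
    and bij_H: "bij_betw (\<lambda>x. the (H x)) (dom H) UNIV"
    and clin: "bounded_clinear J"
    and sym: "cinner (J x) y = cinner x (J y)"
    and nonneg: "0 \<le> inner (J x) x"
    and JJ: "J (J x) = inv_op H x"
    and commute: "bounded_linear C \<Longrightarrow> (\<And>x. C (inv_op H x) = inv_op H (C x)) \<Longrightarrow> C (J x) = J (C x)"
begin

lemmas J_simps = bounded_clinear_simps[OF clin]

lemma linear_H: "linear_op H"
  using selfadjoint by (simp add: selfadjoint_op_def)

lemma inv_in_dom: "J (J x) \<in> dom H"
  unfolding JJ inv_op_def using bij_H by (metis UNIV_I bij_betw_def inv_into_into)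

lemma H_JJ: "the (H (J (J x))) = x"
  unfolding JJ inv_op_def using bij_H by (metis UNIV_I bij_betw_inv_into_right)

lemma JJ_H: "x \<in> dom H \<Longrightarrow> J (J (the (H x))) = x"
  unfolding JJ inv_op_def using bij_H by (metis bij_betw_inv_into_left)

lemma dom_H: "dom H = range (\<lambda>x. J (J x))"
  using inv_in_dom JJ_H by (auto simp: image_iff) (metis domI)

lemma H_eq_Some_iff: "H x = Some y \<longleftrightarrow> x = J (J y)"
  using inv_in_dom[of y] H_JJ[of y] JJ_H[of x] by (metis domI domIff option.collapse option.sel)

lemma inner_sym: "inner (J x) y = inner x (J y)"
  using sym by (simp add: inner_eq_Re_cinner)

lemma inj_J: "inj J"
proof (rule injI)
  fix x y assume "J x = J y"
  then show "x = y" by (metis H_JJ)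
qed

lemma J_eq_iff: "J x = J y \<longleftrightarrow> x = y"
  using inj_J by (auto dest: injD)

lemma subspace_range: "subspace (range J)"
  using clin by (simp add: bounded_clinear_def bounded_linear.linear linear_subspace_image)

lemma dense_range: "closure (range J) = UNIV"
proof (rule dense_if_orthogonal_complement_trivial[OF subspace_range])
  fix z assume "\<And>m. m \<in> range J \<Longrightarrow> inner z m = 0"
  from this[of "J (J z)"] have "inner (J z) (J z) = 0" by (simp add: inner_sym)
  then show "z = 0" using J_eq_iff[of z 0] by (simp add: J_simps)
qed

lemma dense_range_JJ: "closure (range (\<lambda>x. J (J x))) = UNIV"
  using selfadjoint by (simp add: dom_H[symmetric] selfadjoint_op_def densely_defined_def)

text \<open>The operator \<open>H\<^sup>1\<^sup>/\<^sup>2\<close>, as the inverse of \<open>J\<close>.\<close>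

definition R :: "'a \<rightharpoonup> 'a" where
  "R x = (if x \<in> range J then Some (inv_into UNIV J x) else None)"

lemma R_eq_Some_iff: "R x = Some y \<longleftrightarrow> x = J y"
  using inj_J by (auto simp: R_def)

lemma dom_R: "dom R = range J"
  by (auto simp: dom_def R_eq_Some_iff)

lemma R_J: "R (J y) = Some y"
  by (simp add: R_eq_Some_iff)

lemma linear_R: "linear_op R"
  unfolding linear_op_def dom_R
proof (intro conjI ballI allI)
  show "cvs.subspace (range J)"
    unfolding cvs.subspace_def
  proof (intro conjI ballI allI)
    show "0 \<in> range J" using J_simps(3) by (metis rangeI)
  qed (auto simp: J_simps(1,5)[symmetric])
  show "the (R (x + y)) = the (R x) + the (R y)" if "x \<in> range J" "y \<in> range J" for x y
    using that by (auto simp: J_simps(1)[symmetric] R_J)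
  show "the (R (c *\<^sub>C x)) = c *\<^sub>C the (R x)" if "x \<in> range J" for c x
    using that by (auto simp: J_simps(5)[symmetric] R_J)
qed

lemma densely_defined_R: "densely_defined R"
  using dense_range by (simp add: densely_defined_def dom_R)

lemma selfadjoint_R: "selfadjoint_op R"
  unfolding selfadjoint_op_def
proof (intro conjI linear_R densely_defined_R)
  have "adjoint_op R y = Some z \<longleftrightarrow> R y = Some z" for y z
  proof -
    have "adjoint_op R y = Some z \<longleftrightarrow> (\<forall>u. cinner u y = cinner (J u) z)"
      unfolding adjoint_op_eq_Some_iff[OF densely_defined_R] dom_R by (auto simp: R_J)
    also have "\<dots> \<longleftrightarrow> y = J z"
      unfolding sym using cinner_eqI[of y "J z"] by (metis cinner_commute)
    finally show ?thesis by (simp add: R_eq_Some_iff)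
  qed
  then show "adjoint_op R = R"
    by (intro ext) (metis not_None_eq)
qed

lemma J_form: "cinner (J x) x = of_real (inner (J x) x)"
proof -
  have "Im (cinner (J x) x) = 0"
    using arg_cong[OF cinner_commute[of "J x" x], of Im] by (simp add: sym)
  then show ?thesis by (simp add: complex_eq_iff inner_eq_Re_cinner)
qed

lemma nonneg_R: "nonneg_on (dom R) (\<lambda>x. the (R x))"
  using nonneg by (auto simp: nonneg_on_def dom_R R_J sym[symmetric] J_form less_eq_complex_def)

lemma R_comp_R: "R \<circ>\<^sub>m R = H"
proof
  fix x
  have "(R \<circ>\<^sub>m R) x = Some y \<longleftrightarrow> H x = Some y" for y
    by (auto simp: map_comp_Some_iff R_eq_Some_iff H_eq_Some_iff)
  then show "(R \<circ>\<^sub>m R) x = H x" by (metis not_None_eq)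
qed

text \<open>A nonnegative self-adjoint root \<open>Q\<close> of \<open>H\<close> has a bounded inverse \<open>K\<close> with \<open>K\<^sup>2 = J\<^sup>2\<close>. Since \<open>K\<close>
  commutes with \<open>K\<^sup>2\<close>, it commutes with \<open>J\<close>, so uniqueness of bounded positive roots applies.\<close>

lemma root_unique:
  assumes Q: "selfadjoint_op Q" "nonneg_on (dom Q) (\<lambda>x. the (Q x))" "Q \<circ>\<^sub>m Q = H"
  shows "Q = R"
proof -
  have lin: "linear_op Q" using Q(1) by (simp add: selfadjoint_op_def)
  have HQ: "H x = Some y \<longleftrightarrow> (\<exists>v. Q x = Some v \<and> Q v = Some y)" for x y
    using Q(3) by (auto simp: map_comp_Some_iff dest: fun_cong[where x=x])
  have kernel: "v = 0" if "Q v = Some 0" for v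
  proof -
    have "Q 0 = Some 0" using linear_op_simps(3,8)[OF lin] by auto
    with that have "H v = Some 0" by (auto simp: HQ)
    then show ?thesis by (simp add: H_eq_Some_iff J_simps)
  qed
  have inj: "u = v" if "Q u = Some h" "Q v = Some h" for u v h
  proof -
    have "u \<in> dom Q" "v \<in> dom Q" using that by auto
    then have "u - v \<in> dom Q" "the (Q (u - v)) = 0"
      using linear_op_simps(6,7)[OF lin, of u v] that by auto
    then have "Q (u - v) = Some 0" by auto
    then show ?thesis using kernel by force
  qed
  have "\<exists>v. Q v = Some h" for h
    using HQ[of "J (J h)" h] by (auto simp: H_eq_Some_iff)
  then obtain K where K: "\<And>h. Q (K h) = Some h" by metis
  have QK: "Q x = Some y \<longleftrightarrow> x = K y" for x y using inj K by blast
  have Kdom: "K h \<in> dom Q" for h using K by blast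
  have KK: "K (K h) = J (J h)" for h
    using HQ[of "K (K h)" h] K by (simp add: H_eq_Some_iff)
  have Ksym: "cinner (K h) g = cinner h (K g)" for h g
    using selfadjoint_op_symmetric[OF Q(1) Kdom[of h] Kdom[of g]] K by simp
  obtain C where C: "C > 0" "\<And>x. norm (J x) \<le> C * norm x" using bounded_clinear_bound[OF clin] by blast
  have Kclin: "bounded_clinear K"
  proof (rule bounded_clinearI)
    show "K (x + y) = K x + K y" for x y
    proof -
      have "Q (K x + K y) = Some (x + y)"
        using linear_op_simps(1,4)[OF lin Kdom[of x] Kdom[of y]] by (auto simp: K)
      then show ?thesis by (simp only: QK)
    qed
    show "K (c *\<^sub>C x) = c *\<^sub>C K x" for c x
    proof -
      have "Q (c *\<^sub>C K x) = Some (c *\<^sub>C x)"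
        using linear_op_simps(2,5)[OF lin Kdom[of x], of c] by (auto simp: K)
      then show ?thesis by (simp only: QK)
    qed
    show "norm (K x) \<le> C * norm x" for x
    proof -
      have "cinner (K x) (K x) = cinner (J x) (J x)" unfolding Ksym sym KK ..
      then have "(norm (K x))\<^sup>2 = (norm (J x))\<^sup>2" unfolding cinner_self of_real_eq_iff .
      then have "norm (K x) = norm (J x)" by simp
      then show ?thesis using C(2) by simp
    qed
  qed
  have "K (inv_op H x) = inv_op H (K x)" for x by (simp only: JJ[symmetric] KK[symmetric])
  then have JK: "J (K x) = K (J x)" for x
    using commute[of K x] Kclin by (simp only: bounded_clinear_def)
  have "J x = K x" for x
  proof (rule positive_sqrt_unique[of J K])
    show "bounded_linear J" "bounded_linear K" using clin Kclin by (auto simp: bounded_clinear_def)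
    show "J (J x) = K (K x)" for x by (simp add: KK)
    show "J (K x) = K (J x)" for x by (rule JK)
    show "inner (K x) y = inner x (K y)" for x y using Ksym by (simp add: inner_eq_Re_cinner)
    show "0 \<le> inner (K x) x" for x
    proof -
      have "0 \<le> cinner (the (Q (K x))) (K x)" using Q(2) Kdom[of x] unfolding nonneg_on_def by blast
      then show ?thesis by (simp add: K inner_eq_Re_cinner Ksym less_eq_complex_def)
    qed
  qed (rule inner_sym nonneg)+
  then have "Q x = Some y \<longleftrightarrow> R x = Some y" for x y by (simp add: QK R_eq_Some_iff)
  then show ?thesis by (intro ext) (metis not_None_eq)
qed

lemma sqrt_op_eq: "sqrt_op H = R"
  unfolding sqrt_op_def
proof (rule the_equality)
  show "selfadjoint_op R \<and> nonneg_on (dom R) (\<lambda>x. the (R x)) \<and> R \<circ>\<^sub>m R = H"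
    by (intro conjI selfadjoint_R nonneg_R R_comp_R)
qed (elim conjE, rule root_unique)

lemma space1_eq: "space1 H = range J"
  by (simp add: space1_def sqrt_op_eq dom_R)

lemma norm1_J [simp]: "norm1 H (J y) = norm y"
  by (simp add: norm1_def sqrt_op_eq R_J)

end

lemma inverse_sqrt_exists:
  fixes H :: "'a::chilbert_space \<rightharpoonup> 'a"
  assumes H: "selfadjoint_op H" and pos: "uniformly_positive_on (dom H) (\<lambda>x. the (H x))"
  obtains J where "inverse_sqrt H J"
proof -
  define A where "A = inv_op H"
  have lin: "linear_op H" using H by (simp add: selfadjoint_op_def)
  note bij = selfadjoint_uniformly_positive_bij[OF H pos]
  have A_dom: "A x \<in> dom H" and HA: "the (H (A x)) = x" for x
    unfolding A_def inv_op_def using bij(1) by (metis UNIV_I bij_betw_def inv_into_into, metis UNIV_I bij_betw_inv_into_right)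
  have A_eqI: "A h = x" if "x \<in> dom H" "the (H x) = h" for h x
    using bij_betw_inv_into_left[OF bij(1) that(1)] that(2) by (simp add: A_def inv_op_def)
  obtain C where C: "\<And>x. x \<in> dom H \<Longrightarrow> norm x \<le> C * norm (the (H x))" using bij(2) by blast
  have clin: "bounded_clinear A"
  proof (rule bounded_clinearI[where C=C])
    show "A (x + y) = A x + A y" for x y
      by (rule A_eqI) (auto simp: linear_op_simps[OF lin] A_dom HA)
    show "A (c *\<^sub>C x) = c *\<^sub>C A x" for c x
      by (rule A_eqI) (auto simp: linear_op_simps[OF lin] A_dom HA)
    show "norm (A x) \<le> C * norm x" for x using C[OF A_dom] by (simp add: HA)
  qed
  have csym: "cinner (A x) y = cinner x (A y)" for x y
    using selfadjoint_op_symmetric[OF H A_dom A_dom, of x y] by (simp add: HA)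
  have sym: "inner (A x) y = inner x (A y)" for x y
    using csym by (simp add: inner_eq_Re_cinner)
  have nonneg: "0 \<le> inner (A x) x" for x
  proof -
    obtain \<epsilon> where "\<epsilon> > 0" "complex_of_real (\<epsilon> * (norm (A x))\<^sup>2) \<le> cinner (the (H (A x))) (A x)"
      using pos A_dom by (auto simp: uniformly_positive_on_def)
    then show ?thesis
      by (auto simp: HA inner_eq_Re_cinner csym less_eq_complex_def intro: order_trans[rotated])
  qed
  obtain J where J: "bounded_clinear J" "\<And>x. J (J x) = A x" "\<And>x y. inner (J x) y = inner x (J y)"
    "\<And>x. 0 \<le> inner (J x) x"
    "\<And>C x. bounded_linear C \<Longrightarrow> (\<And>x. C (A x) = A (C x)) \<Longrightarrow> C (J x) = J (C x)"
    using positive_sqrt_exists[OF clin sym nonneg] by blast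
  have "cinner (J x) y = cinner x (J y)" for x y
    using J(3)[of x y] J(3)[of x "\<i> *\<^sub>C y"]
    by (simp add: complex_eq_iff inner_eq_Im_cinner bounded_clinear_simps(5)[OF J(1)] inner_eq_Re_cinner[symmetric])
  then have "inverse_sqrt H J"
    using H bij J by unfold_locales (auto simp: A_def[symmetric])
  then show thesis using that by blast
qed

section \<open>The energy space, its dual, and the reduced pencil\<close>

context inverse_sqrt
begin

text \<open>The element of the dual space that corresponds to \<open>w\<close> under the unitary map \<open>y \<mapsto> J y\<close> onto \<open>H\<^sub>1\<close>.\<close>

definition functional :: "'a \<Rightarrow> 'a \<Rightarrow> complex" where
  "functional w v = (if v \<in> range J then cinner w (inv_into UNIV J v) else 0)"

lemma functional_J [simp]: "functional w (J y) = cinner w y"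
  using inj_J by (simp add: functional_def)

lemma functional_outside: "v \<notin> range J \<Longrightarrow> functional w v = 0"
  by (simp add: functional_def)

lemma functional_eqI: "(\<And>y. f (J y) = cinner w y) \<Longrightarrow> (\<And>v. v \<notin> range J \<Longrightarrow> f v = 0) \<Longrightarrow> f = functional w"
  by (rule ext) (metis functional_J functional_outside imageE)

lemma functional_add: "functional (w + w') v = functional w v + functional w' v"
  by (simp add: functional_def cinner_simps)

lemma functional_scaleC: "functional (c *\<^sub>C w) v = c * functional w v"
  by (simp add: functional_def cinner_simps)

lemma functional_inject: "functional w = functional w' \<longleftrightarrow> w = w'"
  by (metis cinner_eqI functional_J)

lemma functional_in_dual: "functional w \<in> space_dual H"
proof -
  have "\<forall>v\<in>range J. cmod (functional w v) \<le> norm w * norm1 H v"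
    by (auto simp: Cauchy_Schwarz_cinner)
  then show ?thesis
    unfolding space_dual_def space1_eq
    by (auto simp: functional_outside J_simps(1)[symmetric] cinner_add_right)
       (auto simp: J_simps(5)[symmetric] cinner_scaleC_right)
qed

lemma dual_eq_functional:
  assumes "f \<in> space_dual H"
  obtains w where "f = functional w"
proof -
  obtain C where C: "\<And>y. cmod (f (J y)) \<le> C * norm y"
    using assms by (auto simp: space_dual_def space1_eq)
  have add: "f (J (x + y)) = f (J x) + f (J y)" and scale: "f (J (c *\<^sub>C x)) = cnj c * f (J x)" for x y c
    using assms by (auto simp: space_dual_def space1_eq J_simps(1,5))
  obtain w where w: "\<And>y. cnj (f (J y)) = cinner y w"
    using riesz_representation[of "\<lambda>y. cnj (f (J y))" C] C by (auto simp: add scale)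
  have "f = functional w"
  proof (rule functional_eqI)
    show "f (J y) = cinner w y" for y using w[of y] by (metis cinner_commute complex_cnj_cnj)
    show "f v = 0" if "v \<notin> range J" for v using assms that by (auto simp: space_dual_def space1_eq)
  qed
  then show thesis by (rule that)
qed

lemma space_dual_eq: "space_dual H = range functional"
  using functional_in_dual dual_eq_functional by (metis (no_types) image_iff rangeI subsetI subset_antisym)

lemma norm_dual_functional [simp]: "norm_dual H (functional w) = norm w"
proof -
  have "norm_dual H (functional w) = (SUP y\<in>{y. norm y \<le> 1}. cmod (cinner w y))"
  proof -
    have "{v \<in> space1 H. norm1 H v \<le> 1} = J ` {y. norm y \<le> 1}" by (auto simp: space1_eq)
    then show ?thesis by (simp add: norm_dual_def image_image)
  qed
  also have "\<dots> = norm w"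
  proof (rule cSup_eq_maximum)
    show "norm w \<in> (\<lambda>y. cmod (cinner w y)) ` {y. norm y \<le> 1}"
    proof (cases "w = 0")
      case False
      have "cinner w ((1 / norm w) *\<^sub>R w) = of_real (norm w)"
        using False by (simp add: cinner_scaleR_right cinner_self power2_eq_square)
      then show ?thesis using False by (intro image_eqI[of _ _ "(1 / norm w) *\<^sub>R w"]) auto
    qed (auto intro: image_eqI[of _ _ 0])
    show "x \<le> norm w" if x: "x \<in> (\<lambda>y. cmod (cinner w y)) ` {y. norm y \<le> 1}" for x
    proof -
      obtain y where y: "norm y \<le> 1" "x = cmod (cinner w y)" using x by blast
      have "x \<le> norm w * norm y" using y(2) Cauchy_Schwarz_cinner by simp
      also have "\<dots> \<le> norm w" using y(1) by (simp add: mult_left_le)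
      finally show ?thesis .
    qed
  qed
  finally show ?thesis .
qed

lemma embed_dual_eq: "embed_dual H h = functional (J h)"
  by (rule functional_eqI) (auto simp: embed_dual_def space1_eq sym)

lemma bounded_eqI_on_range:
  assumes f: "bounded_clinear f" and g: "bounded_clinear g" and "\<And>z. f (J z) = g (J z)"
  shows "f y = g y"
proof -
  have "closed {y. f y = g y}"
    using f g by (intro closed_Collect_eq linear_continuous_on bounded_clinear_linear)
  then have "closure (range J) \<subseteq> {y. f y = g y}" using assms(3) by (intro closure_minimal) auto
  then show ?thesis using dense_range by auto
qed

text \<open>\<open>functional \<circ> B\<close> has all properties of the extension. Any other candidate is itself of the form
  \<open>functional \<circ> w\<close> with a bounded \<open>w\<close> that agrees with \<open>B\<close> on the dense range of \<open>J\<close>.\<close>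

lemma extend_op_eq:
  assumes B: "bounded_clinear B" and AB: "\<And>z. J (A (J (J z))) = B (J z)"
  shows "extend_op H A (J y) = functional (B y)"
proof -
  define E where "E x = (if x \<in> range J then functional (B (inv_into UNIV J x)) else (\<lambda>_. 0))" for x
  have EJ: "E (J y) = functional (B y)" for y using inj_J by (simp add: E_def)
  have Eout: "E x = (\<lambda>_. 0)" if "x \<notin> range J" for x using that by (simp add: E_def)
  obtain K where K: "K > 0" "\<And>y. norm (B y) \<le> K * norm y" using bounded_clinear_bound[OF B] by blast
  have "extend_op H A = E"
    unfolding extend_op_def space1_eq dom_H
  proof (rule the_equality)
    show "(\<forall>x\<in>range J. E x \<in> space_dual H) \<and>
      (\<forall>x\<in>range J. \<forall>y\<in>range J. \<forall>v. E (x + y) v = E x v + E y v) \<and>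
      (\<forall>c. \<forall>x\<in>range J. \<forall>v. E (c *\<^sub>C x) v = c * E x v) \<and>
      (\<exists>C. \<forall>x\<in>range J. norm_dual H (E x) \<le> C * norm1 H x) \<and>
      (\<forall>x\<in>range (\<lambda>x. J (J x)). E x = embed_dual H (A x)) \<and> (\<forall>x. x \<notin> range J \<longrightarrow> E x = (\<lambda>_. 0))"
    proof (intro conjI)
      show "\<forall>x\<in>range J. E x \<in> space_dual H" by (auto simp: EJ functional_in_dual)
      show "\<forall>x\<in>range J. \<forall>y\<in>range J. \<forall>v. E (x + y) v = E x v + E y v"
        by (auto simp: J_simps(1)[symmetric] EJ bounded_clinear_simps(1)[OF B] functional_add)
      show "\<forall>c. \<forall>x\<in>range J. \<forall>v. E (c *\<^sub>C x) v = c * E x v"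
        by (auto simp: J_simps(5)[symmetric] EJ bounded_clinear_simps(5)[OF B] functional_scaleC)
      show "\<exists>C. \<forall>x\<in>range J. norm_dual H (E x) \<le> C * norm1 H x"
        using K(2) by (intro exI[of _ K]) (auto simp: EJ)
      show "\<forall>x\<in>range (\<lambda>x. J (J x)). E x = embed_dual H (A x)"
        by (auto simp: EJ embed_dual_eq AB)
      show "\<forall>x. x \<notin> range J \<longrightarrow> E x = (\<lambda>_. 0)" by (auto simp: Eout)
    qed
  next
    fix E'
    assume E': "(\<forall>x\<in>range J. E' x \<in> space_dual H) \<and>
      (\<forall>x\<in>range J. \<forall>y\<in>range J. \<forall>v. E' (x + y) v = E' x v + E' y v) \<and>
      (\<forall>c. \<forall>x\<in>range J. \<forall>v. E' (c *\<^sub>C x) v = c * E' x v) \<and>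
      (\<exists>C. \<forall>x\<in>range J. norm_dual H (E' x) \<le> C * norm1 H x) \<and>
      (\<forall>x\<in>range (\<lambda>x. J (J x)). E' x = embed_dual H (A x)) \<and> (\<forall>x. x \<notin> range J \<longrightarrow> E' x = (\<lambda>_. 0))"
    have "\<exists>w. E' (J y) = functional w" for y using E' dual_eq_functional by (metis rangeI)
    then obtain w where w: "\<And>y. E' (J y) = functional (w y)" by metis
    obtain C where C: "\<And>y. norm (w y) \<le> C * norm y" using E' by (auto simp: w)
    have "bounded_clinear w"
    proof (rule bounded_clinearI)
      show "w (x + y) = w x + w y" for x y
      proof -
        have "functional (w (x + y)) = functional (w x + w y)"
          using E' by (intro ext) (simp add: w[symmetric] J_simps(1) functional_add)
        then show ?thesis by (simp only: functional_inject)
      qed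
      show "w (c *\<^sub>C x) = c *\<^sub>C w x" for c x
      proof -
        have "functional (w (c *\<^sub>C x)) = functional (c *\<^sub>C w x)"
          using E' by (intro ext) (simp add: w[symmetric] J_simps(5) functional_scaleC)
        then show ?thesis by (simp only: functional_inject)
      qed
    qed (rule C)
    moreover have "w (J z) = B (J z)" for z
    proof -
      have "functional (w (J z)) = embed_dual H (A (J (J z)))" using E' by (simp add: w[symmetric])
      then show ?thesis by (simp add: embed_dual_eq functional_inject AB)
    qed
    ultimately have "w y = B y" for y using B bounded_eqI_on_range by blast
    then show "E' = E" using E' by (intro ext) (metis EJ Eout imageE w)
  qed
  then show ?thesis by (simp add: EJ)
qed

end

text \<open>The operators \<open>G1\<close> and \<open>St\<close> are the bounded operators \<open>G H\<^sup>-\<^sup>1\<^sup>/\<^sup>2\<close> and (the closure of)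
  \<open>H\<^sup>-\<^sup>1\<^sup>/\<^sup>2 S H\<^sup>-\<^sup>1\<^sup>/\<^sup>2\<close>.\<close>

locale reduced_pencil = inverse_sqrt H J for H :: "'a::chilbert_space \<rightharpoonup> 'a" and J +
  fixes F :: "'a \<Rightarrow> 'a" and G S :: "'a \<rightharpoonup> 'a" and G1 St :: "'a \<Rightarrow> 'a"
  assumes F: "bounded_clinear F"
    and G1: "bounded_clinear G1" "\<And>y. the (G (J y)) = G1 y"
    and S: "selfadjoint_op S" "dom S = dom H"
    and St: "bounded_clinear St" "\<And>x y. cinner (St x) y = cinner x (St y)"
      "\<And>z. J (the (S (J (J z)))) = St (J z)"
begin

text \<open>The pencil from \<open>H\<^sub>1\<close> to \<open>H\<^sub>-\<^sub>1\<close> after identifying both spaces with the Hilbert space.\<close>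

definition T :: "complex \<Rightarrow> 'a \<Rightarrow> 'a" where
  "T \<mu> y = \<mu>\<^sup>2 *\<^sub>C J (F (J y)) + \<mu> *\<^sub>C J (G1 y) + St y"

lemma T_clin: "bounded_clinear (T \<mu>)"
  unfolding T_def
  by (intro bounded_clinear_intros bounded_clinear_compose[OF clin] bounded_clinear_compose[OF F] clin G1 St)

lemma gen_pencil_J: "gen_pencil F G H S \<mu> (J y) = functional (T \<mu> y)"
proof -
  have 1: "extend_op H F (J y) = functional (J (F (J y)))"
    by (rule extend_op_eq) (intro bounded_clinear_compose[OF clin] bounded_clinear_compose[OF F] clin, rule refl)
  have 2: "extend_op H (\<lambda>x. the (G x)) (J y) = functional (J (G1 y))"
    by (rule extend_op_eq) (intro bounded_clinear_compose[OF clin] G1, simp add: G1)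
  have 3: "extend_op H (\<lambda>x. the (S x)) (J y) = functional (St y)"
    by (rule extend_op_eq) (rule St)+
  show ?thesis
    unfolding gen_pencil_def 1 2 3 by (rule ext) (simp add: T_def functional_add functional_scaleC)
qed

lemma J_pencil: "J (pencil F G S \<mu> (J (J z))) = T \<mu> (J z)"
  by (simp add: pencil_def T_def J_simps(1,5) G1(2) St(3)[symmetric])

text \<open>The weak equation says that \<open>cinner (S x) (J y) = cinner x g\<close> for a vector \<open>g\<close> and all \<open>x\<close> in the domain
  of \<open>S\<close>. As \<open>S\<close> is self-adjoint, \<open>J y\<close> lies in that domain, which is also the domain of \<open>H\<close>.\<close>

lemma weak_solution_regular:
  assumes "T \<mu> y = J f"
  obtains z where "y = J z" "pencil F G S \<mu> (J (J z)) = f"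
proof -
  define g where "g = f - (\<mu>\<^sup>2 *\<^sub>C F (J y) + \<mu> *\<^sub>C G1 y)"
  have St_y: "St y = J g"
    using assms by (simp add: T_def g_def J_simps(1,2,5) algebra_simps)
  have "S (J y) = Some g"
  proof (rule selfadjoint_op_maximal[OF S(1)])
    fix x assume "x \<in> dom S"
    then obtain u where u: "x = J (J u)" using S(2) dom_H by auto
    have "cinner (the (S x)) (J y) = cinner (St (J u)) y" by (simp add: u sym[symmetric] St(3))
    also have "\<dots> = cinner (J u) (J g)" by (simp add: St(2) St_y)
    also have "\<dots> = cinner x g" by (simp add: u sym)
    finally show "cinner (the (S x)) (J y) = cinner x g" .
  qed
  then have "J y \<in> dom H" using S(2) by auto
  then obtain z where "J y = J (J z)" using dom_H by auto
  then have z: "y = J z" by (simp add: J_eq_iff)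
  have "the (S (J (J z))) = g" using \<open>S (J y) = Some g\<close> z by simp
  then have "pencil F G S \<mu> (J (J z)) = f"
    by (simp add: pencil_def z g_def G1(2))
  with z show thesis by (rule that)
qed

lemma kernel_eq: "pencil_kernel F G H S \<mu> = J ` {y. T \<mu> y = 0}"
proof -
  have "x \<in> pencil_kernel F G H S \<mu> \<longleftrightarrow> x \<in> J ` {y. T \<mu> y = 0}" for x
  proof
    assume "x \<in> pencil_kernel F G H S \<mu>"
    then obtain z where z: "x = J (J z)" "pencil F G S \<mu> (J (J z)) = 0"
      unfolding pencil_kernel_def dom_H by blast
    then have "T \<mu> (J z) = 0" using J_pencil[of \<mu> z] by (simp add: J_simps)
    then show "x \<in> J ` {y. T \<mu> y = 0}" using z by blast
  next
    assume "x \<in> J ` {y. T \<mu> y = 0}"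
    then obtain y where y: "x = J y" "T \<mu> y = J 0" by (auto simp: J_simps)
    obtain z where "y = J z" "pencil F G S \<mu> (J (J z)) = 0"
      using weak_solution_regular[OF y(2)] by blast
    then show "x \<in> pencil_kernel F G H S \<mu>" using y inv_in_dom by (auto simp: pencil_kernel_def)
  qed
  then show ?thesis by blast
qed

lemma eigenvalue_if_reduced_kernel:
  assumes "T \<mu> y = 0" "y \<noteq> 0"
  shows "\<mu> \<in> eigenvalues F G H S" "\<mu> \<notin> resolvent_set F G H S"
proof -
  have x: "J y \<in> pencil_kernel F G H S \<mu>" "J y \<noteq> 0"
    using assms kernel_eq J_eq_iff[of y 0] by (auto simp: J_simps)
  then show "\<mu> \<in> eigenvalues F G H S" by (auto simp: eigenvalues_def)
  show "\<mu> \<notin> resolvent_set F G H S"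
  proof
    assume "\<mu> \<in> resolvent_set F G H S"
    then have "inj_on (pencil F G S \<mu>) (dom H)" by (auto simp: resolvent_set_def bij_betw_def)
    moreover have "J y \<in> dom H" "pencil F G S \<mu> (J y) = 0" using x(1) by (auto simp: pencil_kernel_def)
    moreover have "0 \<in> dom H" using linear_op_simps(3)[OF linear_H] .
    moreover have "pencil F G S \<mu> 0 = 0"
    proof -
      have "J (pencil F G S \<mu> (J (J 0))) = J 0"
        unfolding J_pencil by (simp add: J_simps bounded_clinear_simps(3)[OF T_clin])
      then show ?thesis unfolding J_eq_iff by (simp add: J_simps)
    qed
    ultimately show False using x(2) by (metis inj_onD)
  qed
qed

lemma pencil_inj_on:
  assumes "inj (T \<mu>)"
  shows "inj_on (pencil F G S \<mu>) (dom H)"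
proof (rule inj_onI)
  fix x x' assume *: "x \<in> dom H" "x' \<in> dom H" "pencil F G S \<mu> x = pencil F G S \<mu> x'"
  then obtain u u' where u: "x = J (J u)" "x' = J (J u')" unfolding dom_H by blast
  have "T \<mu> (J u) = T \<mu> (J u')" using *(3) J_pencil u by metis
  then show "x = x'" using assms u by (metis injD)
qed

lemma pencil_inv_eq:
  assumes "inj (T \<mu>)" "T \<mu> y = J f"
  shows "pencil_inv F G H S \<mu> f = J y"
proof -
  obtain z where z: "y = J z" "pencil F G S \<mu> (J (J z)) = f"
    using weak_solution_regular[OF assms(2)] by blast
  have "inj_on (pencil F G S \<mu>) (dom H)" by (rule pencil_inj_on[OF assms(1)])
  then show ?thesis
    unfolding pencil_inv_def using inv_into_f_eq[of "pencil F G S \<mu>" "dom H" "J (J z)" f] z inv_in_dom by simp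
qed

lemma gen_pencil_inv_eq:
  assumes "inj (T \<mu>)"
  shows "gen_pencil_inv F G H S \<mu> (functional (T \<mu> y)) = J y"
proof -
  have "inj_on (gen_pencil F G H S \<mu>) (range J)"
    using assms by (auto simp: inj_on_def gen_pencil_J functional_inject)
  then show ?thesis
    unfolding gen_pencil_inv_def space1_eq
    using inv_into_f_eq[of "gen_pencil F G H S \<mu>" "range J" "J y"] by (simp add: gen_pencil_J)
qed

text \<open>Through the unitary identifications, boundedness of the inverse of \<open>T \<mu>\<close> is boundedness from \<open>H\<^sub>-\<^sub>1\<close> to
  \<open>H\<^sub>1\<close>, which is stronger than both boundedness conditions required here; surjectivity of the
  classical pencil is the regularity of weak solutions.\<close>

lemma resolvent_if_reduced_bij:
  assumes bij: "bij (T \<mu>)" and bound: "\<And>y. norm y \<le> C * norm (T \<mu> y)"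
  shows "\<mu> \<in> resolvent_set F G H S" "\<mu> \<in> gen_resolvent_set F G H S"
proof -
  have surj: "\<exists>y. T \<mu> y = w" for w using bij by (metis bij_pointE)
  have inj: "inj (T \<mu>)" using bij by (simp add: bij_def)
  obtain K where K: "K > 0" "\<And>x. norm (J x) \<le> K * norm x" using bounded_clinear_bound[OF clin] by blast
  have C': "norm y \<le> \<bar>C\<bar> * norm (T \<mu> y)" for y
    using bound[of y] mult_right_mono[OF abs_ge_self[of C] norm_ge_zero[of "T \<mu> y"]] by linarith
  have "bij_betw (pencil F G S \<mu>) (dom H) UNIV"
  proof (rule bij_betw_imageI)
    show "inj_on (pencil F G S \<mu>) (dom H)" by (rule pencil_inj_on[OF inj])
    have "f \<in> pencil F G S \<mu> ` dom H" for f
    proof -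
      obtain y where "T \<mu> y = J f" using surj by blast
      then obtain z where "pencil F G S \<mu> (J (J z)) = f" by (rule weak_solution_regular)
      then show ?thesis using inv_in_dom by blast
    qed
    then show "pencil F G S \<mu> ` dom H = UNIV" by blast
  qed
  moreover have "norm x \<le> (K * \<bar>C\<bar> * K) * norm (pencil F G S \<mu> x)" if x: "x \<in> dom H" for x
  proof -
    obtain z where z: "x = J (J z)" using x unfolding dom_H by blast
    have "norm x \<le> K * (\<bar>C\<bar> * norm (T \<mu> (J z)))"
      unfolding z using K mult_left_mono[OF C'[of "J z"], of K] by (meson less_imp_le order_trans)
    also have "\<dots> \<le> K * (\<bar>C\<bar> * (K * norm (pencil F G S \<mu> x)))"
      unfolding J_pencil[symmetric] z[symmetric] using K by (intro mult_left_mono) auto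
    finally show ?thesis by (simp add: ac_simps)
  qed
  ultimately show "\<mu> \<in> resolvent_set F G H S" unfolding resolvent_set_def by blast
  have "bij_betw (gen_pencil F G H S \<mu>) (space1 H) (space_dual H)"
  proof (rule bij_betw_imageI)
    show "inj_on (gen_pencil F G H S \<mu>) (space1 H)"
      using inj by (auto simp: inj_on_def space1_eq gen_pencil_J functional_inject)
    have "functional w \<in> gen_pencil F G H S \<mu> ` range J" for w
    proof -
      obtain y where "T \<mu> y = w" using surj by blast
      then show ?thesis using gen_pencil_J[of \<mu> y] by (metis image_eqI rangeI)
    qed
    then show "gen_pencil F G H S \<mu> ` space1 H = space_dual H"
      unfolding space1_eq space_dual_eq by (auto simp: gen_pencil_J)
  qed
  moreover have "norm_dual H (embed_dual H x) \<le> (K * K * \<bar>C\<bar>) * norm_dual H (gen_pencil F G H S \<mu> x)"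
    if x: "x \<in> space1 H" for x
  proof -
    obtain y where y: "x = J y" using x unfolding space1_eq by blast
    have "norm (J (J y)) \<le> K * norm (J y)" by (rule K(2))
    also have "\<dots> \<le> K * (K * norm y)" using K by (intro mult_left_mono) auto
    also have "\<dots> \<le> K * (K * (\<bar>C\<bar> * norm (T \<mu> y)))" using K(1) C' by (intro mult_left_mono) auto
    finally have "norm (J (J y)) \<le> K * (K * (\<bar>C\<bar> * norm (T \<mu> y)))" .
    then show ?thesis by (simp add: y embed_dual_eq gen_pencil_J ac_simps)
  qed
  ultimately show "\<mu> \<in> gen_resolvent_set F G H S" unfolding gen_resolvent_set_def by blast
qed

end

section \<open>Coercive quadratic families minus an operator of finite rank\<close>

lemma det_mat_holomorphic:
  fixes a :: "complex \<Rightarrow> nat \<Rightarrow> nat \<Rightarrow> complex"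
  assumes "\<And>i j. i < n \<Longrightarrow> j < n \<Longrightarrow> (\<lambda>z. a z i j) holomorphic_on S"
  shows "(\<lambda>z. Determinant.det (Matrix.mat n n (\<lambda>(i, j). a z i j))) holomorphic_on S"
proof -
  have "Determinant.det (Matrix.mat n n (\<lambda>(i, j). a z i j)) =
      (\<Sum>p\<in>{p. p permutes {0..<n}}. signof p * (\<Prod>i = 0..<n. a z i (p i)))" for z
    unfolding Determinant.det_def
    by (auto intro!: sum.cong prod.cong simp: permutes_nat_less)
  then show ?thesis
    by (simp, intro holomorphic_intros) (auto intro!: assms simp: permutes_nat_less)
qed

lemma det_norm_le:
  fixes A :: "complex mat"
  assumes A: "A \<in> carrier_mat n n" and bound: "\<And>i j. i < n \<Longrightarrow> j < n \<Longrightarrow> cmod (A $$ (i, j)) \<le> B"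
  shows "cmod (Determinant.det A) \<le> fact n * B ^ n"
proof -
  have "cmod (Determinant.det A) \<le> (\<Sum>p\<in>{p. p permutes {0..<n}}. cmod (signof p * (\<Prod>i = 0..<n. A $$ (i, p i))))"
    using A unfolding Determinant.det_def by (auto intro: norm_sum)
  also have "\<dots> \<le> (\<Sum>p\<in>{p. p permutes {0..<n}}. B ^ n)"
  proof (rule sum_mono)
    fix p assume p: "p \<in> {p. p permutes {0..<n}}"
    have "cmod (signof p * (\<Prod>i = 0..<n. A $$ (i, p i))) = (\<Prod>i = 0..<n. cmod (A $$ (i, p i)))"
      by (simp add: norm_mult sign_def prod_norm)
    also have "\<dots> \<le> (\<Prod>i = 0..<n. B)"
      using p by (intro prod_mono) (auto intro!: bound simp: permutes_nat_less)
    finally show "cmod (signof p * (\<Prod>i = 0..<n. A $$ (i, p i))) \<le> B ^ n" by simp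
  qed
  also have "\<dots> = fact n * B ^ n"
    by (simp add: card_permutations[of "{0..<n}" n])
  finally show ?thesis .
qed

lemma mat_mult_index_sum:
  fixes a b :: "nat \<Rightarrow> nat \<Rightarrow> complex"
  assumes "A \<in> carrier_mat n n" "B \<in> carrier_mat n n" "i < n" "j < n"
  shows "(A * B) $$ (i, j) = (\<Sum>k<n. A $$ (i, k) * B $$ (k, j))"
  using assms by (simp add: scalar_prod_def lessThan_atLeast0)

text \<open>Cramer's rule in coordinates: \<open>c\<close> is the adjugate matrix. The bound on its entries depends only on the
  bound of the given entries, so it is uniform along a bounded family of matrices.\<close>

lemma cramer_coefficients:
  fixes m :: "nat \<Rightarrow> nat \<Rightarrow> complex" and n :: nat
  defines "D \<equiv> Determinant.det (Matrix.mat n n (\<lambda>(i, j). m i j))"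
  assumes bound: "\<And>i j. i < n \<Longrightarrow> j < n \<Longrightarrow> cmod (m i j) \<le> B"
  shows "\<exists>c. \<forall>i<n. \<forall>j<n. (\<Sum>k<n. c i k * m k j) = (if i = j then D else 0) \<and>
    (\<Sum>k<n. m i k * c k j) = (if i = j then D else 0) \<and> cmod (c i j) \<le> fact (n - 1) * B ^ (n - 1)"
proof -
  define A where "A = Matrix.mat n n (\<lambda>(i, j). m i j)"
  have A: "A \<in> carrier_mat n n" by (simp add: A_def)
  define c where "c i j = adj_mat A $$ (i, j)" for i j
  show ?thesis
  proof (intro exI[of _ c] allI impI conjI)
    fix i j assume ij: "i < n" "j < n"
    have "(adj_mat A * A) $$ (i, j) = (if i = j then D else 0)"
      using ij unfolding adj_mat(3)[OF A] by (simp add: D_def A_def)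
    then show "(\<Sum>k<n. c i k * m k j) = (if i = j then D else 0)"
      using ij unfolding mat_mult_index_sum[OF adj_mat(1)[OF A] A ij] by (simp add: c_def A_def)
    have "(A * adj_mat A) $$ (i, j) = (if i = j then D else 0)"
      using ij unfolding adj_mat(2)[OF A] by (simp add: D_def A_def)
    then show "(\<Sum>k<n. m i k * c k j) = (if i = j then D else 0)"
      using ij unfolding mat_mult_index_sum[OF A adj_mat(1)[OF A] ij] by (simp add: c_def A_def)
    have "cmod (Determinant.det (mat_delete A j i)) \<le> fact (n - 1) * B ^ (n - 1)"
    proof (rule det_norm_le)
      show "mat_delete A j i \<in> carrier_mat (n - 1) (n - 1)" using A by (auto simp: mat_delete_def)
      show "cmod (mat_delete A j i $$ (k, l)) \<le> B" if "k < n - 1" "l < n - 1" for k l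
        using that ij by (auto simp: mat_delete_def A_def intro!: bound)
    qed
    then show "cmod (c i j) \<le> fact (n - 1) * B ^ (n - 1)"
      using ij by (simp add: c_def adj_mat_def A_def cofactor_def norm_mult norm_power)
  qed
qed

lemma det_zero_kernel:
  fixes m :: "nat \<Rightarrow> nat \<Rightarrow> complex" and n :: nat
  assumes "Determinant.det (Matrix.mat n n (\<lambda>(i, j). m i j)) = 0"
  shows "\<exists>a i. i < n \<and> a i \<noteq> 0 \<and> (\<forall>i<n. (\<Sum>j<n. m i j * a j) = 0)"
proof -
  define A where "A = Matrix.mat n n (\<lambda>(i, j). m i j)"
  have A: "A \<in> carrier_mat n n" by (simp add: A_def)
  obtain v where v: "v \<in> carrier_vec n" "v \<noteq> 0\<^sub>v n" "A *\<^sub>v v = 0\<^sub>v n"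
    using assms det_0_iff_vec_prod_zero_field[OF A] by (auto simp: A_def)
  obtain i where i: "i < n" "vec_index v i \<noteq> 0" using v(1,2) by (metis eq_vecI carrier_vecD index_zero_vec)
  have "(\<Sum>j<n. m i j * vec_index v j) = 0" if "i < n" for i
  proof -
    have "vec_index (A *\<^sub>v v) i = 0" using v(3) that by simp
    then show ?thesis using that v(1) by (simp add: A_def scalar_prod_def lessThan_atLeast0)
  qed
  with i show ?thesis by (intro exI[of _ "vec_index v"] exI[of _ i]) simp
qed

text \<open>\<open>Q \<mu>\<close> below is the coercive operator \<open>L \<mu>\<close> minus the finite-rank operator
  \<open>y \<mapsto> \<Sum> cinner y (f i) g i\<close>. Solving \<open>Q \<mu> y = w\<close> amounts to solving for the numbers \<open>cinner y (f i)\<close>, a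
  linear system with matrix \<open>entry \<mu>\<close> and determinant \<open>d \<mu>\<close>.\<close>

locale finite_rank_perturbation =
  fixes A0 A1 A2 :: "'a::chilbert_space \<Rightarrow> 'a" and \<Omega> :: "complex set" and \<kappa> :: real
    and n :: nat and f g :: "nat \<Rightarrow> 'a"
  assumes A0: "bounded_clinear A0" and A1: "bounded_clinear A1" and A2: "bounded_clinear A2"
    and \<kappa>: "\<kappa> > 0"
    and coercive: "\<mu> \<in> \<Omega> \<Longrightarrow> \<kappa> * (norm y)\<^sup>2 \<le> Re (cinner (\<mu>\<^sup>2 *\<^sub>C A2 y + \<mu> *\<^sub>C A1 y + A0 y) y)"
begin

definition L :: "complex \<Rightarrow> 'a \<Rightarrow> 'a" where
  "L \<mu> y = \<mu>\<^sup>2 *\<^sub>C A2 y + \<mu> *\<^sub>C A1 y + A0 y"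

definition Q :: "complex \<Rightarrow> 'a \<Rightarrow> 'a" where
  "Q \<mu> y = L \<mu> y - (\<Sum>i<n. cinner y (f i) *\<^sub>C g i)"

definition Li :: "complex \<Rightarrow> 'a \<Rightarrow> 'a" where
  "Li \<mu> = inv_into UNIV (L \<mu>)"

definition entry :: "complex \<Rightarrow> nat \<Rightarrow> nat \<Rightarrow> complex" where
  "entry \<mu> i j = (if i = j then 1 else 0) - cinner (Li \<mu> (g j)) (f i)"

definition d :: "complex \<Rightarrow> complex" where
  "d \<mu> = Determinant.det (Matrix.mat n n (\<lambda>(i, j). entry \<mu> i j))"

lemma L_clin: "bounded_clinear (L \<mu>)"
  unfolding L_def by (intro bounded_clinear_intros A0 A1 A2)

lemmas L_simps = bounded_clinear_simps[OF L_clin]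

lemma L_bij: "\<mu> \<in> \<Omega> \<Longrightarrow> bij (L \<mu>)"
  using \<kappa> coercive bounded_clinear_linear[OF L_clin]
  by (intro bij_if_coercive[where c=\<kappa>]) (auto simp: L_def inner_eq_Re_cinner)

lemma L_Li: "\<mu> \<in> \<Omega> \<Longrightarrow> L \<mu> (Li \<mu> w) = w"
  using L_bij by (simp add: Li_def bij_is_surj surj_f_inv_f)

lemma Li_eqI: "\<mu> \<in> \<Omega> \<Longrightarrow> L \<mu> y = w \<Longrightarrow> Li \<mu> w = y"
  using L_bij by (auto simp: Li_def bij_is_inj)

lemma L_lower: "\<mu> \<in> \<Omega> \<Longrightarrow> \<kappa> * norm y \<le> norm (L \<mu> y)"
proof (cases "y = 0")
  case False
  assume "\<mu> \<in> \<Omega>"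
  then have "\<kappa> * (norm y)\<^sup>2 \<le> Re (cinner (L \<mu> y) y)" using coercive by (simp add: L_def)
  also have "\<dots> \<le> norm (L \<mu> y) * norm y" using Cauchy_Schwarz_cinner complex_Re_le_cmod order_trans by blast
  finally show ?thesis using False by (simp add: power2_eq_square)
qed simp

lemma Li_norm: "\<mu> \<in> \<Omega> \<Longrightarrow> norm (Li \<mu> w) \<le> norm w / \<kappa>"
  using L_lower[of \<mu> "Li \<mu> w"] \<kappa> by (simp add: L_Li field_simps)

lemma Li_add: "\<mu> \<in> \<Omega> \<Longrightarrow> Li \<mu> (v + w) = Li \<mu> v + Li \<mu> w"
  by (rule Li_eqI) (auto simp: L_simps(1) L_Li)

lemma Li_diff: "\<mu> \<in> \<Omega> \<Longrightarrow> Li \<mu> (v - w) = Li \<mu> v - Li \<mu> w"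
  by (rule Li_eqI) (auto simp: L_simps(2) L_Li)

lemma Li_scaleC: "\<mu> \<in> \<Omega> \<Longrightarrow> Li \<mu> (c *\<^sub>C w) = c *\<^sub>C Li \<mu> w"
  by (rule Li_eqI) (auto simp: L_simps(5) L_Li)

lemma Li_sum: "\<mu> \<in> \<Omega> \<Longrightarrow> Li \<mu> (\<Sum>i\<in>I. w i) = (\<Sum>i\<in>I. Li \<mu> (w i))"
  by (rule Li_eqI) (auto simp: L_simps(7) L_Li)

lemma Li_resolvent_identity:
  assumes "\<mu> \<in> \<Omega>" "\<nu> \<in> \<Omega>"
  shows "Li \<mu> w - Li \<nu> w = (\<nu> - \<mu>) *\<^sub>C Li \<mu> ((\<mu> + \<nu>) *\<^sub>C A2 (Li \<nu> w) + A1 (Li \<nu> w))"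
proof -
  define x where "x = Li \<nu> w"
  have "L \<nu> x - L \<mu> x = (\<nu> - \<mu>) *\<^sub>C ((\<mu> + \<nu>) *\<^sub>C A2 x + A1 x)"
    by (simp add: L_def scaleC_add_right scaleC_add_left cvs.scale_left_diff_distrib power2_eq_square algebra_simps)
  then have "Li \<mu> (w - L \<mu> x) = (\<nu> - \<mu>) *\<^sub>C Li \<mu> ((\<mu> + \<nu>) *\<^sub>C A2 x + A1 x)"
    using assms by (simp add: x_def L_Li Li_scaleC)
  moreover have "Li \<mu> (w - L \<mu> x) = Li \<mu> w - x"
    using assms by (simp add: Li_diff Li_eqI[of \<mu> x "L \<mu> x"])
  ultimately show ?thesis by (simp add: x_def)
qed

lemma Li_continuous:
  assumes \<nu>: "\<nu> \<in> \<Omega>" and v: "(v \<longlongrightarrow> v0) (at \<nu> within \<Omega>)"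
  shows "((\<lambda>\<mu>. Li \<mu> (v \<mu>)) \<longlongrightarrow> Li \<nu> v0) (at \<nu> within \<Omega>)"
proof -
  define x where "x = Li \<nu> v0"
  have "((\<lambda>\<mu>. norm (v \<mu> - v0 + (\<nu> - \<mu>) *\<^sub>C ((\<mu> + \<nu>) *\<^sub>C A2 x + A1 x)) / \<kappa>) \<longlongrightarrow>
      norm (v0 - v0 + (\<nu> - \<nu>) *\<^sub>C ((\<nu> + \<nu>) *\<^sub>C A2 x + A1 x)) / \<kappa>) (at \<nu> within \<Omega>)"
    using \<kappa> by (intro tendsto_intros tendsto_scaleC v) auto
  then have lim: "((\<lambda>\<mu>. norm (v \<mu> - v0 + (\<nu> - \<mu>) *\<^sub>C ((\<mu> + \<nu>) *\<^sub>C A2 x + A1 x)) / \<kappa>) \<longlongrightarrow> 0) (at \<nu> within \<Omega>)"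
    by simp
  have ev: "\<forall>\<^sub>F \<mu> in at \<nu> within \<Omega>. norm (Li \<mu> (v \<mu>) - Li \<nu> v0)
      \<le> norm (v \<mu> - v0 + (\<nu> - \<mu>) *\<^sub>C ((\<mu> + \<nu>) *\<^sub>C A2 x + A1 x)) / \<kappa>"
    unfolding eventually_at_filter
  proof (intro always_eventually allI impI)
    fix \<mu> assume \<mu>: "\<mu> \<in> \<Omega>"
    have "Li \<mu> (v \<mu>) - Li \<nu> v0 = Li \<mu> (v \<mu> - v0) + (Li \<mu> v0 - Li \<nu> v0)"
      using \<mu> by (simp add: Li_diff)
    also have "\<dots> = Li \<mu> (v \<mu> - v0 + (\<nu> - \<mu>) *\<^sub>C ((\<mu> + \<nu>) *\<^sub>C A2 x + A1 x))"
    proof -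
      have "Li \<mu> v0 - Li \<nu> v0 = (\<nu> - \<mu>) *\<^sub>C Li \<mu> ((\<mu> + \<nu>) *\<^sub>C A2 x + A1 x)"
        unfolding x_def by (rule Li_resolvent_identity[OF \<mu> \<nu>])
      then show ?thesis using \<mu> by (simp only: Li_add Li_scaleC)
    qed
    finally show "norm (Li \<mu> (v \<mu>) - Li \<nu> v0)
        \<le> norm (v \<mu> - v0 + (\<nu> - \<mu>) *\<^sub>C ((\<mu> + \<nu>) *\<^sub>C A2 x + A1 x)) / \<kappa>"
      using Li_norm[OF \<mu>] by simp
  qed
  have "((\<lambda>\<mu>. Li \<mu> (v \<mu>) - Li \<nu> v0) \<longlongrightarrow> 0) (at \<nu> within \<Omega>)"
    by (rule Lim_null_comparison[OF ev lim])
  then show ?thesis by (rule LIM_zero_cancel)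
qed

text \<open>The resolvent identity turns the difference quotient into a form of the inverse at the moving
  point, which is continuous.\<close>

lemma Li_holomorphic: "(\<lambda>\<mu>. cinner (Li \<mu> w) h) holomorphic_on \<Omega>"
  unfolding holomorphic_on_def field_differentiable_def
proof (intro ballI exI)
  fix \<nu> assume \<nu>: "\<nu> \<in> \<Omega>"
  define x where "x = Li \<nu> w"
  define D where "D = - cinner (Li \<nu> ((\<nu> + \<nu>) *\<^sub>C A2 x + A1 x)) h"
  have lim: "((\<lambda>\<mu>. - cinner (Li \<mu> ((\<mu> + \<nu>) *\<^sub>C A2 x + A1 x)) h) \<longlongrightarrow> D) (at \<nu> within \<Omega>)"
    unfolding D_def by (intro tendsto_minus tendsto_cinner tendsto_const Li_continuous[OF \<nu>]
        tendsto_add tendsto_scaleC tendsto_ident_at)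
  have "\<forall>\<^sub>F \<mu> in at \<nu> within \<Omega>. - cinner (Li \<mu> ((\<mu> + \<nu>) *\<^sub>C A2 x + A1 x)) h
      = (cinner (Li \<mu> w) h - cinner (Li \<nu> w) h) / (\<mu> - \<nu>)"
    unfolding eventually_at_filter
  proof (intro always_eventually allI impI)
    fix \<mu> assume \<mu>: "\<mu> \<noteq> \<nu>" "\<mu> \<in> \<Omega>"
    have "cinner (Li \<mu> w) h - cinner (Li \<nu> w) h = (\<nu> - \<mu>) * cinner (Li \<mu> ((\<mu> + \<nu>) *\<^sub>C A2 x + A1 x)) h"
      unfolding x_def cinner_diff_left[symmetric] Li_resolvent_identity[OF \<mu>(2) \<nu>] by (rule cinner_scaleC_left)
    then show "- cinner (Li \<mu> ((\<mu> + \<nu>) *\<^sub>C A2 x + A1 x)) h = (cinner (Li \<mu> w) h - cinner (Li \<nu> w) h) / (\<mu> - \<nu>)"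
      using \<mu>(1) by (simp add: field_simps)
  qed
  from Lim_transform_eventually[OF lim this]
  show "((\<lambda>\<mu>. cinner (Li \<mu> w) h) has_field_derivative D) (at \<nu> within \<Omega>)"
    by (simp add: has_field_derivative_iff)
qed

lemma d_holomorphic: "d holomorphic_on \<Omega>"
  unfolding d_def entry_def by (intro det_mat_holomorphic holomorphic_intros Li_holomorphic)

lemma Q_clin: "bounded_clinear (Q \<mu>)"
  unfolding Q_def by (intro bounded_clinear_intros L_clin)

lemma solution_formula:
  assumes \<mu>: "\<mu> \<in> \<Omega>"
  shows "Q \<mu> y = w \<longleftrightarrow> y = Li \<mu> w + (\<Sum>j<n. cinner y (f j) *\<^sub>C Li \<mu> (g j))"
proof -
  have "Q \<mu> y = w \<longleftrightarrow> L \<mu> y = w + (\<Sum>j<n. cinner y (f j) *\<^sub>C g j)"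
    by (auto simp: Q_def algebra_simps)
  also have "\<dots> \<longleftrightarrow> y = Li \<mu> (w + (\<Sum>j<n. cinner y (f j) *\<^sub>C g j))"
    using Li_eqI[OF \<mu>] L_Li[OF \<mu>] by metis
  finally show ?thesis using \<mu> by (simp add: Li_add Li_sum Li_scaleC)
qed

lemma entry_sum:
  assumes "i < n"
  shows "(\<Sum>j<n. entry \<mu> i j * a j) = a i - (\<Sum>j<n. a j * cinner (Li \<mu> (g j)) (f i))"
proof -
  have "(\<Sum>j<n. entry \<mu> i j * a j) = (\<Sum>j<n. (if j = i then a i else 0) - a j * cinner (Li \<mu> (g j)) (f i))"
    by (intro sum.cong) (auto simp: entry_def algebra_simps)
  then show ?thesis using assms by (simp add: sum_subtractf)
qed

lemma entry_bound:
  obtains B where "B \<ge> 0" "\<And>\<mu> i j. \<mu> \<in> \<Omega> \<Longrightarrow> i < n \<Longrightarrow> j < n \<Longrightarrow> cmod (entry \<mu> i j) \<le> B"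
proof -
  define B where "B = 1 + (\<Sum>i<n. \<Sum>j<n. norm (g j) / \<kappa> * norm (f i))"
  have nn: "0 \<le> norm (g j) / \<kappa> * norm (f i)" for i j using \<kappa> by simp
  have "cmod (entry \<mu> i j) \<le> B" if "\<mu> \<in> \<Omega>" "i < n" "j < n" for \<mu> i j
  proof -
    have "cmod (cinner (Li \<mu> (g j)) (f i)) \<le> norm (Li \<mu> (g j)) * norm (f i)" by (rule Cauchy_Schwarz_cinner)
    also have "\<dots> \<le> norm (g j) / \<kappa> * norm (f i)" using Li_norm[OF that(1)] by (intro mult_right_mono) auto
    also have "\<dots> \<le> (\<Sum>j<n. norm (g j) / \<kappa> * norm (f i))" using that(3) nn by (intro member_le_sum) auto
    also have "\<dots> \<le> (\<Sum>i<n. \<Sum>j<n. norm (g j) / \<kappa> * norm (f i))"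
      using that(2) nn by (intro member_le_sum[of i _ "\<lambda>i. \<Sum>j<n. norm (g j) / \<kappa> * norm (f i)"]) (auto intro: sum_nonneg)
    finally have "cmod (cinner (Li \<mu> (g j)) (f i)) \<le> (\<Sum>i<n. \<Sum>j<n. norm (g j) / \<kappa> * norm (f i))" .
    moreover have "cmod (entry \<mu> i j) \<le> 1 + cmod (cinner (Li \<mu> (g j)) (f i))"
      unfolding entry_def by (rule order_trans[OF norm_triangle_ineq4]) simp
    ultimately show ?thesis by (simp add: B_def)
  qed
  moreover have "B \<ge> 0" unfolding B_def using nn by (intro add_nonneg_nonneg sum_nonneg) auto
  ultimately show thesis using that by blast
qed

text \<open>The constant is independent of \<open>\<mu>\<close> because coercivity is uniform on \<open>\<Omega>\<close>: it bounds the inverse of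
  \<open>L \<mu>\<close>, hence the matrix entries and their cofactors. Multiplying by
  \<open>d \<mu>\<close>, as in Cramer's rule, keeps the estimate meaningful up to the zeros of \<open>d\<close>.\<close>

lemma determinant_estimate:
  obtains C where "C \<ge> 0" "\<And>\<mu> y. \<mu> \<in> \<Omega> \<Longrightarrow> cmod (d \<mu>) * norm y \<le> C * norm (Q \<mu> y)"
proof -
  obtain B where B: "B \<ge> 0" "\<And>\<mu> i j. \<mu> \<in> \<Omega> \<Longrightarrow> i < n \<Longrightarrow> j < n \<Longrightarrow> cmod (entry \<mu> i j) \<le> B"
    using entry_bound by blast
  define E where "E = fact (n - 1) * B ^ (n - 1)"
  define D where "D = fact n * B ^ n"
  have E: "E \<ge> 0" and D: "D \<ge> 0" using B(1) by (auto simp: E_def D_def)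
  define C where "C = D / \<kappa> + (\<Sum>j<n. (\<Sum>k<n. E * (norm (f k) / \<kappa>)) * (norm (g j) / \<kappa>))"
  have "cmod (d \<mu>) * norm y \<le> C * norm (Q \<mu> y)" if \<mu>: "\<mu> \<in> \<Omega>" for \<mu> y
  proof -
    define w where "w = Q \<mu> y"
    define a where "a i = cinner y (f i)" for i
    define b where "b i = cinner (Li \<mu> w) (f i)" for i
    have y: "y = Li \<mu> w + (\<Sum>j<n. a j *\<^sub>C Li \<mu> (g j))"
      using solution_formula[OF \<mu>, of y w] by (simp add: w_def a_def)
    have ab: "a i = b i + (\<Sum>j<n. a j * cinner (Li \<mu> (g j)) (f i))" for i
      unfolding a_def[of i] b_def by (subst y) (simp add: cinner_simps)
    have Ma: "(\<Sum>j<n. entry \<mu> i j * a j) = b i" if "i < n" for i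
      unfolding entry_sum[OF that] using ab[of i] by simp
    have "\<exists>c. \<forall>i<n. \<forall>j<n. (\<Sum>k<n. c i k * entry \<mu> k j) = (if i = j then d \<mu> else 0) \<and>
        (\<Sum>k<n. entry \<mu> i k * c k j) = (if i = j then d \<mu> else 0) \<and> cmod (c i j) \<le> E"
      unfolding d_def E_def by (rule cramer_coefficients) (rule B(2)[OF \<mu>])
    then obtain c where "\<forall>i<n. \<forall>j<n. (\<Sum>k<n. c i k * entry \<mu> k j) = (if i = j then d \<mu> else 0) \<and>
        (\<Sum>k<n. entry \<mu> i k * c k j) = (if i = j then d \<mu> else 0) \<and> cmod (c i j) \<le> E" by (elim exE)
    then have c: "(\<Sum>k<n. c i k * entry \<mu> k j) = (if i = j then d \<mu> else 0)" "cmod (c i j) \<le> E"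
      if "i < n" "j < n" for i j using that by blast+
    have da: "d \<mu> * a i = (\<Sum>k<n. c i k * b k)" if "i < n" for i
    proof -
      have "(\<Sum>k<n. c i k * b k) = (\<Sum>k<n. \<Sum>j<n. c i k * entry \<mu> k j * a j)"
        by (intro sum.cong refl) (simp add: Ma[symmetric] sum_distrib_left mult.assoc)
      also have "\<dots> = (\<Sum>j<n. (\<Sum>k<n. c i k * entry \<mu> k j) * a j)"
        by (subst sum.swap) (simp add: sum_distrib_right)
      also have "\<dots> = (\<Sum>j<n. if j = i then d \<mu> * a i else 0)"
        using that by (intro sum.cong) (auto simp: c(1))
      finally show ?thesis using that by simp
    qed
    have bk: "cmod (b k) \<le> norm w * (norm (f k) / \<kappa>)" for k
    proof -
      have "cmod (b k) \<le> norm (Li \<mu> w) * norm (f k)" unfolding b_def by (rule Cauchy_Schwarz_cinner)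
      also have "\<dots> \<le> norm w / \<kappa> * norm (f k)" using Li_norm[OF \<mu>] by (intro mult_right_mono) auto
      finally show ?thesis by simp
    qed
    have dai: "cmod (d \<mu> * a i) \<le> norm w * (\<Sum>k<n. E * (norm (f k) / \<kappa>))" if "i < n" for i
    proof -
      have "cmod (d \<mu> * a i) \<le> (\<Sum>k<n. cmod (c i k * b k))" unfolding da[OF that] by (rule norm_sum)
      also have "\<dots> \<le> (\<Sum>k<n. E * (norm w * (norm (f k) / \<kappa>)))"
        unfolding norm_mult using that by (intro sum_mono mult_mono c(2) bk E) auto
      finally show ?thesis by (simp add: sum_distrib_left ac_simps)
    qed
    have dD: "cmod (d \<mu>) \<le> D"
      unfolding d_def D_def using B(2)[OF \<mu>] by (intro det_norm_le) auto
    have "cmod (d \<mu>) * norm y = norm (d \<mu> *\<^sub>C y)" by (simp add: norm_scaleC)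
    also have "d \<mu> *\<^sub>C y = d \<mu> *\<^sub>C Li \<mu> w + (\<Sum>j<n. (d \<mu> * a j) *\<^sub>C Li \<mu> (g j))"
      by (subst y) (simp add: scaleC_add_right cvs.scale_sum_right)
    also have "norm \<dots> \<le> norm (d \<mu> *\<^sub>C Li \<mu> w) + (\<Sum>j<n. norm ((d \<mu> * a j) *\<^sub>C Li \<mu> (g j)))"
      by (rule order_trans[OF norm_triangle_ineq add_left_mono[OF norm_sum]])
    also have "\<dots> \<le> D * (norm w / \<kappa>) + (\<Sum>j<n. (norm w * (\<Sum>k<n. E * (norm (f k) / \<kappa>))) * (norm (g j) / \<kappa>))"
      unfolding norm_scaleC using \<kappa> E
      by (intro add_mono sum_mono mult_mono dD dai Li_norm[OF \<mu>] D) (auto intro!: sum_nonneg mult_nonneg_nonneg)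
    also have "\<dots> = C * norm w" by (simp add: C_def sum_distrib_left distrib_right distrib_left ac_simps)
    finally show ?thesis by (simp add: w_def)
  qed
  moreover have "C \<ge> 0"
    unfolding C_def using E D \<kappa> by (intro add_nonneg_nonneg sum_nonneg mult_nonneg_nonneg) (auto intro!: sum_nonneg)
  ultimately show thesis using that by blast
qed

lemma Q_bij:
  assumes \<mu>: "\<mu> \<in> \<Omega>" and d: "d \<mu> \<noteq> 0"
  shows "bij (Q \<mu>)"
proof -
  have "inj (Q \<mu>)"
  proof (rule injI)
    fix x y assume eq: "Q \<mu> x = Q \<mu> y"
    obtain C where "cmod (d \<mu>) * norm (x - y) \<le> C * norm (Q \<mu> (x - y))"
      using determinant_estimate \<mu> by metis
    then show "x = y" using d eq by (simp add: bounded_clinear_simps(2)[OF Q_clin] mult_le_0_iff)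
  qed
  moreover have "\<exists>y. Q \<mu> y = w" for w
  proof -
    define b where "b i = cinner (Li \<mu> w) (f i)" for i
    obtain B where B: "\<And>i j. i < n \<Longrightarrow> j < n \<Longrightarrow> cmod (entry \<mu> i j) \<le> B" using entry_bound \<mu> by metis
    have "\<exists>c. \<forall>i<n. \<forall>j<n. (\<Sum>k<n. c i k * entry \<mu> k j) = (if i = j then d \<mu> else 0) \<and>
        (\<Sum>k<n. entry \<mu> i k * c k j) = (if i = j then d \<mu> else 0) \<and> cmod (c i j) \<le> fact (n - 1) * B ^ (n - 1)"
      unfolding d_def by (rule cramer_coefficients) (rule B)
    then obtain c where "\<forall>i<n. \<forall>j<n. (\<Sum>k<n. c i k * entry \<mu> k j) = (if i = j then d \<mu> else 0) \<and>
        (\<Sum>k<n. entry \<mu> i k * c k j) = (if i = j then d \<mu> else 0) \<and> cmod (c i j) \<le> fact (n - 1) * B ^ (n - 1)"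
      by (elim exE)
    then have c: "(\<Sum>k<n. entry \<mu> i k * c k j) = (if i = j then d \<mu> else 0)"
      if "i < n" "j < n" for i j using that by blast
    define a where "a i = (\<Sum>k<n. c i k * b k) / d \<mu>" for i
    have Ma: "(\<Sum>j<n. entry \<mu> i j * a j) = b i" if "i < n" for i
    proof -
      have "(\<Sum>j<n. entry \<mu> i j * a j) = (\<Sum>j<n. \<Sum>k<n. entry \<mu> i j * c j k * b k) / d \<mu>"
        by (simp add: a_def sum_divide_distrib sum_distrib_left mult.assoc)
      also have "(\<Sum>j<n. \<Sum>k<n. entry \<mu> i j * c j k * b k) = (\<Sum>k<n. (\<Sum>j<n. entry \<mu> i j * c j k) * b k)"
        by (subst sum.swap) (simp add: sum_distrib_right)
      also have "\<dots> = (\<Sum>k<n. if k = i then d \<mu> * b i else 0)"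
        using that by (intro sum.cong) (auto simp: c)
      finally show ?thesis using that d by simp
    qed
    define y where "y = Li \<mu> w + (\<Sum>j<n. a j *\<^sub>C Li \<mu> (g j))"
    have "cinner y (f i) = a i" if "i < n" for i
    proof -
      have "cinner y (f i) = b i + (\<Sum>j<n. a j * cinner (Li \<mu> (g j)) (f i))"
        by (simp add: y_def b_def cinner_simps)
      then show ?thesis using Ma[OF that] entry_sum[OF that, of \<mu> a] by (simp add: diff_eq_eq)
    qed
    then have "y = Li \<mu> w + (\<Sum>j<n. cinner y (f j) *\<^sub>C Li \<mu> (g j))" by (simp add: y_def)
    then show ?thesis using solution_formula[OF \<mu>] by blast
  qed
  ultimately show ?thesis by (metis bijI surj_def)
qed

text \<open>A null vector \<open>a\<close> of the matrix supplies the coordinates \<open>cinner y (f i)\<close> of a solution \<open>y\<close>.\<close>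

lemma Q_kernel:
  assumes \<mu>: "\<mu> \<in> \<Omega>" and d: "d \<mu> = 0"
  obtains y where "y \<noteq> 0" "Q \<mu> y = 0"
proof -
  obtain a i where a: "i < n" "a i \<noteq> 0" "\<And>i. i < n \<Longrightarrow> (\<Sum>j<n. entry \<mu> i j * a j) = 0"
    using det_zero_kernel[OF d[unfolded d_def]] by blast
  define y where "y = (\<Sum>j<n. a j *\<^sub>C Li \<mu> (g j))"
  have y: "cinner y (f i) = a i" if "i < n" for i
    using a(3)[OF that] entry_sum[OF that, of \<mu> a] by (simp add: y_def cinner_simps)
  have "Li \<mu> 0 = 0" by (rule Li_eqI[OF \<mu>]) (rule L_simps)
  then have "y = Li \<mu> 0 + (\<Sum>j<n. cinner y (f j) *\<^sub>C Li \<mu> (g j))" using y by (simp add: y_def)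
  then have "Q \<mu> y = 0" using solution_formula[OF \<mu>] by blast
  moreover have "y \<noteq> 0" using y[OF a(1)] a(2) by auto
  ultimately show thesis using that by blast
qed

lemma Q_kernel_expansion:
  assumes \<mu>: "\<mu> \<in> \<Omega>" and "Q \<mu> y = 0"
  shows "y = (\<Sum>j<n. cinner y (f j) *\<^sub>C Li \<mu> (g j))"
proof -
  have "Li \<mu> 0 = 0" by (rule Li_eqI[OF \<mu>]) (rule L_simps)
  then show ?thesis using assms solution_formula[OF \<mu>, of y 0] by simp
qed

end

section \<open>Jordan chains and multiplicity\<close>

context finite_rank_perturbation
begin

text \<open>The notion of a chain for the quadratic family \<open>Q\<close>, whose Taylor coefficients at \<open>\<mu>\<close> are \<open>Q \<mu>\<close>,
  \<open>2 \<mu> A2 + A1\<close> and \<open>A2\<close>. If \<open>y 0, y 1, \<dots>\<close> is a Jordan chain at \<open>\<mu>\<close> then \<open>Q\<close> maps the curve \<open>\<Sum>s\<^sup>i y\<^sub>i\<close> to a function that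
  vanishes at \<open>s = 0\<close> to the order of the length of the chain, while the determinant estimate
  does not allow a higher order than that of the zero of \<open>d\<close>.\<close>

definition chain_at :: "complex \<Rightarrow> (nat \<Rightarrow> 'a) \<Rightarrow> nat \<Rightarrow> bool" where
  "chain_at \<mu> y k \<longleftrightarrow> (\<forall>j\<le>k. Q \<mu> (y j)
     + (if j \<ge> 1 then (2 * \<mu>) *\<^sub>C A2 (y (j - 1)) + A1 (y (j - 1)) else 0)
     + (if j \<ge> 2 then A2 (y (j - 2)) else 0) = 0)"

lemma Q_shift: "Q (\<mu> + s) y = Q \<mu> y + s *\<^sub>C ((2 * \<mu>) *\<^sub>C A2 y + A1 y) + s\<^sup>2 *\<^sub>C A2 y"
proof -
  have "(\<mu> + s)\<^sup>2 = \<mu>\<^sup>2 + s * (2 * \<mu>) + s\<^sup>2" by (simp add: power2_eq_square algebra_simps)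
  then show ?thesis
    by (simp add: Q_def L_def scaleC_add_left scaleC_add_right algebra_simps)
qed

text \<open>The chain conditions cancel the coefficients of \<open>s\<^sup>0, \<dots>, s\<^sup>k\<close>; two terms remain because the family
  is quadratic in the parameter.\<close>

lemma Q_chain_sum:
  assumes "chain_at \<mu> y k"
  shows "Q (\<mu> + s) (\<Sum>i\<le>k. s ^ i *\<^sub>C y i) = s ^ (k + 1) *\<^sub>C
    ((2 * \<mu>) *\<^sub>C A2 (y k) + A1 (y k) + (if k \<ge> 1 then A2 (y (k - 1)) else 0) + s *\<^sub>C A2 (y k))"
  using assms
proof (induction k)
  case 0
  then have "Q \<mu> (y 0) = 0" by (simp add: chain_at_def)
  then show ?case
    by (simp add: Q_shift scaleC_add_right power2_eq_square)
next
  case (Suc k)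
  define Z where "Z = Q \<mu> (y (Suc k))"
  define X where "X = (2 * \<mu>) *\<^sub>C A2 (y k) + A1 (y k)"
  define X' where "X' = (2 * \<mu>) *\<^sub>C A2 (y (Suc k)) + A1 (y (Suc k))"
  define W where "W = (if k \<ge> 1 then A2 (y (k - 1)) else 0)"
  have "chain_at \<mu> y k" using Suc.prems by (simp add: chain_at_def)
  from Suc.IH[OF this] have IH: "Q (\<mu> + s) (\<Sum>i\<le>k. s ^ i *\<^sub>C y i) = s ^ (k + 1) *\<^sub>C (X + W + s *\<^sub>C A2 (y k))"
    by (simp only: X_def W_def)
  have "Z + X + W = 0"
    using Suc.prems by (cases k) (auto simp: chain_at_def Z_def X_def W_def dest!: spec[of _ "Suc k"] simp del: One_nat_def)
  then have Z: "Z = - X - W" using add_diff_cancel_right'[of Z "X + W"] by (simp add: add.assoc)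
  have "Q (\<mu> + s) (\<Sum>i\<le>Suc k. s ^ i *\<^sub>C y i)
      = s ^ (k + 1) *\<^sub>C (X + W + s *\<^sub>C A2 (y k)) + s ^ (k + 1) *\<^sub>C (Z + s *\<^sub>C X' + s\<^sup>2 *\<^sub>C A2 (y (Suc k)))"
  proof -
    have "(\<Sum>i\<le>Suc k. s ^ i *\<^sub>C y i) = (\<Sum>i\<le>k. s ^ i *\<^sub>C y i) + s ^ (k + 1) *\<^sub>C y (Suc k)" by simp
    then have "Q (\<mu> + s) (\<Sum>i\<le>Suc k. s ^ i *\<^sub>C y i)
        = Q (\<mu> + s) (\<Sum>i\<le>k. s ^ i *\<^sub>C y i) + s ^ (k + 1) *\<^sub>C Q (\<mu> + s) (y (Suc k))"
      by (simp only: bounded_clinear_simps(1,5)[OF Q_clin])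
    then show ?thesis unfolding IH Q_shift[of \<mu> s "y (Suc k)"] Z_def X'_def .
  qed
  also have "\<dots> = s ^ (k + 1) *\<^sub>C (s *\<^sub>C (A2 (y k) + X' + s *\<^sub>C A2 (y (Suc k))))"
    unfolding scaleC_add_right[symmetric] Z by (simp add: scaleC_add_right power2_eq_square)
  also have "\<dots> = s ^ (Suc k + 1) *\<^sub>C (X' + A2 (y k) + s *\<^sub>C A2 (y (Suc k)))"
    by (simp add: mult.commute add.commute)
  finally show ?case by (simp add: X'_def)
qed

lemma chain_length_bounded:
  assumes \<Omega>: "open \<Omega>" "connected \<Omega>" and \<mu>: "\<mu> \<in> \<Omega>" and \<nu>: "\<nu> \<in> \<Omega>" "d \<nu> \<noteq> 0"
  obtains m where "\<And>y k. y 0 \<noteq> 0 \<Longrightarrow> chain_at \<mu> y k \<Longrightarrow> k < m"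
proof -
  obtain C where C: "C \<ge> 0" "\<And>\<mu> y. \<mu> \<in> \<Omega> \<Longrightarrow> cmod (d \<mu>) * norm y \<le> C * norm (Q \<mu> y)"
    using determinant_estimate by blast
  show thesis
  proof (cases "d \<mu> = 0")
    case False
    have "y 0 = 0" if "chain_at \<mu> y k" for y k
    proof -
      have "Q \<mu> (y 0) = 0" using that unfolding chain_at_def by (auto dest: spec[of _ 0])
      then show ?thesis using C(2)[OF \<mu>, of "y 0"] False by (simp add: mult_le_0_iff)
    qed
    then show thesis using that by blast
  next
    case True
    then have nonconst: "\<not> d constant_on \<Omega>" using \<mu> \<nu> unfolding constant_on_def by metis
    obtain g r m where m: "0 < m" "0 < r" "ball \<mu> r \<subseteq> \<Omega>" "g holomorphic_on ball \<mu> r"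
      "\<And>w. w \<in> ball \<mu> r \<Longrightarrow> d w = (w - \<mu>) ^ m * g w" "\<And>w. w \<in> ball \<mu> r \<Longrightarrow> g w \<noteq> 0"
      using holomorphic_factor_zero_nonconstant[OF d_holomorphic \<Omega> \<mu> True nonconst] by metis
    have "k < m" if y: "y 0 \<noteq> 0" "chain_at \<mu> y k" for y k
    proof (rule ccontr)
      assume k: "\<not> k < m"
      define X where "X s = (\<Sum>i\<le>k. s ^ i *\<^sub>C y i)" for s
      define W where "W s = (2 * \<mu>) *\<^sub>C A2 (y k) + A1 (y k) + (if k \<ge> 1 then A2 (y (k - 1)) else 0) + s *\<^sub>C A2 (y k)" for s
      have QX: "Q (\<mu> + s) (X s) = s ^ (k + 1) *\<^sub>C W s" for s
        unfolding X_def W_def by (rule Q_chain_sum[OF y(2)])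
      \<comment> \<open>The determinant estimate at \<open>\<mu> + s\<close>, divided by \<open>|s|\<^sup>m\<close>. If \<open>k \<ge> m\<close>, a positive power of \<open>|s|\<close> is left on the right.\<close>
      have le: "cmod (g (\<mu> + s)) * norm (X s) \<le> C * cmod s ^ (k + 1 - m) * norm (W s)"
        if s: "s \<noteq> 0" "cmod s < r" for s
      proof -
        have ball: "\<mu> + s \<in> ball \<mu> r" using s by (simp add: dist_norm)
        then have "cmod (d (\<mu> + s)) * norm (X s) \<le> C * norm (Q (\<mu> + s) (X s))" using m(3) C(2) by blast
        then have "cmod s ^ m * (cmod (g (\<mu> + s)) * norm (X s)) \<le> C * (cmod s ^ (k + 1) * norm (W s))"
          unfolding m(5)[OF ball] QX by (simp add: norm_mult norm_power norm_scaleC mult.assoc)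
        also have "cmod s ^ (k + 1) = cmod s ^ m * cmod s ^ (k + 1 - m)"
          using k by (simp add: power_add[symmetric])
        finally have "cmod s ^ m * (cmod (g (\<mu> + s)) * norm (X s)) \<le> cmod s ^ m * (C * cmod s ^ (k + 1 - m) * norm (W s))"
          by (simp add: ac_simps)
        then show ?thesis using s(1) by simp
      qed
      have Xlim: "(X \<longlongrightarrow> X 0) (at 0)"
        unfolding X_def by (intro tendsto_sum tendsto_scaleC tendsto_intros)
      have X0: "X 0 = y 0"
      proof -
        have "X 0 = (\<Sum>i\<in>{..k}. if i = 0 then y 0 else 0)" unfolding X_def by (intro sum.cong) auto
        then show ?thesis by simp
      qed
      have "isCont g \<mu>"
        using m(2,4) by (metis centre_in_ball continuous_on_interior holomorphic_on_imp_continuous_on interior_ball)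
      then have "((\<lambda>s. g (\<mu> + s)) \<longlongrightarrow> g \<mu>) (at 0)" by (simp add: isCont_iff)
      then have limL: "((\<lambda>s. cmod (g (\<mu> + s)) * norm (X s)) \<longlongrightarrow> cmod (g \<mu>) * norm (X 0)) (at 0)"
        by (intro tendsto_intros Xlim)
      have limR: "((\<lambda>s. C * cmod s ^ (k + 1 - m) * norm (W s)) \<longlongrightarrow> C * cmod 0 ^ (k + 1 - m) * norm (W 0)) (at 0)"
        unfolding W_def by (intro tendsto_intros tendsto_scaleC)
      have zero: "C * cmod 0 ^ (k + 1 - m) * norm (W 0) = 0" using k by (simp add: power_0_left)
      have ev: "\<forall>\<^sub>F s in at 0. cmod (g (\<mu> + s)) * norm (X s) \<le> C * cmod s ^ (k + 1 - m) * norm (W s)"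
        unfolding eventually_at using m(2) le by (intro exI[of _ r]) auto
      have "cmod (g \<mu>) * norm (X 0) \<le> 0"
        using tendsto_le[OF at_neq_bot limR limL ev] unfolding zero .
      moreover have "g \<mu> \<noteq> 0" using m(2,6) by simp
      ultimately show False using y(1) X0 by (simp add: mult_le_0_iff)
    qed
    then show thesis using that by blast
  qed
qed

end

text \<open>Greedy choice: as long as the chosen vectors do not span the kernel, append an eigenvector of maximal rank
  outside their span. The maximum exists because ranks are bounded, and the choice stops
  because the kernel has finite dimension.\<close>

lemma canonical_system_exists:
  assumes N: "cvs.subspace (pencil_kernel F G H S \<mu>)" and B: "finite B" "pencil_kernel F G H S \<mu> \<subseteq> cvs.span B"
    and rank: "\<And>x. eigvec_rank F G H S \<mu> x \<le> enat m"
  shows "finite_alg_multiplicity F G H S \<mu>"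
proof -
  define N where "N = pencil_kernel F G H S \<mu>"
  define r where "r = eigvec_rank F G H S \<mu>"
  define good where "good es \<longleftrightarrow> distinct es \<and> cvs.independent (set es) \<and> set es \<subseteq> N \<and>
    (\<forall>i<length es. \<forall>y\<in>N - cvs.span (set (take i es)). r y \<le> r (es ! i))" for es
  have len: "length es \<le> card B" if "good es" for es
  proof -
    have "set es \<subseteq> cvs.span B" using that B(2) by (auto simp: good_def N_def)
    then have "card (set es) \<le> card B"
      using cvs.independent_span_bound[OF B(1)] that by (auto simp: good_def)
    then show ?thesis using that by (simp add: good_def distinct_card)
  qed
  have "good []" by (simp add: good_def cvs.independent_empty)
  then obtain es where es: "good es" "\<And>es'. good es' \<Longrightarrow> length es' \<le> length es"
    using ex_has_greatest_nat[of good "[]" length "Suc (card B)"] len by (auto simp: less_Suc_eq_le)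
  have span: "cvs.span (set es) = N"
  proof (rule ccontr)
    assume neq: "cvs.span (set es) \<noteq> N"
    have "cvs.span (set es) \<subseteq> N"
      using es(1) N by (intro cvs.span_minimal) (auto simp: good_def N_def)
    with neq obtain y0 where y0: "y0 \<in> N - cvs.span (set es)" by blast
    have rfin: "r y = enat (the_enat (r y)) \<and> the_enat (r y) \<le> m" for y
      using rank[of y] unfolding r_def[symmetric] by (cases "r y") auto
    obtain y where y: "y \<in> N - cvs.span (set es)"
      "\<And>z. z \<in> N - cvs.span (set es) \<Longrightarrow> the_enat (r z) \<le> the_enat (r y)"
      using ex_has_greatest_nat[of "\<lambda>y. y \<in> N - cvs.span (set es)" y0 "\<lambda>y. the_enat (r y)" "Suc m"] y0 rfin
      by (auto simp: less_Suc_eq_le)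
    have ymax: "r z \<le> r y" if "z \<in> N - cvs.span (set es)" for z
      using y(2)[OF that] rfin[of z] rfin[of y] by (metis enat_ord_simps(1))
    have "good (es @ [y])"
      unfolding good_def
    proof (intro conjI allI impI ballI)
      have "y \<notin> set es" using y(1) cvs.span_superset by blast
      then show "distinct (es @ [y])" using es(1) by (simp add: good_def)
      show "cvs.independent (set (es @ [y]))"
        using es(1) y(1) by (simp add: good_def cvs.independent_insert)
      show "set (es @ [y]) \<subseteq> N" using es(1) y(1) by (simp add: good_def)
      fix i z assume i: "i < length (es @ [y])" and z: "z \<in> N - cvs.span (set (take i (es @ [y])))"
      show "r z \<le> r ((es @ [y]) ! i)"
      proof (cases "i < length es")
        case True
        then show ?thesis using es(1) z by (auto simp: good_def nth_append)
      next
        case False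
        then have "i = length es" using i by simp
        then show ?thesis using z ymax by simp
      qed
    qed
    then show False using es(2)[of "es @ [y]"] by simp
  qed
  have can: "canonical_system F G H S \<mu> es"
    using es(1) span unfolding canonical_system_def good_def r_def N_def by blast
  have "(\<Sum>e\<leftarrow>es. r e) \<le> enat (length es * m)" for es
  proof (induction es)
    case (Cons a es)
    have "r a + (\<Sum>e\<leftarrow>es. r e) \<le> enat m + enat (length es * m)"
      using Cons rank[of a] by (intro add_mono) (simp_all add: r_def)
    then show ?case by simp
  qed (simp add: zero_enat_def)
  then have "(\<Sum>e\<leftarrow>es. r e) < \<infinity>" by (meson enat_ord_code(4) le_less_trans)
  with can show ?thesis unfolding finite_alg_multiplicity_def r_def by blast
qed

section \<open>Coercivity off the real axis\<close>

text \<open>Compare with the real point \<open>t = Re \<mu>\<close>: in the cone \<open>|\<mu>\<^sup>2 - t\<^sup>2|\<close> and \<open>|\<mu> - t|\<close> are at most \<open>3 s t\<^sup>2\<close> and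
  \<open>s |t|\<close>, so the difference of the two forms is at most half of the lower bound at \<open>t\<close>.\<close>

lemma coercive_in_cone:
  fixes \<alpha> \<beta> \<gamma> \<mu> :: complex and a b c s \<epsilon> :: real
  assumes ab: "0 \<le> a" "0 \<le> b" and c: "0 \<le> c" "cmod \<alpha> \<le> c * a\<^sup>2" "cmod \<beta> \<le> c * (a * b)"
    and s: "0 \<le> s" "s \<le> 1" "8 * c * s \<le> \<epsilon>" and \<epsilon>: "\<epsilon> > 0"
    and real: "\<And>t. \<epsilon> * (t\<^sup>2 * a\<^sup>2 + b\<^sup>2) \<le> Re (of_real t ^ 2 * \<alpha> + of_real t * \<beta> + \<gamma>)"
    and \<mu>: "\<bar>Im \<mu>\<bar> \<le> s * \<bar>Re \<mu>\<bar>"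
  shows "\<epsilon> / 4 * ((cmod \<mu>)\<^sup>2 * a\<^sup>2 + b\<^sup>2) \<le> Re (\<mu>\<^sup>2 * \<alpha> + \<mu> * \<beta> + \<gamma>)"
proof -
  define t where "t = Re \<mu>"
  define \<tau> where "\<tau> = Im \<mu>"
  have mu: "\<mu> = of_real t + \<i> * of_real \<tau>" by (simp add: t_def \<tau>_def complex_eq_iff)
  have tau: "\<bar>\<tau>\<bar> \<le> s * \<bar>t\<bar>" using \<mu> by (simp add: t_def \<tau>_def)
  have tau2: "\<tau>\<^sup>2 \<le> s * t\<^sup>2"
  proof -
    have "\<bar>\<tau>\<bar> * \<bar>\<tau>\<bar> \<le> (s * \<bar>t\<bar>) * (s * \<bar>t\<bar>)" using tau s by (intro mult_mono) auto
    also have "\<dots> = s * (s * t\<^sup>2)" by (simp add: power2_eq_square)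
    also have "\<dots> \<le> s * (1 * t\<^sup>2)" using s by (intro mult_left_mono mult_right_mono) auto
    finally show ?thesis by (simp add: power2_eq_square)
  qed
  have d2: "cmod (\<mu>\<^sup>2 - of_real t ^ 2) \<le> 3 * s * t\<^sup>2"
  proof -
    have "\<mu>\<^sup>2 - of_real t ^ 2 = of_real (- \<tau>\<^sup>2) + \<i> * of_real (2 * t * \<tau>)"
      by (simp add: mu power2_eq_square algebra_simps)
    then have "cmod (\<mu>\<^sup>2 - of_real t ^ 2) \<le> \<tau>\<^sup>2 + 2 * (\<bar>t\<bar> * \<bar>\<tau>\<bar>)"
      using norm_triangle_ineq[of "of_real (- \<tau>\<^sup>2)" "\<i> * of_real (2 * t * \<tau>)"]
      by (simp add: norm_mult abs_mult del: of_real_minus of_real_mult of_real_power)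
    moreover have "\<bar>t\<bar> * \<bar>\<tau>\<bar> \<le> \<bar>t\<bar> * (s * \<bar>t\<bar>)" using tau by (intro mult_left_mono) auto
    ultimately show ?thesis using tau2 by (simp add: power2_eq_square algebra_simps)
  qed
  have d1: "cmod (\<mu> - of_real t) \<le> s * \<bar>t\<bar>" using tau by (simp add: mu norm_mult)
  have tab: "\<bar>t\<bar> * (a * b) \<le> (t\<^sup>2 * a\<^sup>2 + b\<^sup>2) / 2"
  proof -
    have "0 \<le> (\<bar>t\<bar> * a - b)\<^sup>2" by simp
    then show ?thesis by (simp add: power2_diff power_mult_distrib ac_simps)
  qed
  define q where "q = t\<^sup>2 * a\<^sup>2 + b\<^sup>2"
  have q: "t\<^sup>2 * a\<^sup>2 \<le> q" "q \<ge> 0" by (auto simp: q_def)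
  have tabq: "\<bar>t\<bar> * (a * b) \<le> q" 
  proof -
    have half: "u \<le> v / 2 \<Longrightarrow> 0 \<le> v \<Longrightarrow> u \<le> v" for u v :: real by simp
    show ?thesis using tab q(2) unfolding q_def by (rule half)
  qed
  have diff: "cmod ((\<mu>\<^sup>2 - of_real t ^ 2) * \<alpha> + (\<mu> - of_real t) * \<beta>) \<le> \<epsilon> / 2 * q"
  proof -
    have "cmod ((\<mu>\<^sup>2 - of_real t ^ 2) * \<alpha> + (\<mu> - of_real t) * \<beta>)
        \<le> cmod (\<mu>\<^sup>2 - of_real t ^ 2) * cmod \<alpha> + cmod (\<mu> - of_real t) * cmod \<beta>"
      by (rule order_trans[OF norm_triangle_ineq]) (simp add: norm_mult)
    also have "\<dots> \<le> 3 * s * t\<^sup>2 * (c * a\<^sup>2) + s * \<bar>t\<bar> * (c * (a * b))"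
      using c s by (intro add_mono mult_mono d1 d2) auto
    also have "\<dots> = 3 * (c * s) * (t\<^sup>2 * a\<^sup>2) + (c * s) * (\<bar>t\<bar> * (a * b))" by (simp add: algebra_simps)
    also have "\<dots> \<le> 3 * (c * s) * q + (c * s) * q"
      using tabq q c s by (intro add_mono mult_left_mono) auto
    also have "\<dots> = 4 * (c * s) * q" by simp
    also have "\<dots> \<le> \<epsilon> / 2 * q" using s(3) q by (intro mult_right_mono) auto
    finally show ?thesis .
  qed
  have "\<mu>\<^sup>2 * \<alpha> + \<mu> * \<beta> + \<gamma> = (of_real t ^ 2 * \<alpha> + of_real t * \<beta> + \<gamma>) + ((\<mu>\<^sup>2 - of_real t ^ 2) * \<alpha> + (\<mu> - of_real t) * \<beta>)"
    by (simp add: algebra_simps)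
  then have "Re (\<mu>\<^sup>2 * \<alpha> + \<mu> * \<beta> + \<gamma>) = Re (of_real t ^ 2 * \<alpha> + of_real t * \<beta> + \<gamma>) + Re ((\<mu>\<^sup>2 - of_real t ^ 2) * \<alpha> + (\<mu> - of_real t) * \<beta>)"
    by (simp only: plus_complex.simps)
  moreover have "- cmod ((\<mu>\<^sup>2 - of_real t ^ 2) * \<alpha> + (\<mu> - of_real t) * \<beta>) \<le> Re ((\<mu>\<^sup>2 - of_real t ^ 2) * \<alpha> + (\<mu> - of_real t) * \<beta>)"
    using abs_Re_le_cmod[of "(\<mu>\<^sup>2 - of_real t ^ 2) * \<alpha> + (\<mu> - of_real t) * \<beta>"] by linarith
  ultimately have main: "\<epsilon> / 2 * q \<le> Re (\<mu>\<^sup>2 * \<alpha> + \<mu> * \<beta> + \<gamma>)"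
    using real[of t] diff unfolding q_def[symmetric] by linarith
  have "(cmod \<mu>)\<^sup>2 \<le> 2 * t\<^sup>2"
  proof -
    have "s * t\<^sup>2 \<le> 1 * t\<^sup>2" using s by (intro mult_right_mono) auto
    then show ?thesis using tau2 by (simp add: cmod_power2 t_def \<tau>_def)
  qed
  then have "(cmod \<mu>)\<^sup>2 * a\<^sup>2 \<le> (2 * t\<^sup>2) * a\<^sup>2" by (rule mult_right_mono) simp
  then have le: "(cmod \<mu>)\<^sup>2 * a\<^sup>2 \<le> 2 * (t\<^sup>2 * a\<^sup>2)" by (simp only: mult.assoc)
  have "u + w \<le> 2 * (v + w)" if "u \<le> 2 * v" "0 \<le> w" for u v w :: real using that by simp
  from this[OF le zero_le_power2] have "(cmod \<mu>)\<^sup>2 * a\<^sup>2 + b\<^sup>2 \<le> 2 * q" unfolding q_def .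
  then have "\<epsilon> / 4 * ((cmod \<mu>)\<^sup>2 * a\<^sup>2 + b\<^sup>2) \<le> \<epsilon> / 4 * (2 * q)" using \<epsilon> by (intro mult_left_mono) auto
  then show ?thesis using main by simp
qed

text \<open>Compare with the point \<open>0\<close>: \<open>a \<le> K b\<close> makes both terms that contain \<open>\<mu>\<close> small multiples of \<open>b\<^sup>2\<close>.\<close>

lemma coercive_in_ball:
  fixes \<alpha> \<beta> \<gamma> \<mu> :: complex and a b c K \<rho> \<epsilon> :: real
  assumes ab: "0 \<le> a" "0 \<le> b" "a \<le> K * b" and K: "K > 0"
    and c: "0 \<le> c" "cmod \<alpha> \<le> c * a\<^sup>2" "cmod \<beta> \<le> c * (a * b)"
    and \<rho>: "0 \<le> \<rho>" "\<rho> * K \<le> 1" "4 * c * (\<rho> * K) \<le> \<epsilon>" and \<epsilon>: "\<epsilon> > 0"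
    and real: "\<epsilon> * b\<^sup>2 \<le> Re \<gamma>" and \<mu>: "cmod \<mu> \<le> \<rho>"
  shows "\<epsilon> / 4 * b\<^sup>2 \<le> Re (\<mu>\<^sup>2 * \<alpha> + \<mu> * \<beta> + \<gamma>)"
proof -
  have x: "cmod \<mu> * a \<le> (\<rho> * K) * b"
  proof -
    have "cmod \<mu> * a \<le> \<rho> * (K * b)" using \<mu> ab \<rho> by (intro mult_mono) auto
    then show ?thesis by (simp add: mult.assoc)
  qed
  have "(cmod \<mu> * a)\<^sup>2 \<le> ((\<rho> * K) * b)\<^sup>2" using x ab by (intro power_mono) auto
  also have "\<dots> = (\<rho> * K) * ((\<rho> * K) * b\<^sup>2)" by (simp add: power2_eq_square)
  also have "\<dots> \<le> (\<rho> * K) * (1 * b\<^sup>2)" using \<rho> K by (intro mult_left_mono mult_right_mono) auto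
  finally have x2: "(cmod \<mu> * a)\<^sup>2 \<le> (\<rho> * K) * b\<^sup>2" by simp
  have "cmod (\<mu>\<^sup>2 * \<alpha> + \<mu> * \<beta>) \<le> (cmod \<mu>)\<^sup>2 * cmod \<alpha> + cmod \<mu> * cmod \<beta>"
    by (rule order_trans[OF norm_triangle_ineq]) (simp add: norm_mult norm_power)
  also have "\<dots> \<le> (cmod \<mu>)\<^sup>2 * (c * a\<^sup>2) + cmod \<mu> * (c * (a * b))"
    using c by (intro add_mono mult_left_mono) auto
  also have "\<dots> = c * (cmod \<mu> * a)\<^sup>2 + c * ((cmod \<mu> * a) * b)" by (simp add: power_mult_distrib ac_simps)
  also have "\<dots> \<le> c * ((\<rho> * K) * b\<^sup>2) + c * (((\<rho> * K) * b) * b)"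
    using c ab x x2 by (intro add_mono mult_left_mono mult_right_mono) auto
  also have "\<dots> = (4 * c * (\<rho> * K)) / 2 * b\<^sup>2" by (simp add: power2_eq_square)
  also have "\<dots> \<le> \<epsilon> / 2 * b\<^sup>2" by (intro mult_right_mono divide_right_mono \<rho>(3)) auto
  finally have "- (\<epsilon> / 2 * b\<^sup>2) \<le> Re (\<mu>\<^sup>2 * \<alpha> + \<mu> * \<beta>)"
    using abs_Re_le_cmod[of "\<mu>\<^sup>2 * \<alpha> + \<mu> * \<beta>"] by linarith
  moreover have "\<epsilon> / 4 * b\<^sup>2 \<le> \<epsilon> / 2 * b\<^sup>2" using \<epsilon> by (intro mult_right_mono) auto
  ultimately show ?thesis using real by simp
qed

definition cone_ball :: "real \<Rightarrow> real \<Rightarrow> complex set" where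
  "cone_ball s \<rho> = {z. \<bar>Im z\<bar> < s * \<bar>Re z\<bar>} \<union> ball 0 \<rho>"

lemma open_cone_ball: "open (cone_ball s \<rho>)"
  unfolding cone_ball_def by (intro open_Un open_ball open_Collect_less continuous_intros)

text \<open>The closures of the two halves of the cone meet only at \<open>0\<close>; with the ball around it the set is
  star-shaped about \<open>0\<close>.\<close>

lemma connected_cone_ball:
  assumes "\<rho> > 0"
  shows "connected (cone_ball s \<rho>)"
proof (rule starlike_imp_connected)
  have "closed_segment 0 z \<subseteq> cone_ball s \<rho>" if z: "z \<in> cone_ball s \<rho>" for z
  proof (cases "z \<in> ball 0 \<rho>")
    case True
    then have "closed_segment 0 z \<subseteq> ball 0 \<rho>"
      using assms by (simp add: closed_segment_subset convex_ball)
    then show ?thesis by (auto simp: cone_ball_def)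
  next
    case False
    then have cone: "\<bar>Im z\<bar> < s * \<bar>Re z\<bar>" using z by (auto simp: cone_ball_def)
    show ?thesis
    proof
      fix w assume "w \<in> closed_segment 0 z"
      then obtain u where u: "w = u *\<^sub>R z" "0 \<le> u" by (auto simp: closed_segment_def)
      show "w \<in> cone_ball s \<rho>"
      proof (cases "u = 0")
        case True
        then show ?thesis using assms u by (simp add: cone_ball_def)
      next
        case False
        then have "u * \<bar>Im z\<bar> < u * (s * \<bar>Re z\<bar>)" using cone u(2) by simp
        then show ?thesis using u by (simp add: cone_ball_def abs_mult ac_simps)
      qed
    qed
  qed
  moreover have "0 \<in> cone_ball s \<rho>" using assms by (simp add: cone_ball_def)
  ultimately show "starlike (cone_ball s \<rho>)" unfolding starlike_def by blast
qed

lemma compact_in_cone_ball: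
  fixes s \<rho> r :: real
  assumes "s > 0" "\<rho> > 0"
  defines "K \<equiv> ({z. \<bar>Im z\<bar> \<le> s / 2 * \<bar>Re z\<bar>} \<inter> cball 0 r) \<union> cball 0 (\<rho> / 2)"
  shows "compact K" "K \<subseteq> cone_ball s \<rho>"
proof -
  have "closed {z. \<bar>Im z\<bar> \<le> s / 2 * \<bar>Re z\<bar>}" by (intro closed_Collect_le continuous_intros)
  then show "compact K" unfolding K_def by (intro compact_Un closed_Int_compact compact_cball)
  show "K \<subseteq> cone_ball s \<rho>"
  proof
    fix z assume "z \<in> K"
    then consider "\<bar>Im z\<bar> \<le> s / 2 * \<bar>Re z\<bar>" | "z \<in> cball 0 (\<rho> / 2)" by (auto simp: K_def)
    then show "z \<in> cone_ball s \<rho>"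
    proof cases
      case 1
      show ?thesis
      proof (cases "Re z = 0")
        case True
        then have "z = 0" using 1 by (simp add: complex_eq_iff)
        then show ?thesis using assms by (simp add: cone_ball_def)
      next
        case False
        then have "s / 2 * \<bar>Re z\<bar> < s * \<bar>Re z\<bar>" using assms by simp
        then show ?thesis using 1 by (simp add: cone_ball_def)
      qed
    next
      case 2
      then show ?thesis using assms by (simp add: cone_ball_def)
    qed
  qed
qed

lemma double_sector_subset_cone:
  assumes "z \<in> double_sector \<phi>" and \<phi>: "\<phi> \<le> pi / 3"
  shows "\<bar>Im z\<bar> \<le> 2 * \<phi> * \<bar>Re z\<bar>"
proof -
  have *: "\<bar>sin t\<bar> \<le> 2 * \<phi> * \<bar>cos t\<bar>" if "\<bar>t\<bar> < \<phi>" for t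
  proof -
    have "cos (pi / 3) \<le> cos \<bar>t\<bar>" using that \<phi> by (intro cos_monotone_0_pi_le) auto
    then have "1 / 2 \<le> \<bar>cos t\<bar>" by (simp add: cos_60)
    then have "\<phi> * (1 / 2) \<le> \<phi> * \<bar>cos t\<bar>" using that by (intro mult_left_mono) auto
    then show ?thesis using abs_sin_x_le_abs_x[of t] that by simp
  qed
  obtain t where t: "is_Arg z t" "\<bar>t\<bar> < \<phi> \<or> \<bar>pi - t\<bar> < \<phi>"
    using assms by (auto simp: double_sector_def)
  have "\<bar>sin t\<bar> \<le> 2 * \<phi> * \<bar>cos t\<bar>" using t(2) *[of t] *[of "pi - t"] by auto
  then have "cmod z * \<bar>sin t\<bar> \<le> cmod z * (2 * \<phi> * \<bar>cos t\<bar>)" by (rule mult_left_mono) simp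
  moreover have "Re z = cmod z * cos t" "Im z = cmod z * sin t"
  proof -
    define R where "R = cmod z"
    have "z = of_real R * cis t" using t(1) by (simp add: R_def is_Arg_def cis_conv_exp)
    then have "Re z = R * cos t" "Im z = R * sin t" by simp_all
    then show "Re z = cmod z * cos t" "Im z = cmod z * sin t" by (simp_all add: R_def)
  qed
  ultimately show ?thesis by (simp add: abs_mult ac_simps)
qed

section \<open>Bounded realisations of symmetric operators\<close>

context inverse_sqrt
begin

lemma closed_on_range_J:
  assumes "closed {y. P y}" "\<And>z. P (J z)"
  shows "P y"
proof -
  have "closure (range J) \<subseteq> {y. P y}" using assms by (intro closure_minimal) auto
  then show ?thesis using dense_range by auto
qed

text \<open>The operator \<open>J K J\<^sup>-\<^sup>1\<close> on the range of \<open>J\<close>, which is bounded by Lax's lemma. For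
  \<open>K = W H\<^sup>-\<^sup>1\<close> with symmetric \<open>W\<close> the extension \<open>B\<close> is the closure of \<open>H\<^sup>-\<^sup>1\<^sup>/\<^sup>2 W H\<^sup>-\<^sup>1\<^sup>/\<^sup>2\<close>.\<close>

lemma symmetrizable_extension:
  assumes K: "bounded_clinear K" and Ksym: "\<And>x y. cinner (J (J (K x))) y = cinner x (J (J (K y)))"
  obtains B where "bounded_clinear B" "\<And>x y. cinner (B x) y = cinner x (B y)" "\<And>z. B (J z) = J (K z)"
proof -
  obtain C where C: "C > 0" "\<And>x. norm (K x) \<le> C * norm x" using bounded_clinear_bound[OF K] by blast
  have lax: "norm (J (K z)) \<le> C * norm (J z)" for z
  proof (rule lax_symmetrizable[OF bounded_clinear_linear[OF clin] _ C(2)])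
    show "inner (J (K x)) (J y) = inner (J x) (J (K y))" for x y
    proof -
      have "cinner (J (K x)) (J y) = cinner (J (J (K x))) y" by (simp only: sym)
      also have "\<dots> = cinner (J x) (J (K y))" unfolding Ksym by (simp only: sym)
      finally show ?thesis by (simp add: inner_eq_Re_cinner)
    qed
  qed (use C in simp)
  define k where "k x = J (K (inv_into UNIV J x))" for x
  have kJ: "k (J z) = J (K z)" for z using inj_J by (simp add: k_def)
  have uc: "uniformly_continuous_on (range J) k"
    unfolding uniformly_continuous_on_def
  proof (intro allI impI)
    fix e :: real assume e: "e > 0"
    have "dist (k x') (k x) < e" if xx: "x \<in> range J" "x' \<in> range J" "dist x' x < e / C" for x x'
    proof -
      obtain u v where uv: "x' = J u" "x = J v" using xx by blast
      have "dist (k x') (k x) = norm (J (K (u - v)))"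
        by (simp add: uv kJ dist_norm bounded_clinear_simps(2)[OF K] J_simps(2))
      also have "\<dots> \<le> C * norm (J (u - v))" by (rule lax)
      also have "\<dots> < e" using xx(3) C(1) by (simp add: uv dist_norm J_simps(2) field_simps)
      finally show ?thesis .
    qed
    then show "\<exists>d>0. \<forall>x\<in>range J. \<forall>x'\<in>range J. dist x' x < d \<longrightarrow> dist (k x') (k x) < e"
      using e C(1) by (intro exI[of _ "e / C"]) auto
  qed
  obtain B where B: "uniformly_continuous_on (closure (range J)) B" "\<And>x. x \<in> range J \<Longrightarrow> k x = B x"
    using uniformly_continuous_on_extension_on_closure[OF uc] by metis
  have cont: "continuous_on UNIV B"
    using uniformly_continuous_imp_continuous[OF B(1)] by (simp add: dense_range)
  have BJ: "B (J z) = J (K z)" for z using B(2)[of "J z"] kJ by simp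
  have Bcomp: "continuous_on UNIV (\<lambda>x. B (h x))" if "continuous_on UNIV h" for h
    using continuous_on_compose2[OF cont that] by simp
  have Badd: "B (x + y) = B x + B y" for x y
  proof (rule closed_on_range_J[where y=x])
    show "closed {x. B (x + y) = B x + B y}"
      by (intro closed_Collect_eq continuous_on_add Bcomp cont continuous_on_id continuous_on_const)
    show "B (J u + y) = B (J u) + B y" for u
    proof (rule closed_on_range_J[where y=y])
      show "closed {y. B (J u + y) = B (J u) + B y}"
        by (intro closed_Collect_eq continuous_on_add Bcomp cont continuous_on_id continuous_on_const)
      show "B (J u + J v) = B (J u) + B (J v)" for v
        by (simp add: J_simps(1)[symmetric] BJ bounded_clinear_simps(1)[OF K])
    qed
  qed
  have Bscale: "B (c *\<^sub>C x) = c *\<^sub>C B x" for c x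
  proof (rule closed_on_range_J[where y=x])
    have sc: "continuous_on UNIV (\<lambda>x. c *\<^sub>C h x)" if "continuous_on UNIV h" for h :: "'a \<Rightarrow> 'a"
      by (rule bounded_linear.continuous_on[OF bounded_linear_scaleC that])
    show "closed {x. B (c *\<^sub>C x) = c *\<^sub>C B x}"
      by (intro closed_Collect_eq Bcomp sc cont continuous_on_id)
    show "B (c *\<^sub>C J u) = c *\<^sub>C B (J u)" for u
      by (simp add: J_simps(5)[symmetric] BJ bounded_clinear_simps(5)[OF K])
  qed
  have Bnorm: "norm (B x) \<le> C * norm x" for x
  proof (rule closed_on_range_J[where y=x])
    show "closed {x. norm (B x) \<le> C * norm x}"
      by (intro closed_Collect_le continuous_intros cont)
  qed (simp add: BJ lax)
  have Bclin: "bounded_clinear B" by (rule bounded_clinearI[OF Badd Bscale Bnorm])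
  have "cinner (B x) y = cinner x (B y)" for x y
  proof (rule closed_on_range_J[where y=x])
    show "closed {x. cinner (B x) y = cinner x (B y)}"
      by (intro closed_Collect_eq bounded_linear.continuous_on[OF bounded_linear_cinner_left] cont continuous_on_id)
    show "cinner (B (J u)) y = cinner (J u) (B y)" for u
    proof (rule closed_on_range_J[where y=y])
      show "closed {y. cinner (B (J u)) y = cinner (J u) (B y)}"
        by (intro closed_Collect_eq bounded_linear.continuous_on[OF bounded_linear_cinner_right] cont continuous_on_id)
      show "cinner (B (J u)) (J v) = cinner (J u) (B (J v))" for v
      proof -
        have "cinner (J (K u)) (J v) = cinner (J (J (K u))) v" by (simp only: sym)
        also have "\<dots> = cinner (J u) (J (K v))" unfolding Ksym by (simp only: sym)
        finally show ?thesis by (simp only: BJ)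
      qed
    qed
  qed
  with Bclin BJ show thesis using that by blast
qed

text \<open>The vectors \<open>J (G v)\<close> with \<open>|v| \<le> 1\<close> are weakly bounded, since pairing them with \<open>y\<close> moves \<open>G\<close> over
  to \<open>J y\<close>. Hence they are bounded in norm, and duality with the dense domain of \<open>G\<close>
  gives the bound for \<open>G J\<close>.\<close>

lemma symmetric_op_relatively_bounded:
  assumes G: "symmetric_op G" and dom: "range J \<subseteq> dom G"
  shows "bounded_clinear (\<lambda>y. the (G (J y)))"
proof -
  have lin: "linear_op G" and dd: "closure (dom G) = UNIV"
    and Gsym: "\<And>x y. x \<in> dom G \<Longrightarrow> y \<in> dom G \<Longrightarrow> cinner (the (G x)) y = cinner x (the (G y))"
    using G by (auto simp: symmetric_op_def densely_defined_def)
  have Jdom: "J y \<in> dom G" for y using dom by blast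
  define G1 where "G1 y = the (G (J y))" for y
  have adj: "inner (G1 y) v = inner y (J (the (G v)))" if "v \<in> dom G" for y v
    using Gsym[OF Jdom that, of y] by (simp add: G1_def inner_eq_Re_cinner sym)
  define W where "W = {J (the (G v)) | v. v \<in> dom G \<and> norm v \<le> 1}"
  have weak: "\<exists>C. \<forall>w\<in>W. \<bar>inner y w\<bar> \<le> C" for y
  proof (intro exI[of _ "norm (G1 y)"] ballI)
    fix w assume "w \<in> W"
    then obtain v where v: "w = J (the (G v))" "v \<in> dom G" "norm v \<le> 1" by (auto simp: W_def)
    have "\<bar>inner y w\<bar> \<le> norm (G1 y) * norm v"
      unfolding v(1) adj[OF v(2), symmetric] by (rule Cauchy_Schwarz_ineq2)
    also have "\<dots> \<le> norm (G1 y)" using v(3) by (simp add: mult_left_le)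
    finally show "\<bar>inner y w\<bar> \<le> norm (G1 y)" .
  qed
  obtain C where C: "\<And>w. w \<in> W \<Longrightarrow> norm w \<le> C" using weakly_bounded_imp_bounded[OF weak] by blast
  have JG: "norm (J (the (G v))) \<le> C * norm v" if v: "v \<in> dom G" for v
  proof (cases "v = 0")
    case True
    then show ?thesis using linear_op_simps(8)[OF lin] by (simp add: J_simps)
  next
    case False
    define c :: complex where "c = of_real (1 / norm v)"
    have cv: "c *\<^sub>C v \<in> dom G" by (rule linear_op_simps(2)[OF lin v])
    have nc: "norm (c *\<^sub>C v) = 1" using False by (simp add: norm_scaleC c_def norm_divide)
    have "J (the (G (c *\<^sub>C v))) \<in> W" using cv nc unfolding W_def by (intro CollectI exI[of _ "c *\<^sub>C v"]) simp
    then have "norm (J (the (G (c *\<^sub>C v)))) \<le> C" by (rule C)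
    then show ?thesis
      using False by (simp only: linear_op_simps(5)[OF lin v] J_simps(5) norm_scaleC) (simp add: c_def norm_divide field_simps)
  qed
  have bound: "norm (G1 y) \<le> C * norm y" for y
  proof -
    have "inner (G1 y) v \<le> C * norm y * norm v" for v
    proof -
      have "closed {v. inner (G1 y) v \<le> C * norm y * norm v}" by (intro closed_Collect_le continuous_intros)
      moreover have "dom G \<subseteq> {v. inner (G1 y) v \<le> C * norm y * norm v}"
      proof
        fix v assume v: "v \<in> dom G"
        have "inner (G1 y) v \<le> norm y * norm (J (the (G v)))" unfolding adj[OF v] by (rule norm_cauchy_schwarz)
        also have "\<dots> \<le> norm y * (C * norm v)" by (intro mult_left_mono JG[OF v]) simp
        finally show "v \<in> {v. inner (G1 y) v \<le> C * norm y * norm v}" by (simp add: ac_simps)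
      qed
      ultimately have "closure (dom G) \<subseteq> {v. inner (G1 y) v \<le> C * norm y * norm v}" by (intro closure_minimal)
      then show ?thesis using dd by auto
    qed
    from this[of "G1 y"] have "norm (G1 y) * norm (G1 y) \<le> (C * norm y) * norm (G1 y)"
      by (simp add: power2_norm_eq_inner[symmetric] power2_eq_square)
    moreover have "0 \<le> C * norm y"
    proof -
      have "(0::'a) \<in> W" unfolding W_def using linear_op_simps(3,8)[OF lin] J_simps(3)
        by (intro CollectI exI[of _ 0]) simp
      then have "0 \<le> C" using C by fastforce
      then show ?thesis by simp
    qed
    ultimately show ?thesis by (cases "G1 y = 0") auto
  qed
  have "bounded_clinear G1"
  proof (rule bounded_clinearI[OF _ _ bound])
    show "G1 (x + y) = G1 x + G1 y" for x y
      by (simp add: G1_def J_simps(1) linear_op_simps(4)[OF lin Jdom Jdom])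
    show "G1 (c *\<^sub>C x) = c *\<^sub>C G1 x" for c x
      by (simp add: G1_def J_simps(5) linear_op_simps(5)[OF lin Jdom])
  qed
  then show ?thesis unfolding G1_def .
qed

text \<open>\<open>res M\<close> is the operator \<open>H (H + M)\<^sup>-\<^sup>1\<close>.\<close>

definition res :: "real \<Rightarrow> 'a \<Rightarrow> 'a" where
  "res M = inv_into UNIV (\<lambda>y. y + M *\<^sub>R J (J y))"

lemma one_plus_clin: "bounded_clinear (\<lambda>y. y + M *\<^sub>R J (J y))"
  by (intro bounded_clinear_intros bounded_clinear_compose[OF clin] clin)

lemma one_plus_form: "inner (y + M *\<^sub>R J (J y)) y = (norm y)\<^sup>2 + M * (norm (J y))\<^sup>2"
  by (simp add: inner_add_left power2_norm_eq_inner inner_sym)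

lemma one_plus_bij: "M \<ge> 0 \<Longrightarrow> bij (\<lambda>y. y + M *\<^sub>R J (J y))"
  by (rule bij_if_coercive[where c=1]) (auto simp: one_plus_clin bounded_clinear_linear one_plus_form)

lemma res_eq: "M \<ge> 0 \<Longrightarrow> res M y + M *\<^sub>R J (J (res M y)) = y"
  using surj_f_inv_f[OF bij_is_surj[OF one_plus_bij]] by (simp add: res_def)

lemma res_eqI: "M \<ge> 0 \<Longrightarrow> x + M *\<^sub>R J (J x) = y \<Longrightarrow> res M y = x"
  using inv_into_f_eq[OF bij_is_inj[OF one_plus_bij]] by (simp add: res_def)

lemma res_norm:
  assumes "M \<ge> 0"
  shows "norm (res M y) \<le> norm y"
proof (cases "res M y = 0")
  case False
  have "(norm (res M y))\<^sup>2 \<le> inner y (res M y)"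
    using one_plus_form[of "res M y" M] res_eq[OF assms, of y] assms by simp
  also have "\<dots> \<le> norm y * norm (res M y)" by (rule norm_cauchy_schwarz)
  finally show ?thesis using False by (simp add: power2_eq_square)
qed simp

lemma res_clin: "M \<ge> 0 \<Longrightarrow> bounded_clinear (res M)"
proof (rule bounded_clinearI[where C=1])
  assume M: "M \<ge> 0"
  note one = bounded_clinear_simps[OF one_plus_clin[of M]]
  show "res M (x + y) = res M x + res M y" for x y
    using one(1)[of "res M x" "res M y"] by (intro res_eqI[OF M]) (simp only: res_eq[OF M])
  show "res M (c *\<^sub>C x) = c *\<^sub>C res M x" for c x
    using one(5)[of c "res M x"] by (intro res_eqI[OF M]) (simp only: res_eq[OF M])
  show "norm (res M x) \<le> 1 * norm x" for x using res_norm[OF M] by simp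
qed

lemma res_J: "M \<ge> 0 \<Longrightarrow> J (res M y) = res M (J y)"
proof -
  assume M: "M \<ge> 0"
  have "J (res M y) + M *\<^sub>R J (J (J (res M y))) = J (res M y + M *\<^sub>R J (J (res M y)))"
    by (simp only: J_simps(1,6))
  also have "\<dots> = J y" by (simp only: res_eq[OF M])
  finally show ?thesis by (rule res_eqI[OF M, symmetric])
qed

lemma res_sym:
  assumes "M \<ge> 0"
  shows "inner (res M x) y = inner x (res M y)"
proof -
  define u where "u = res M x"
  define v where "v = res M y"
  have "inner u (v + M *\<^sub>R J (J v)) = inner (u + M *\<^sub>R J (J u)) v"
    by (simp add: inner_add_left inner_add_right inner_sym)
  then show ?thesis using res_eq[OF assms, of x] res_eq[OF assms, of y] by (simp add: u_def v_def)
qed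

lemma res_csym:
  assumes "M \<ge> 0"
  shows "cinner (res M x) y = cinner x (res M y)"
  using res_sym[OF assms, of x y] res_sym[OF assms, of x "\<i> *\<^sub>C y"] bounded_clinear_simps(5)[OF res_clin[OF assms]]
  by (simp add: complex_eq_iff inner_eq_Im_cinner inner_eq_Re_cinner[symmetric])

text \<open>On \<open>h = J (J z)\<close> one has \<open>M res M h = z - res M z\<close>, which is bounded; such \<open>h\<close> are dense and \<open>res M\<close>
  is a contraction.\<close>

lemma res_tendsto_0: "((\<lambda>M. norm (res M h)) \<longlongrightarrow> 0) at_top"
proof (rule tendstoI)
  fix e :: real assume e: "e > 0"
  have "h \<in> closure (range (\<lambda>x. J (J x)))" using dense_range_JJ by simp
  then obtain z where z: "norm (h - J (J z)) < e / 2"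
    using e unfolding closure_approachable by (auto simp: dist_norm norm_minus_commute dest!: spec[of _ "e / 2"])
  have "\<forall>\<^sub>F M in at_top. M > max 0 (4 * norm z / e)" by (rule eventually_gt_at_top)
  then show "\<forall>\<^sub>F M in at_top. dist (norm (res M h)) 0 < e"
  proof eventually_elim
    case (elim M)
    then have M: "M > 0" and Mz: "4 * norm z / e < M" by auto
    have "M *\<^sub>R res M (J (J z)) = M *\<^sub>R J (J (res M z))" using M by (simp add: res_J)
    also have "\<dots> = z - res M z" using res_eq[of M z] M by (simp add: algebra_simps)
    finally have "norm (M *\<^sub>R res M (J (J z))) \<le> norm z + norm (res M z)" using norm_triangle_ineq4[of z "res M z"] by simp
    also have "\<dots> \<le> 2 * norm z" using res_norm[of M z] M by simp
    finally have "M * norm (res M (J (J z))) \<le> 2 * norm z" using M by simp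
    moreover have "2 * norm z < M * (e / 2)" using Mz e M by (simp add: field_simps)
    ultimately have 1: "norm (res M (J (J z))) < e / 2" using M by (smt (verit) mult_less_cancel_left_pos)
    have "res M h = res M (h - J (J z)) + res M (J (J z))"
      using bounded_clinear_simps(2)[OF res_clin[of M]] M by simp
    then have "norm (res M h) \<le> norm (h - J (J z)) + norm (res M (J (J z)))"
      using norm_triangle_ineq[of "res M (h - J (J z))" "res M (J (J z))"] res_norm[of M "h - J (J z)"] M by simp
    then show ?case using 1 z by simp
  qed
qed

text \<open>Strong convergence of the symmetric operators \<open>res M\<close> to \<open>0\<close> becomes norm convergence after multiplication
  by a compact operator: up to \<open>\<eta> / 2\<close> only finitely many functionals of \<open>A\<close> matter, and \<open>res M\<close> acts on
  the vectors \<open>h i\<close> that represent them.\<close>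

lemma compact_res_small:
  assumes A: "compact_op A" and \<eta>: "\<eta> > 0"
  obtains M where "M > 0" "\<And>y. norm (A (res M y)) \<le> \<eta> * norm y"
proof -
  have clinA: "bounded_clinear A" using A by (simp add: compact_op_def)
  obtain n :: nat and e where e: "\<And>y. norm (A y - (\<Sum>i<n. cinner (A y) (e i) *\<^sub>C e i)) \<le> \<eta> / 2 * norm y"
    using compact_op_finite_rank_approx[OF A, of "\<eta> / 2"] \<eta> by (metis half_gt_zero)
  have "\<exists>h. \<forall>x. cinner (A x) (e i) = cinner x h" for i
    using bounded_adjoint_vector[OF clinA] by metis
  then obtain h where h: "\<And>i x. cinner (A x) (e i) = cinner x (h i)" by metis
  have "((\<lambda>M. \<Sum>i<n. norm (res M (h i)) * norm (e i)) \<longlongrightarrow> (\<Sum>i<n. 0 * norm (e i))) at_top"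
    by (intro tendsto_sum tendsto_mult res_tendsto_0 tendsto_const)
  then have "\<forall>\<^sub>F M in at_top. (\<Sum>i<n. norm (res M (h i)) * norm (e i)) < \<eta> / 2"
    using \<eta> by (intro order_tendstoD(2)) auto
  then have "\<forall>\<^sub>F M in at_top. (\<Sum>i<n. norm (res M (h i)) * norm (e i)) < \<eta> / 2 \<and> M > 0"
    using eventually_gt_at_top by (rule eventually_conj)
  then obtain M where M: "(\<Sum>i<n. norm (res M (h i)) * norm (e i)) < \<eta> / 2" "M > 0"
    using eventually_happens'[OF trivial_limit_at_top_linorder] by blast
  have "norm (A (res M y)) \<le> \<eta> * norm y" for y
  proof -
    define p where "p = (\<Sum>i<n. cinner (A (res M y)) (e i) *\<^sub>C e i)"
    have "norm p \<le> (\<Sum>i<n. norm (cinner (A (res M y)) (e i) *\<^sub>C e i))" unfolding p_def by (rule norm_sum)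
    also have "\<dots> \<le> (\<Sum>i<n. norm y * norm (res M (h i)) * norm (e i))"
    proof (rule sum_mono)
      fix i
      have "cmod (cinner (A (res M y)) (e i)) \<le> norm y * norm (res M (h i))"
        using M(2) Cauchy_Schwarz_cinner[of y "res M (h i)"] by (simp add: h res_csym)
      then show "norm (cinner (A (res M y)) (e i) *\<^sub>C e i) \<le> norm y * norm (res M (h i)) * norm (e i)"
        unfolding norm_scaleC by (intro mult_right_mono) auto
    qed
    also have "\<dots> = norm y * (\<Sum>i<n. norm (res M (h i)) * norm (e i))" by (simp add: sum_distrib_left mult.assoc)
    also have "\<dots> \<le> norm y * (\<eta> / 2)" using M(1) by (intro mult_left_mono) auto
    finally have p: "norm p \<le> \<eta> / 2 * norm y" by (simp add: mult.commute)
    have "norm (A (res M y) - p) \<le> \<eta> / 2 * norm (res M y)" unfolding p_def by (rule e)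
    also have "\<dots> \<le> \<eta> / 2 * norm y" using M(2) \<eta> by (intro mult_left_mono res_norm) auto
    finally have q: "norm (A (res M y) - p) \<le> \<eta> / 2 * norm y" .
    have "norm (A (res M y)) \<le> norm (A (res M y) - p) + norm p"
      using norm_triangle_ineq[of "A (res M y) - p" p] by simp
    also have "\<dots> \<le> \<eta> / 2 * norm y + \<eta> / 2 * norm y" by (intro add_mono p q)
    finally show ?thesis by (simp add: field_simps)
  qed
  with M(2) show thesis using that by blast
qed

end

section \<open>Relatively compact perturbations\<close>

context inverse_sqrt
begin

text \<open>\<open>V\<close> is the realisation of a perturbation whose product with the inverse of \<open>H\<close> is \<open>A\<close>. Smallness of
  \<open>A res M\<close> cannot be transported to \<open>V res M\<close> by Lax's lemma directly, because \<open>V res M\<close> is not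
  symmetric. It is transported to \<open>res M V res M\<close>, and positivity of \<open>V\<close> removes the left factor
  through \<open>|V x|\<^sup>2 \<le> c inner (V x) x\<close>.\<close>

lemma perturbation_res_small:
  assumes A: "compact_op A" and AV: "\<And>z. V (J z) = J (A z)"
    and V: "bounded_clinear V" "\<And>x y. cinner (V x) y = cinner x (V y)" "\<And>x. 0 \<le> inner (V x) x"
    and \<eta>: "\<eta> > 0"
  obtains M where "M > 0" "\<And>y. norm (V (res M y)) \<le> \<eta> * norm y"
proof -
  have Vsym: "inner (V x) y = inner x (V y)" for x y using V(2) by (simp add: inner_eq_Re_cinner)
  obtain c where c: "c > 0" "\<And>x. norm (V x) \<le> c * norm x" using bounded_clinear_bound[OF V(1)] by blast
  have form: "inner (V x) x \<le> c * (norm x)\<^sup>2" for x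
    using norm_cauchy_schwarz[of "V x" x] mult_right_mono[OF c(2)[of x] norm_ge_zero[of x]]
    by (simp add: power2_eq_square)
  define \<eta>' where "\<eta>' = \<eta>\<^sup>2 / c"
  have \<eta>': "\<eta>' > 0" using \<eta> c(1) by (simp add: \<eta>'_def)
  obtain M where M: "M > 0" "\<And>y. norm (A (res M y)) \<le> \<eta>' * norm y" using compact_res_small[OF A \<eta>'] by blast
  then have M0: "M \<ge> 0" by simp
  define B where "B z = res M (A (res M z))" for z
  have B: "norm (B z) \<le> \<eta>' * norm z" for z
    unfolding B_def using res_norm[OF M0] M(2) by (rule order_trans)
  have JB: "J (B z) = res M (V (res M (J z)))" for z
    unfolding B_def res_J[OF M0] AV[symmetric] ..
  have lax: "norm (J (B z)) \<le> \<eta>' * norm (J z)" for z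
    by (rule lax_symmetrizable[OF bounded_clinear_linear[OF clin] _ B])
       (use \<eta>' in \<open>auto simp: JB res_sym[OF M0] Vsym\<close>)
  have RVR: "norm (res M (V (res M y))) \<le> \<eta>' * norm y" for y
  proof (rule closed_on_range_J[where y=y])
    have "continuous_on UNIV (\<lambda>y. res M (V (res M y)))"
      by (intro linear_continuous_on bounded_clinear_linear bounded_clinear_compose[OF res_clin[OF M0]]
          bounded_clinear_compose[OF V(1)] res_clin[OF M0])
    then show "closed {y. norm (res M (V (res M y))) \<le> \<eta>' * norm y}"
      by (intro closed_Collect_le continuous_intros)
  qed (use lax in \<open>simp add: JB\<close>)
  have "norm (V (res M y)) \<le> \<eta> * norm y" for y
  proof -
    have "(norm (V (res M y)))\<^sup>2 \<le> c * inner (V (res M y)) (res M y)"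
      by (rule psd_norm_le[OF bounded_linear.linear[OF bounded_clinear_linear[OF V(1)]] Vsym V(3) form])
    also have "inner (V (res M y)) (res M y) = inner (res M (V (res M y))) y" by (simp add: res_sym[OF M0])
    also have "\<dots> \<le> norm (res M (V (res M y))) * norm y" by (rule norm_cauchy_schwarz)
    also have "\<dots> \<le> (\<eta>' * norm y) * norm y" by (intro mult_right_mono RVR) simp
    finally have "(norm (V (res M y)))\<^sup>2 \<le> c * ((\<eta>' * norm y) * norm y)" using c(1) by simp
    also have "\<dots> = (\<eta> * norm y)\<^sup>2" using c(1) by (simp add: \<eta>'_def power2_eq_square)
    finally show ?thesis by (rule power2_le_imp_le) (use \<eta> in simp)
  qed
  with M(1) show thesis using that by blast
qed

text \<open>Split \<open>V = V res M + M V J J res M = V res M + M J A J res M\<close>. The first term is small for large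
  \<open>M\<close>. In the second one \<open>A\<close> is nearly of finite rank, which gives the approximation, and
  \<open>J res M\<close> commutes past \<open>J\<close>, which bounds its form by \<open>|J y| |y|\<close>.\<close>

lemma perturbation_realisation:
  assumes A: "compact_op A" and nonneg_A: "\<And>z. 0 \<le> cinner (A z) (J (J z))"
  shows "\<exists>V. bounded_clinear V \<and> (\<forall>z. V (J z) = J (A z)) \<and>
    (\<forall>\<eta>>0. \<exists>(n::nat) f g. \<forall>y. norm (V y - (\<Sum>i<n. cinner y (f i) *\<^sub>C g i)) \<le> \<eta> * norm y) \<and>
    (\<forall>\<eta>>0. \<exists>C. \<forall>y. cmod (cinner (V y) y) \<le> \<eta> * (norm y)\<^sup>2 + C * (norm (J y))\<^sup>2)"
proof -
  have clinA: "bounded_clinear A" using A by (simp add: compact_op_def)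
  have clinJJA: "bounded_clinear (\<lambda>z. J (J (A z)))"
    by (intro bounded_clinear_compose[OF clin] clinA)
  have form: "cinner (J (J (A z))) z = cinner (A z) (J (J z))" for z by (simp only: sym)
  have Asym: "cinner (J (J (A x))) y = cinner x (J (J (A y)))" for x y
  proof (rule symmetric_if_form_real[where D=UNIV])
    show "Im (cinner (J (J (A x))) x) = 0" for x
      using nonneg_A[of x] unfolding form by (simp add: less_eq_complex_def)
  qed (simp_all add: bounded_clinear_simps(1,5)[OF clinJJA])
  obtain V where V: "bounded_clinear V" "\<And>x y. cinner (V x) y = cinner x (V y)" "\<And>z. V (J z) = J (A z)"
    using symmetrizable_extension[OF clinA Asym] by blast
  have Vpos: "0 \<le> inner (V y) y" for y
  proof (rule closed_on_range_J[where y=y])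
    show "closed {y. 0 \<le> inner (V y) y}"
      by (intro closed_Collect_le continuous_intros linear_continuous_on bounded_clinear_linear V)
    show "0 \<le> inner (V (J z)) (J z)" for z
      using nonneg_A[of z] by (simp add: V(3) inner_eq_Re_cinner sym less_eq_complex_def)
  qed
  obtain c where c: "c > 0" "\<And>x. norm (V x) \<le> c * norm x" using bounded_clinear_bound[OF V(1)] by blast
  obtain k where k: "k > 0" "\<And>x. norm (J x) \<le> k * norm x" using bounded_clinear_bound[OF clin] by blast
  note small = perturbation_res_small[OF A V(3) V(1,2) Vpos]
  have split: "V y = V (res M y) + M *\<^sub>R V (J (J (res M y)))" if "M > 0" for M y
    using res_eq[of M y] that bounded_clinear_simps(1,6)[OF V(1)] by (metis less_imp_le)
  have approx: "\<exists>(n::nat) f g. \<forall>y. norm (V y - (\<Sum>i<n. cinner y (f i) *\<^sub>C g i)) \<le> \<eta> * norm y"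
    if \<eta>: "\<eta> > 0" for \<eta>
  proof -
    have "\<eta> / 2 > 0" using \<eta> by simp
    then obtain M where M: "M > 0" "\<And>y. norm (V (res M y)) \<le> \<eta> / 2 * norm y" using small by blast
    define \<eta>' where "\<eta>' = \<eta> / 2 / (M * k * k)"
    have "\<eta>' > 0" using \<eta> M(1) k(1) by (simp add: \<eta>'_def)
    then obtain n :: nat and e where e: "\<And>y. norm (A y - (\<Sum>i<n. cinner (A y) (e i) *\<^sub>C e i)) \<le> \<eta>' * norm y"
      using compact_op_finite_rank_approx[OF A] by metis
    have "bounded_clinear (\<lambda>y. A (J (res M y)))"
      using M(1) by (intro bounded_clinear_compose[OF clinA] bounded_clinear_compose[OF clin] res_clin) simp
    then have "\<exists>f. \<forall>y. cinner (A (J (res M y))) (e i) = cinner y f" for i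
      using bounded_adjoint_vector by metis
    then obtain f where f: "\<And>i y. cinner (A (J (res M y))) (e i) = cinner y (f i)" by metis
    have "norm (V y - (\<Sum>i<n. cinner y (f i) *\<^sub>C (M *\<^sub>R J (e i)))) \<le> \<eta> * norm y" for y
    proof -
      define x where "x = J (res M y)"
      define p where "p = (\<Sum>i<n. cinner (A x) (e i) *\<^sub>C e i)"
      have "(\<Sum>i<n. cinner y (f i) *\<^sub>C (M *\<^sub>R J (e i))) = M *\<^sub>R J p"
        by (simp add: p_def x_def f J_simps(5,7) scaleR_sum_right scaleC_scaleR_commute)
      moreover have "V y = V (res M y) + M *\<^sub>R J (A x)"
        using split[OF M(1), of y] V(3)[of x] by (simp add: x_def)
      ultimately have "V y - (\<Sum>i<n. cinner y (f i) *\<^sub>C (M *\<^sub>R J (e i))) = V (res M y) + M *\<^sub>R J (A x - p)"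
        by (simp add: J_simps(2) scaleR_diff_right)
      also have "norm \<dots> \<le> norm (V (res M y)) + M * norm (J (A x - p))"
        using M(1) by (intro order_trans[OF norm_triangle_ineq]) simp
      also have "\<dots> \<le> \<eta> / 2 * norm y + M * (k * (\<eta>' * (k * norm y)))"
      proof (intro add_mono M(2) mult_left_mono)
        have "norm (J (A x - p)) \<le> k * norm (A x - p)" by (rule k)
        also have "\<dots> \<le> k * (\<eta>' * norm x)" using k(1) e[of x] by (intro mult_left_mono) (simp_all add: p_def)
        also have "\<dots> \<le> k * (\<eta>' * (k * norm y))"
        proof -
          have "norm x \<le> k * norm (res M y)" unfolding x_def by (rule k)
          also have "\<dots> \<le> k * norm y" using k(1) M(1) res_norm[of M y] by (intro mult_left_mono) auto
          finally show ?thesis using k(1) \<open>\<eta>' > 0\<close> by (intro mult_left_mono) auto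
        qed
        finally show "norm (J (A x - p)) \<le> k * (\<eta>' * (k * norm y))" .
      qed (use M(1) in simp)
      also have "\<dots> = \<eta> * norm y" using M(1) k(1) by (simp add: \<eta>'_def field_simps)
      finally show ?thesis .
    qed
    then show ?thesis by (intro exI[of _ n] exI[of _ f] exI[of _ "\<lambda>i. M *\<^sub>R J (e i)"]) simp
  qed
  have formbound: "\<exists>C. \<forall>y. cmod (cinner (V y) y) \<le> \<eta> * (norm y)\<^sup>2 + C * (norm (J y))\<^sup>2" if \<eta>: "\<eta> > 0" for \<eta>
  proof -
    have "\<eta> / 2 > 0" using \<eta> by simp
    then obtain M where M: "M > 0" "\<And>y. norm (V (res M y)) \<le> \<eta> / 2 * norm y" using small by blast
    define X where "X = M * (c * k)"
    have X: "X > 0" using M c k by (simp add: X_def)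
    have "cmod (cinner (V y) y) \<le> \<eta> * (norm y)\<^sup>2 + (X\<^sup>2 / (2 * \<eta>)) * (norm (J y))\<^sup>2" for y
    proof -
      have JJ: "norm (V (J (J (res M y)))) \<le> c * (k * norm (J y))"
      proof -
        have "norm (V (J (J (res M y)))) \<le> c * norm (J (res M (J y)))" using c(2) M(1) by (simp add: res_J)
        also have "\<dots> \<le> c * (k * norm (res M (J y)))" using c(1) k(2) by (intro mult_left_mono) auto
        also have "\<dots> \<le> c * (k * norm (J y))" using c(1) k(1) M(1) res_norm by (intro mult_left_mono) auto
        finally show ?thesis .
      qed
      have "norm (V y) \<le> norm (V (res M y)) + M * norm (V (J (J (res M y))))"
        using split[OF M(1), of y] norm_triangle_ineq[of "V (res M y)" "M *\<^sub>R V (J (J (res M y)))"] M(1) by simp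
      also have "\<dots> \<le> \<eta> / 2 * norm y + M * (c * (k * norm (J y)))"
        using M by (intro add_mono mult_left_mono JJ) auto
      finally have nV: "norm (V y) \<le> \<eta> / 2 * norm y + X * norm (J y)" by (simp add: X_def ac_simps)
      have "cmod (cinner (V y) y) \<le> norm (V y) * norm y" by (rule Cauchy_Schwarz_cinner)
      also have "\<dots> \<le> (\<eta> / 2 * norm y + X * norm (J y)) * norm y" by (intro mult_right_mono nV) simp
      also have "\<dots> \<le> \<eta> * (norm y)\<^sup>2 + (X\<^sup>2 / (2 * \<eta>)) * (norm (J y))\<^sup>2"
      proof -
        have "0 \<le> (\<eta> * norm y - X * norm (J y))\<^sup>2 / (2 * \<eta>)" using \<eta> by simp
        also have "\<dots> = \<eta> / 2 * (norm y)\<^sup>2 - X * norm (J y) * norm y + (X\<^sup>2 / (2 * \<eta>)) * (norm (J y))\<^sup>2"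
          using \<eta> by (simp add: power2_eq_square field_simps)
        finally show ?thesis by (simp add: power2_eq_square algebra_simps)
      qed
      finally show ?thesis .
    qed
    then show ?thesis by blast
  qed
  show ?thesis
    by (intro exI[of _ V] conjI allI impI V approx formbound)
qed

end

section \<open>Resolvent estimates and normal eigenvalues\<close>

definition weighted_resolvent_norm ::
    "('a::chilbert_space \<Rightarrow> 'a) \<Rightarrow> ('a \<rightharpoonup> 'a) \<Rightarrow> ('a \<rightharpoonup> 'a) \<Rightarrow> ('a \<rightharpoonup> 'a) \<Rightarrow> complex \<Rightarrow> ennreal" where
  "weighted_resolvent_norm F G H S z =
     ennreal ((cmod z)\<^sup>2) * op_norm UNIV norm norm (pencil_inv F G H S z)
     + ennreal (cmod z) * op_norm UNIV norm (norm1 H) (pencil_inv F G H S z)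
     + op_norm (space_dual H) (norm_dual H) (norm1 H) (gen_pencil_inv F G H S z)"

context reduced_pencil
begin

text \<open>Let \<open>T \<mu> y = J f\<close>. Coercivity and \<open>Re (cinner (J f) y) \<le> |f| |J y|\<close> bound first \<open>|\<mu>|\<^sup>2 |J y|\<close> and then
  \<open>|\<mu>| |y|\<close> by \<open>|f| / \<kappa>\<close>. Here \<open>J y\<close> is the classical solution and \<open>|y|\<close> its norm in \<open>H\<^sub>1\<close>. The third
  term only uses \<open>\<kappa> |y| \<le> |T \<mu> y|\<close>.\<close>

lemma uniform_estimate:
  assumes \<kappa>: "\<kappa> > 0" and \<mu>: "\<mu> \<noteq> 0"
    and coer: "\<And>y. \<kappa> * ((cmod \<mu>)\<^sup>2 * (norm (J y))\<^sup>2 + (norm y)\<^sup>2) \<le> Re (cinner (T \<mu> y) y)"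
  shows "\<mu> \<in> resolvent_set F G H S" "\<mu> \<in> gen_resolvent_set F G H S"
    and "weighted_resolvent_norm F G H S \<mu> \<le> ennreal (3 / \<kappa>)"
proof -
  have coer': "\<kappa> * (norm y)\<^sup>2 \<le> Re (cinner (T \<mu> y) y)" for y
  proof -
    have "0 \<le> \<kappa> * ((cmod \<mu>)\<^sup>2 * (norm (J y))\<^sup>2)" using \<kappa> by simp
    then show ?thesis using coer[of y] by (simp add: distrib_left)
  qed
  have bij: "bij (T \<mu>)"
    using coer' \<kappa> by (intro bij_if_coercive[where c=\<kappa>] bounded_clinear_linear[OF T_clin]) (auto simp: inner_eq_Re_cinner)
  then have inj: "inj (T \<mu>)" and surj: "\<And>w. \<exists>y. T \<mu> y = w" by (auto simp: bij_def surj_def) (metis)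
  have lower: "\<kappa> * norm y \<le> norm (T \<mu> y)" for y
  proof (cases "y = 0")
    case False
    have "\<kappa> * (norm y)\<^sup>2 \<le> norm (T \<mu> y) * norm y"
      using coer'[of y] Cauchy_Schwarz_cinner complex_Re_le_cmod order_trans by metis
    then show ?thesis using False by (simp add: power2_eq_square)
  qed simp
  have bound: "norm y \<le> 1 / \<kappa> * norm (T \<mu> y)" for y using lower[of y] \<kappa> by (simp add: field_simps)
  show "\<mu> \<in> resolvent_set F G H S" "\<mu> \<in> gen_resolvent_set F G H S"
    by (rule resolvent_if_reduced_bij[OF bij bound])+
  define l where "l = cmod \<mu>"
  have l: "l > 0" using \<mu> by (simp add: l_def)
  have est: "l\<^sup>2 * norm (J y) \<le> norm f / \<kappa>" "l * norm y \<le> norm f / \<kappa>" if Ty: "T \<mu> y = J f" for y f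
  proof -
    define a where "a = norm (J y)"
    define b where "b = norm y"
    have "Re (cinner (T \<mu> y) y) \<le> norm f * a"
      using complex_Re_le_cmod[of "cinner f (J y)"] Cauchy_Schwarz_cinner[of f "J y"] by (simp add: Ty sym a_def)
    with coer[of y] have main: "\<kappa> * (l\<^sup>2 * a\<^sup>2 + b\<^sup>2) \<le> norm f * a" by (simp add: l_def a_def b_def)
    have "\<kappa> * (l\<^sup>2 * a\<^sup>2) \<le> \<kappa> * (l\<^sup>2 * a\<^sup>2 + b\<^sup>2)" using \<kappa> by (intro mult_left_mono) auto
    with main have "(\<kappa> * l\<^sup>2 * a) * a \<le> norm f * a" by (simp add: power2_eq_square ac_simps)
    then have a: "\<kappa> * l\<^sup>2 * a \<le> norm f" by (cases "a = 0") (auto simp: a_def)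
    then show "l\<^sup>2 * norm (J y) \<le> norm f / \<kappa>" using \<kappa> by (simp add: a_def field_simps)
    have "\<kappa> * b\<^sup>2 \<le> \<kappa> * (l\<^sup>2 * a\<^sup>2 + b\<^sup>2)" using \<kappa> by (intro mult_left_mono) auto
    with main have "\<kappa> * b\<^sup>2 \<le> norm f * a" by linarith
    then have "(\<kappa> * l\<^sup>2) * (\<kappa> * b\<^sup>2) \<le> (\<kappa> * l\<^sup>2) * (norm f * a)" using \<kappa> by (intro mult_left_mono) auto
    also have "\<dots> = norm f * (\<kappa> * l\<^sup>2 * a)" by (simp add: ac_simps)
    also have "\<dots> \<le> norm f * norm f" using a by (intro mult_left_mono) auto
    finally have "(\<kappa> * (l * b))\<^sup>2 \<le> (norm f)\<^sup>2" by (simp add: power2_eq_square ac_simps)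
    then have "\<kappa> * (l * b) \<le> norm f" by (rule power2_le_imp_le) simp
    then show "l * norm y \<le> norm f / \<kappa>" using \<kappa> by (simp add: b_def field_simps)
  qed
  have 1: "ennreal (l\<^sup>2) * op_norm UNIV norm norm (pencil_inv F G H S \<mu>) \<le> ennreal (1 / \<kappa>)"
  proof -
    have "op_norm UNIV norm norm (pencil_inv F G H S \<mu>) \<le> ennreal (1 / \<kappa> / l\<^sup>2)"
      unfolding op_norm_def
    proof (intro SUP_least ennreal_leI)
      fix f :: 'a assume f: "f \<in> {x \<in> UNIV. norm x \<le> 1}"
      obtain y where y: "T \<mu> y = J f" using surj by blast
      have "l\<^sup>2 * norm (J y) \<le> 1 / \<kappa>" using est(1)[OF y] f \<kappa> by (simp add: order_trans divide_right_mono)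
      then show "norm (pencil_inv F G H S \<mu> f) \<le> 1 / \<kappa> / l\<^sup>2"
        unfolding pencil_inv_eq[OF inj y] using l by (subst pos_le_divide_eq) (simp_all add: mult.commute)
    qed
    then have "ennreal (l\<^sup>2) * op_norm UNIV norm norm (pencil_inv F G H S \<mu>) \<le> ennreal (l\<^sup>2) * ennreal (1 / \<kappa> / l\<^sup>2)"
      by (rule mult_left_mono) simp
    also have "\<dots> = ennreal (1 / \<kappa>)" using l \<kappa> by (simp add: ennreal_mult'[symmetric])
    finally show ?thesis .
  qed
  have 2: "ennreal l * op_norm UNIV norm (norm1 H) (pencil_inv F G H S \<mu>) \<le> ennreal (1 / \<kappa>)"
  proof -
    have "op_norm UNIV norm (norm1 H) (pencil_inv F G H S \<mu>) \<le> ennreal (1 / \<kappa> / l)"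
      unfolding op_norm_def
    proof (intro SUP_least ennreal_leI)
      fix f :: 'a assume f: "f \<in> {x \<in> UNIV. norm x \<le> 1}"
      obtain y where y: "T \<mu> y = J f" using surj by blast
      have "l * norm y \<le> 1 / \<kappa>" using est(2)[OF y] f \<kappa> by (simp add: order_trans divide_right_mono)
      then show "norm1 H (pencil_inv F G H S \<mu> f) \<le> 1 / \<kappa> / l"
        unfolding pencil_inv_eq[OF inj y] using l by (subst pos_le_divide_eq) (simp_all add: mult.commute)
    qed
    then have "ennreal l * op_norm UNIV norm (norm1 H) (pencil_inv F G H S \<mu>) \<le> ennreal l * ennreal (1 / \<kappa> / l)"
      by (rule mult_left_mono) simp
    also have "\<dots> = ennreal (1 / \<kappa>)" using l \<kappa> by (simp add: ennreal_mult'[symmetric])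
    finally show ?thesis .
  qed
  have 3: "op_norm (space_dual H) (norm_dual H) (norm1 H) (gen_pencil_inv F G H S \<mu>) \<le> ennreal (1 / \<kappa>)"
    unfolding op_norm_def
  proof (intro SUP_least ennreal_leI)
    fix h assume h: "h \<in> {x \<in> space_dual H. norm_dual H x \<le> 1}"
    then obtain w where w: "h = functional w" "norm w \<le> 1" unfolding space_dual_eq by auto
    obtain y where y: "w = T \<mu> y" using surj by metis
    have "\<kappa> * norm y \<le> 1" using lower[of y] w(2) y by simp
    then show "norm1 H (gen_pencil_inv F G H S \<mu> h) \<le> 1 / \<kappa>"
      unfolding w(1) y gen_pencil_inv_eq[OF inj] using \<kappa> by (simp add: field_simps)
  qed
  have "weighted_resolvent_norm F G H S \<mu> \<le> ennreal (1 / \<kappa>) + ennreal (1 / \<kappa>) + ennreal (1 / \<kappa>)"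
    unfolding weighted_resolvent_norm_def l_def[symmetric] by (intro add_mono 1 2 3)
  also have "\<dots> = ennreal (3 / \<kappa>)" using \<kappa> by (simp add: ennreal_plus[symmetric] del: ennreal_plus)
  finally show "weighted_resolvent_norm F G H S \<mu> \<le> ennreal (3 / \<kappa>)" .
qed

text \<open>The vectors of a chain lie in the domain of \<open>H\<close>, so applying \<open>J\<close> to the chain equations gives the
  equations of a chain for the reduced pencil.\<close>

lemma jordan_chain_reduced:
  assumes chain: "jordan_chain F G H S \<mu> xs"
  obtains y where "y 0 \<noteq> 0" "\<And>j. j < length xs \<Longrightarrow> T \<mu> (y j)
     + (if j \<ge> 1 then (2 * \<mu>) *\<^sub>C J (F (J (y (j - 1)))) + J (G1 (y (j - 1))) else 0)
     + (if j \<ge> 2 then J (F (J (y (j - 2)))) else 0) = 0"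
proof -
  have xs: "xs \<noteq> []" "hd xs \<noteq> 0" "set xs \<subseteq> dom H"
    "\<And>l. l < length xs \<Longrightarrow> (\<Sum>j\<le>l. pencil_taylor F G S \<mu> j (xs ! (l - j))) = 0"
    using chain by (auto simp: jordan_chain_def)
  have "\<exists>z. j < length xs \<longrightarrow> xs ! j = J (J z)" for j
    using xs(3) nth_mem[of j xs] unfolding dom_H by (metis (no_types) imageE subsetD)
  then obtain z where z: "\<And>j. j < length xs \<Longrightarrow> xs ! j = J (J (z j))" by metis
  define y where "y j = J (z j)" for j
  have "y 0 \<noteq> 0"
    using xs(1,2) z[of 0] J_simps(3) by (auto simp: y_def hd_conv_nth)
  moreover have "T \<mu> (y l)
     + (if l \<ge> 1 then (2 * \<mu>) *\<^sub>C J (F (J (y (l - 1)))) + J (G1 (y (l - 1))) else 0)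
     + (if l \<ge> 2 then J (F (J (y (l - 2)))) else 0) = 0" if l: "l < length xs" for l
  proof -
    define t where "t j = J (pencil_taylor F G S \<mu> j (J (y (l - j))))" for j
    have t0: "t 0 = T \<mu> (y l)" by (simp add: t_def pencil_taylor_def y_def J_pencil)
    have t1: "t 1 = (2 * \<mu>) *\<^sub>C J (F (J (y (l - 1)))) + J (G1 (y (l - 1)))"
      by (simp add: t_def pencil_taylor_def J_simps(1,5) G1(2))
    have t2: "t 2 = J (F (J (y (l - 2))))" by (simp add: t_def pencil_taylor_def)
    have t3: "t j = 0" if "j \<ge> 3" for j using that by (simp add: t_def pencil_taylor_def J_simps(3))
    have "(\<Sum>j\<le>l. t j) = J (\<Sum>j\<le>l. pencil_taylor F G S \<mu> j (xs ! (l - j)))"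
      unfolding J_simps(7) t_def using l by (intro sum.cong refl) (simp add: z y_def)
    then have sum0: "(\<Sum>j\<le>l. t j) = 0" using xs(4)[OF l] J_simps(3) by simp
    have "(\<Sum>j\<le>l. t j) = (\<Sum>j\<in>{..l} \<inter> {0, 1, 2}. t j)"
      by (rule sum.mono_neutral_right) (auto intro!: t3)
    also have "\<dots> = t 0 + (if l \<ge> 1 then t 1 else 0) + (if l \<ge> 2 then t 2 else 0)"
    proof -
      consider "l = 0" | "l = 1" | "l \<ge> 2" by linarith
      then show ?thesis
      proof cases
        case 1
        then have "{..l} \<inter> {0, 1, 2} = {0}" by auto
        then show ?thesis using 1 by simp
      next
        case 2
        then have "{..l} \<inter> {0, 1, 2} = {0, 1}" by auto
        then show ?thesis using 2 by simp
      next
        case 3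
        then have "{..l} \<inter> {0, 1, 2} = {0, 1, 2}" by auto
        then show ?thesis using 3 by (simp add: add.assoc)
      qed
    qed
    finally show ?thesis using sum0 by (simp only: t0 t1 t2)
  qed
  ultimately show thesis using that by blast
qed

text \<open>Zeros of the determinant are isolated, and off the zeros both resolvent conditions hold. At a zero the kernel
  is nontrivial; it is finite-dimensional because its elements are combinations of the \<open>n\<close> vectors
  \<open>J (Li \<mu> (g j))\<close>, and chains have bounded length.\<close>

lemma normal_eigenvalue_if_determinant_zero:
  assumes fr: "finite_rank_perturbation A0 (\<lambda>y. J (G1 y)) (\<lambda>y. J (F (J y))) \<Omega> \<kappa>"
    and A0: "\<And>y. A0 y = St y + (\<Sum>i<n. cinner y (f i) *\<^sub>C g i)"
  defines "D \<equiv> finite_rank_perturbation.d A0 (\<lambda>y. J (G1 y)) (\<lambda>y. J (F (J y))) n f g"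
  assumes \<Omega>: "open \<Omega>" "connected \<Omega>" and \<nu>: "\<nu> \<in> \<Omega>" "D \<nu> \<noteq> 0"
  shows "\<mu> \<in> \<Omega> \<Longrightarrow> D \<mu> \<noteq> 0 \<Longrightarrow> \<mu> \<in> resolvent_set F G H S \<and> \<mu> \<in> gen_resolvent_set F G H S"
    and "\<mu> \<in> \<Omega> \<Longrightarrow> D \<mu> = 0 \<Longrightarrow> \<mu> \<in> normal_eigenvalues F G H S"
proof -
  interpret fr: finite_rank_perturbation A0 "\<lambda>y. J (G1 y)" "\<lambda>y. J (F (J y))" \<Omega> \<kappa> n f g by (rule fr)
  have Q: "fr.Q \<mu> y = T \<mu> y" for \<mu> y by (simp add: fr.Q_def fr.L_def A0 T_def)
  have res: "\<mu> \<in> resolvent_set F G H S \<and> \<mu> \<in> gen_resolvent_set F G H S" if "\<mu> \<in> \<Omega>" "D \<mu> \<noteq> 0" for \<mu>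
  proof -
    have "bij (fr.Q \<mu>)" using fr.Q_bij that by (simp add: D_def)
    then have bij: "bij (T \<mu>)" unfolding Q .
    obtain C where "\<And>y. cmod (D \<mu>) * norm y \<le> C * norm (T \<mu> y)"
      using fr.determinant_estimate \<open>\<mu> \<in> \<Omega>\<close> unfolding Q D_def by metis
    then have "norm y \<le> (C / cmod (D \<mu>)) * norm (T \<mu> y)" for y
      using that(2) by (simp add: field_simps)
    then show ?thesis using resolvent_if_reduced_bij[OF bij] by blast
  qed
  then show "\<mu> \<in> \<Omega> \<Longrightarrow> D \<mu> \<noteq> 0 \<Longrightarrow> \<mu> \<in> resolvent_set F G H S \<and> \<mu> \<in> gen_resolvent_set F G H S" .
  assume \<mu>: "\<mu> \<in> \<Omega>" and D: "D \<mu> = 0"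
  have "\<exists>y. y \<noteq> 0 \<and> T \<mu> y = 0" using fr.Q_kernel[OF \<mu>] D unfolding Q D_def by metis
  then obtain y where y: "T \<mu> y = 0" "y \<noteq> 0" by blast
  note eig = eigenvalue_if_reduced_kernel[OF y]
  obtain r where r: "0 < r" "ball \<mu> r \<subseteq> \<Omega>" "\<And>z. z \<in> ball \<mu> r - {\<mu>} \<Longrightarrow> D z \<noteq> 0"
    using isolated_zeros[OF fr.d_holomorphic \<Omega> \<mu> _ \<nu>(1)] D \<nu>(2) unfolding D_def by metis
  have "ball \<mu> r \<inter> - resolvent_set F G H S = {\<mu>}"
  proof -
    have near: "z \<in> resolvent_set F G H S" if "z \<in> ball \<mu> r" "z \<noteq> \<mu>" for z
      using res[of z] r(2,3) that by blast
    show ?thesis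
    proof (intro equalityI subsetI)
      show "z \<in> {\<mu>}" if "z \<in> ball \<mu> r \<inter> - resolvent_set F G H S" for z using near that by blast
    qed (use eig(2) r(1) in simp)
  qed
  then have "\<mu> isolated_in (- resolvent_set F G H S)"
    using eig(2) unfolding isolated_in_def by (auto intro!: exI[of _ "ball \<mu> r"])
  moreover have "finite_alg_multiplicity F G H S \<mu>"
  proof -
    obtain m where m: "\<And>y k. y 0 \<noteq> 0 \<Longrightarrow> fr.chain_at \<mu> y k \<Longrightarrow> k < m"
      using fr.chain_length_bounded[OF \<Omega> \<mu> \<nu>(1)] \<nu>(2) unfolding D_def by metis
    define B where "B = J ` (\<lambda>j. fr.Li \<mu> (g j)) ` {..<n}"
    show ?thesis
    proof (rule canonical_system_exists)
      show "finite B" by (simp add: B_def)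
      show "cvs.subspace (pencil_kernel F G H S \<mu>)"
        unfolding kernel_eq cvs.subspace_def
      proof (intro conjI ballI allI)
        note Ts = bounded_clinear_simps[OF T_clin]
        show "0 \<in> J ` {y. T \<mu> y = 0}" by (rule image_eqI[of _ _ 0]) (simp_all add: J_simps(3) Ts(3))
        show "x + x' \<in> J ` {y. T \<mu> y = 0}" if x: "x \<in> J ` {y. T \<mu> y = 0}" "x' \<in> J ` {y. T \<mu> y = 0}" for x x'
        proof -
          obtain u u' where "x = J u" "x' = J u'" "T \<mu> u = 0" "T \<mu> u' = 0" using x by blast
          then show ?thesis by (intro image_eqI[of _ _ "u + u'"]) (simp_all add: J_simps(1) Ts(1))
        qed
        show "c *\<^sub>C x \<in> J ` {y. T \<mu> y = 0}" if x: "x \<in> J ` {y. T \<mu> y = 0}" for c x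
        proof -
          obtain u where "x = J u" "T \<mu> u = 0" using x by blast
          then show ?thesis by (intro image_eqI[of _ _ "c *\<^sub>C u"]) (simp_all add: J_simps(5) Ts(5))
        qed
      qed
      show "pencil_kernel F G H S \<mu> \<subseteq> cvs.span B"
      proof
        fix x assume "x \<in> pencil_kernel F G H S \<mu>"
        then obtain u where u: "x = J u" "T \<mu> u = 0" unfolding kernel_eq by blast
        have "u = (\<Sum>j<n. cinner u (f j) *\<^sub>C fr.Li \<mu> (g j))"
          using u(2) by (intro fr.Q_kernel_expansion[OF \<mu>]) (simp add: Q)
        then have "J u = J (\<Sum>j<n. cinner u (f j) *\<^sub>C fr.Li \<mu> (g j))" by (rule arg_cong)
        then have "x = (\<Sum>j<n. cinner u (f j) *\<^sub>C J (fr.Li \<mu> (g j)))"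
          by (simp only: u(1) J_simps(5,7))
        moreover have "(\<Sum>j<n. cinner u (f j) *\<^sub>C J (fr.Li \<mu> (g j))) \<in> cvs.span B"
          by (intro cvs.span_sum cvs.span_scale cvs.span_base) (auto simp: B_def)
        ultimately show "x \<in> cvs.span B" by simp
      qed
      show "eigvec_rank F G H S \<mu> x \<le> enat m" for x
        unfolding eigvec_rank_def
      proof (rule SUP_least)
        fix xs assume "xs \<in> {xs. jordan_chain F G H S \<mu> xs \<and> hd xs = x}"
        then have chain: "jordan_chain F G H S \<mu> xs" by simp
        obtain y where y: "y 0 \<noteq> 0" "\<And>j. j < length xs \<Longrightarrow> T \<mu> (y j)
           + (if j \<ge> 1 then (2 * \<mu>) *\<^sub>C J (F (J (y (j - 1)))) + J (G1 (y (j - 1))) else 0)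
           + (if j \<ge> 2 then J (F (J (y (j - 2)))) else 0) = 0"
          using jordan_chain_reduced[OF chain] by blast
        have "xs \<noteq> []" using chain by (simp add: jordan_chain_def)
        then have "fr.chain_at \<mu> y (length xs - 1)"
          unfolding fr.chain_at_def Q by (intro allI impI y(2)) (cases xs, auto)
        then have "length xs - 1 < m" using m y(1) by blast
        then show "enat (length xs) \<le> enat m" by simp
      qed
    qed
  qed
  ultimately show "\<mu> \<in> normal_eigenvalues F G H S"
    using eig(1) by (simp add: normal_eigenvalues_def)
qed

end

section \<open>Strong ellipticity and the spectrum\<close>

text \<open>\<open>S = H + W\<close> with \<open>W\<close> symmetric on the domain of \<open>H\<close>, so \<open>J S J\<close> is the identity plus the realisation of
  \<open>W\<close>.\<close>

lemma pencil_reduction_exists: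
  fixes F :: "'a::chilbert_space \<Rightarrow> 'a" and G H S :: "'a \<rightharpoonup> 'a"
  assumes "pencil_assms F G H S"
  obtains J G1 St where "reduced_pencil H J F G S G1 St"
proof -
  have F: "bounded_clinear F"
    and H: "selfadjoint_op H" "uniformly_positive_on (dom H) (\<lambda>x. the (H x))"
    and G: "symmetric_op G" "dom (sqrt_op H) \<subseteq> dom G"
    and S: "selfadjoint_op S" "dom S = dom H"
    and W: "compact_op (\<lambda>y. the (S (inv_op H y)) - the (H (inv_op H y)))"
    using assms by (auto simp: pencil_assms_def)
  obtain J where J: "inverse_sqrt H J" using inverse_sqrt_exists[OF H] by blast
  interpret inverse_sqrt H J by (rule J)
  have G1: "bounded_clinear (\<lambda>y. the (G (J y)))"
    using symmetric_op_relatively_bounded[OF G(1)] G(2) by (simp add: sqrt_op_eq dom_R)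
  define K where "K z = the (S (J (J z))) - z" for z
  have K: "bounded_clinear K"
    using W by (simp add: compact_op_def JJ[symmetric] H_JJ K_def[abs_def])
  have Ksym: "cinner (J (J (K x))) y = cinner x (J (J (K y)))" for x y
  proof -
    have Sdom: "J (J z) \<in> dom S" for z using S(2) inv_in_dom by simp
    have "cinner (J (J (K x))) y = cinner (the (S (J (J x)))) (J (J y)) - cinner x (J (J y))"
      by (simp add: K_def sym cinner_diff_left)
    also have "\<dots> = cinner (J (J x)) (the (S (J (J y)))) - cinner (J (J x)) y"
      by (simp add: selfadjoint_op_symmetric[OF S(1) Sdom Sdom] sym)
    also have "\<dots> = cinner x (J (J (K y)))"
      by (simp add: K_def sym J_simps(2) cinner_diff_right)
    finally show ?thesis .
  qed
  obtain B where B: "bounded_clinear B" "\<And>x y. cinner (B x) y = cinner x (B y)" "\<And>z. B (J z) = J (K z)"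
    using symmetrizable_extension[OF K Ksym] by blast
  have "reduced_pencil H J F G S (\<lambda>y. the (G (J y))) (\<lambda>y. y + B y)"
  proof
    show "bounded_clinear (\<lambda>y. y + B y)" by (intro bounded_clinear_intros B)
    show "cinner (x + B x) y = cinner x (y + B y)" for x y by (simp add: cinner_simps B(2))
    show "J (the (S (J (J z)))) = J z + B (J z)" for z by (simp add: B(3) K_def J_simps(2))
  qed (use F G1 S in simp_all)
  then show thesis by (rule that)
qed

context reduced_pencil
begin

text \<open>The ellipticity inequality, read on vectors \<open>J (J z)\<close>, is an inequality between bounded forms in \<open>y = J z\<close>,
  and extends to all \<open>y\<close> by density.\<close>

lemma perturbation_of_strongly_elliptic:
  assumes "strongly_elliptic F G H S"
  shows "\<exists>V \<epsilon>. \<epsilon> > 0 \<and> bounded_clinear V \<and>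
    (\<forall>\<eta>>0. \<exists>(n::nat) f g. \<forall>y. norm (V y - (\<Sum>i<n. cinner y (f i) *\<^sub>C g i)) \<le> \<eta> * norm y) \<and>
    (\<forall>\<eta>>0. \<exists>C. \<forall>y. cmod (cinner (V y) y) \<le> \<eta> * (norm y)\<^sup>2 + C * (norm (J y))\<^sup>2) \<and>
    (\<forall>t y. \<epsilon> * (t\<^sup>2 * (norm (J y))\<^sup>2 + (norm y)\<^sup>2) \<le> Re (cinner (T (of_real t) y) y + cinner (V y) y))"
proof -
  obtain V where compact: "relatively_compact_op H V"
    and nonneg_V: "nonneg_on (dom H) (\<lambda>x. the (V x))"
    and pos: "uniformly_positive_pencil H (\<lambda>\<mu> x. pencil F G S \<mu> x + the (V x))"
    using assms unfolding strongly_elliptic_def by (elim exE conjE)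
  obtain \<epsilon> where \<epsilon>: "\<epsilon> > 0"
    and "\<forall>t::real. \<forall>x\<in>dom H. of_real \<epsilon> * (of_real (t\<^sup>2 * (norm x)\<^sup>2) + cinner (the (H x)) x)
      \<le> cinner (pencil F G S (of_real t) x + the (V x)) x"
    using pos unfolding uniformly_positive_pencil_def by (elim exE conjE)
  then have ell: "complex_of_real \<epsilon> * (of_real (t\<^sup>2 * (norm x)\<^sup>2) + cinner (the (H x)) x)
      \<le> cinner (pencil F G S (of_real t) x + the (V x)) x" if "x \<in> dom H" for t x
    using that by (elim allE[where x=t] ballE[where x=x]) simp_all
  define A where "A z = the (V (J (J z)))" for z
  have A: "compact_op A"
    using compact unfolding relatively_compact_op_def by (simp add: JJ[symmetric] A_def[abs_def])
  have nonneg_A: "0 \<le> cinner (A z) (J (J z))" for z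
    using nonneg_V inv_in_dom[of z] unfolding nonneg_on_def A_def by blast
  obtain U where U: "bounded_clinear U" and UJ: "\<forall>z. U (J z) = J (A z)"
    and approx: "\<forall>\<eta>>0. \<exists>(n::nat) f g. \<forall>y. norm (U y - (\<Sum>i<n. cinner y (f i) *\<^sub>C g i)) \<le> \<eta> * norm y"
    and bound: "\<forall>\<eta>>0. \<exists>C. \<forall>y. cmod (cinner (U y) y) \<le> \<eta> * (norm y)\<^sup>2 + C * (norm (J y))\<^sup>2"
    using perturbation_realisation[OF A nonneg_A] by (elim exE conjE)
  have "\<epsilon> * (t\<^sup>2 * (norm (J y))\<^sup>2 + (norm y)\<^sup>2) \<le> Re (cinner (T (of_real t) y) y + cinner (U y) y)" for t y
  proof (rule closed_on_range_J[where y=y])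
    have cont: "continuous_on UNIV (\<lambda>y. cinner (B y) y)" if "bounded_clinear B" for B
      using that by (intro bounded_bilinear.continuous_on[OF bounded_bilinear_cinner]
          linear_continuous_on bounded_clinear_linear continuous_on_id)
    show "closed {y. \<epsilon> * (t\<^sup>2 * (norm (J y))\<^sup>2 + (norm y)\<^sup>2) \<le> Re (cinner (T (of_real t) y) y + cinner (U y) y)}"
      by (intro closed_Collect_le continuous_intros cont T_clin U linear_continuous_on
          bounded_clinear_linear clin)
    show "\<epsilon> * (t\<^sup>2 * (norm (J (J z)))\<^sup>2 + (norm (J z))\<^sup>2)
        \<le> Re (cinner (T (of_real t) (J z)) (J z) + cinner (U (J z)) (J z))" for z
    proof -
      have "complex_of_real \<epsilon> * (of_real (t\<^sup>2 * (norm (J (J z)))\<^sup>2) + cinner z (J (J z)))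
          \<le> cinner (pencil F G S (of_real t) (J (J z)) + A z) (J (J z))"
        using ell[OF inv_in_dom[of z], of t] by (simp add: H_JJ A_def)
      moreover have "cinner z (J (J z)) = of_real ((norm (J z))\<^sup>2)"
        using cinner_self[of "J z"] by (simp add: sym)
      moreover have "cinner (pencil F G S (of_real t) (J (J z)) + A z) (J (J z))
          = cinner (T (of_real t) (J z)) (J z) + cinner (U (J z)) (J z)"
        unfolding J_pencil[symmetric] UJ[rule_format] by (simp add: cinner_add_left sym)
      ultimately have "complex_of_real \<epsilon> * (of_real (t\<^sup>2 * (norm (J (J z)))\<^sup>2) + of_real ((norm (J z))\<^sup>2))
          \<le> cinner (T (of_real t) (J z)) (J z) + cinner (U (J z)) (J z)" by simp
      then show ?thesis by (simp add: less_eq_complex_def)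
    qed
  qed
  then show ?thesis by (intro exI[of _ U] exI[of _ \<epsilon>] conjI \<epsilon> U approx bound allI)
qed

text \<open>The aperture \<open>s\<close> and the radius \<open>\<rho>\<close> depend only on \<open>\<epsilon>\<close>, the norm of \<open>J\<close>, and a constant \<open>c\<close> with
  \<open>|cinner (J (F (J y))) y| \<le> c |J y|\<^sup>2\<close> and \<open>|cinner (J (G1 y)) y| \<le> c |J y| |y|\<close>.\<close>

lemma coercivity_regions:
  assumes \<epsilon>: "\<epsilon> > 0"
    and ell: "\<And>t y. \<epsilon> * (t\<^sup>2 * (norm (J y))\<^sup>2 + (norm y)\<^sup>2) \<le> Re (cinner (T (of_real t) y) y + cinner (V y) y)"
  shows "\<exists>s \<rho>. s > 0 \<and> \<rho> > 0 \<and>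
    (\<forall>\<mu> y. \<bar>Im \<mu>\<bar> \<le> s * \<bar>Re \<mu>\<bar> \<longrightarrow>
      \<epsilon> / 4 * ((cmod \<mu>)\<^sup>2 * (norm (J y))\<^sup>2 + (norm y)\<^sup>2) \<le> Re (cinner (T \<mu> y) y + cinner (V y) y)) \<and>
    (\<forall>\<mu> y. cmod \<mu> \<le> \<rho> \<longrightarrow> \<epsilon> / 4 * (norm y)\<^sup>2 \<le> Re (cinner (T \<mu> y) y + cinner (V y) y))"
proof -
  obtain cF where cF: "cF > 0" "\<And>x. norm (F x) \<le> cF * norm x" using bounded_clinear_bound[OF F] by blast
  obtain cG where cG: "cG > 0" "\<And>x. norm (G1 x) \<le> cG * norm x" using bounded_clinear_bound[OF G1(1)] by blast
  obtain k where k: "k > 0" "\<And>x. norm (J x) \<le> k * norm x" using bounded_clinear_bound[OF clin] by blast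
  define c where "c = cF + cG"
  have c: "c > 0" using cF cG by (simp add: c_def)
  define \<alpha> where "\<alpha> y = cinner (J (F (J y))) y" for y
  define \<beta> where "\<beta> y = cinner (J (G1 y)) y" for y
  define \<gamma> where "\<gamma> y = cinner (St y) y + cinner (V y) y" for y
  have T_form: "cinner (T \<mu> y) y + cinner (V y) y = \<mu>\<^sup>2 * \<alpha> y + \<mu> * \<beta> y + \<gamma> y" for \<mu> y
    by (simp add: T_def \<alpha>_def \<beta>_def \<gamma>_def cinner_simps)
  have \<alpha>: "cmod (\<alpha> y) \<le> c * (norm (J y))\<^sup>2" for y
  proof -
    have "cmod (\<alpha> y) \<le> norm (F (J y)) * norm (J y)" unfolding \<alpha>_def sym by (rule Cauchy_Schwarz_cinner)
    also have "\<dots> \<le> (cF * norm (J y)) * norm (J y)" by (intro mult_right_mono cF) simp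
    also have "\<dots> \<le> (c * norm (J y)) * norm (J y)" using cG by (intro mult_right_mono) (auto simp: c_def)
    finally show ?thesis by (simp add: power2_eq_square)
  qed
  have \<beta>: "cmod (\<beta> y) \<le> c * (norm (J y) * norm y)" for y
  proof -
    have "cmod (\<beta> y) \<le> norm (G1 y) * norm (J y)" unfolding \<beta>_def sym by (rule Cauchy_Schwarz_cinner)
    also have "\<dots> \<le> (cG * norm y) * norm (J y)" by (intro mult_right_mono cG) simp
    also have "\<dots> \<le> (c * norm y) * norm (J y)" using cF by (intro mult_right_mono) (auto simp: c_def)
    finally show ?thesis by (simp add: ac_simps)
  qed
  \<comment> \<open>Chosen so that the change of the form stays below half of the lower bound, here and for \<open>\<rho>\<close>.\<close>
  define s where "s = min 1 (\<epsilon> / (8 * c))"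
  define \<rho> where "\<rho> = min (1 / k) (\<epsilon> / (4 * c * k))"
  have s: "s > 0" "s \<le> 1" "8 * c * s \<le> \<epsilon>"
  proof -
    have "8 * c * s \<le> 8 * c * (\<epsilon> / (8 * c))" using c by (intro mult_left_mono) (auto simp: s_def)
    then show "8 * c * s \<le> \<epsilon>" using c by simp
  qed (use \<epsilon> c in \<open>auto simp: s_def\<close>)
  have \<rho>: "\<rho> > 0" "\<rho> * k \<le> 1" "4 * c * (\<rho> * k) \<le> \<epsilon>"
  proof -
    have "\<rho> * k \<le> 1 / k * k" using k by (intro mult_right_mono) (auto simp: \<rho>_def)
    then show "\<rho> * k \<le> 1" using k by simp
    have "4 * c * (\<rho> * k) \<le> 4 * c * (\<epsilon> / (4 * c * k) * k)"
      using c k by (intro mult_left_mono mult_right_mono) (auto simp: \<rho>_def)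
    then show "4 * c * (\<rho> * k) \<le> \<epsilon>" using c k by simp
  qed (use \<epsilon> c k in \<open>auto simp: \<rho>_def\<close>)
  show ?thesis
  proof (rule exI[of _ s], rule exI[of _ \<rho>], intro conjI s(1) \<rho>(1) allI impI)
    show "\<epsilon> / 4 * ((cmod \<mu>)\<^sup>2 * (norm (J y))\<^sup>2 + (norm y)\<^sup>2) \<le> Re (cinner (T \<mu> y) y + cinner (V y) y)"
      if "\<bar>Im \<mu>\<bar> \<le> s * \<bar>Re \<mu>\<bar>" for \<mu> y
      unfolding T_form
      by (rule coercive_in_cone[where c=c and s=s])
         (use c s \<epsilon> \<alpha> \<beta> ell that in \<open>auto simp: T_form\<close>)
    show "\<epsilon> / 4 * (norm y)\<^sup>2 \<le> Re (cinner (T \<mu> y) y + cinner (V y) y)" if "cmod \<mu> \<le> \<rho>" for \<mu> y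
      unfolding T_form
    proof (rule coercive_in_ball[where c=c and K=k and \<rho>=\<rho> and a="norm (J y)"])
      show "\<epsilon> * (norm y)\<^sup>2 \<le> Re (\<gamma> y)" using ell[of 0 y] by (simp add: T_form)
    qed (use c k \<rho> \<epsilon> \<alpha> \<beta> that in auto)
  qed
qed

theorem spectrum_in_double_sector:
  assumes "strongly_elliptic F G H S"
  shows "\<exists>\<phi> \<delta>. 0 < \<phi> \<and> \<phi> \<le> pi / 2 \<and> 0 < \<delta> \<and>
    (\<exists>E. finite E \<and> E \<subseteq> normal_eigenvalues F G H S \<and>
       (double_sector \<phi> \<union> cball 0 \<delta>) - E \<subseteq> resolvent_set F G H S \<and>
       (double_sector \<phi> \<union> cball 0 \<delta>) - E \<subseteq> gen_resolvent_set F G H S) \<and>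
    (\<exists>r>0. \<forall>r0\<ge>r. \<exists>C::real. \<forall>z\<in>double_sector \<phi>. cmod z > r0 \<longrightarrow>
       z \<in> resolvent_set F G H S \<and> z \<in> gen_resolvent_set F G H S \<and>
       weighted_resolvent_norm F G H S z \<le> ennreal C)"
proof -
  obtain V \<epsilon> where \<epsilon>: "\<epsilon> > 0" and V: "bounded_clinear V"
    and approx: "\<forall>\<eta>>0. \<exists>(n::nat) f g. \<forall>y. norm (V y - (\<Sum>i<n. cinner y (f i) *\<^sub>C g i)) \<le> \<eta> * norm y"
    and bound: "\<forall>\<eta>>0. \<exists>C. \<forall>y. cmod (cinner (V y) y) \<le> \<eta> * (norm y)\<^sup>2 + C * (norm (J y))\<^sup>2"
    and "\<forall>t y. \<epsilon> * (t\<^sup>2 * (norm (J y))\<^sup>2 + (norm y)\<^sup>2) \<le> Re (cinner (T (of_real t) y) y + cinner (V y) y)"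
    using perturbation_of_strongly_elliptic[OF assms] by (elim exE conjE)
  then have ell: "\<epsilon> * (t\<^sup>2 * (norm (J y))\<^sup>2 + (norm y)\<^sup>2) \<le> Re (cinner (T (of_real t) y) y + cinner (V y) y)"
    for t y by blast
  obtain s \<rho> where s: "s > 0" and \<rho>: "\<rho> > 0"
    and cone: "\<forall>\<mu> y. \<bar>Im \<mu>\<bar> \<le> s * \<bar>Re \<mu>\<bar> \<longrightarrow>
      \<epsilon> / 4 * ((cmod \<mu>)\<^sup>2 * (norm (J y))\<^sup>2 + (norm y)\<^sup>2) \<le> Re (cinner (T \<mu> y) y + cinner (V y) y)"
    and disk: "\<forall>\<mu> y. cmod \<mu> \<le> \<rho> \<longrightarrow> \<epsilon> / 4 * (norm y)\<^sup>2 \<le> Re (cinner (T \<mu> y) y + cinner (V y) y)"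
    using coercivity_regions[OF \<epsilon> ell] by (elim exE conjE)
  note cone = cone[rule_format] and disk = disk[rule_format]
  define \<kappa> where "\<kappa> = \<epsilon> / 8"
  have \<kappa>: "\<kappa> > 0" "\<epsilon> / 4 = 2 * \<kappa>" using \<epsilon> by (simp_all add: \<kappa>_def)
  define \<Omega> where "\<Omega> = cone_ball s \<rho>"
  have \<Omega>: "open \<Omega>" "connected \<Omega>" unfolding \<Omega>_def using open_cone_ball connected_cone_ball[OF \<rho>] by auto
  \<comment> \<open>For large parameters the form of \<open>V\<close> is absorbed, and \<open>T\<close> itself is coercive.\<close>
  obtain C0 where C0: "\<And>y. cmod (cinner (V y) y) \<le> \<kappa> * (norm y)\<^sup>2 + C0 * (norm (J y))\<^sup>2"
    using bound \<kappa>(1) by blast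
  define r where "r = sqrt (\<bar>C0\<bar> / \<kappa>) + 1"
  have r: "r > 0" using \<kappa>(1) by (simp add: r_def add_nonneg_pos)
  have large: "\<kappa> * ((cmod \<mu>)\<^sup>2 * (norm (J y))\<^sup>2 + (norm y)\<^sup>2) \<le> Re (cinner (T \<mu> y) y)"
    if \<mu>: "\<bar>Im \<mu>\<bar> \<le> s * \<bar>Re \<mu>\<bar>" "r \<le> cmod \<mu>" for \<mu> y
  proof -
    have "sqrt (\<bar>C0\<bar> / \<kappa>) \<le> cmod \<mu>" using \<mu>(2) by (simp add: r_def)
    then have "(sqrt (\<bar>C0\<bar> / \<kappa>))\<^sup>2 \<le> (cmod \<mu>)\<^sup>2" using \<kappa>(1) by (intro power_mono) auto
    then have "\<bar>C0\<bar> \<le> \<kappa> * (cmod \<mu>)\<^sup>2" using \<kappa>(1) by (simp add: field_simps)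
    then have "C0 * (norm (J y))\<^sup>2 \<le> (\<kappa> * (cmod \<mu>)\<^sup>2) * (norm (J y))\<^sup>2" by (intro mult_right_mono) auto
    then have *: "cmod (cinner (V y) y) \<le> \<kappa> * ((cmod \<mu>)\<^sup>2 * (norm (J y))\<^sup>2 + (norm y)\<^sup>2)"
      using C0[of y] by (simp add: algebra_simps)
    define q where "q = (cmod \<mu>)\<^sup>2 * (norm (J y))\<^sup>2 + (norm y)\<^sup>2"
    have "2 * \<kappa> * q \<le> Re (cinner (T \<mu> y) y) + Re (cinner (V y) y)"
      using cone[OF \<mu>(1), of y] unfolding \<kappa>(2) q_def by simp
    moreover have "Re (cinner (V y) y) \<le> \<kappa> * q"
      using * complex_Re_le_cmod[of "cinner (V y) y"] unfolding q_def by linarith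
    ultimately show ?thesis unfolding q_def[symmetric] by simp
  qed
  have estimate: "\<mu> \<in> resolvent_set F G H S" "\<mu> \<in> gen_resolvent_set F G H S"
    "weighted_resolvent_norm F G H S \<mu> \<le> ennreal (3 / \<kappa>)"
    if \<mu>: "\<bar>Im \<mu>\<bar> \<le> s * \<bar>Re \<mu>\<bar>" "r \<le> cmod \<mu>" for \<mu>
  proof -
    have "\<mu> \<noteq> 0" using \<mu>(2) r by auto
    note * = uniform_estimate[OF \<kappa>(1) this large[OF \<mu>]]
    show "\<mu> \<in> resolvent_set F G H S" "\<mu> \<in> gen_resolvent_set F G H S"
    "weighted_resolvent_norm F G H S \<mu> \<le> ennreal (3 / \<kappa>)"
      by (rule *)+
  qed
  \<comment> \<open>Replacing \<open>V\<close> by a finite-rank approximation keeps coercivity on \<open>\<Omega>\<close>.\<close>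
  obtain n :: nat and f g where fg: "\<And>y. norm (V y - (\<Sum>i<n. cinner y (f i) *\<^sub>C g i)) \<le> \<kappa> * norm y"
    using approx \<kappa>(1) by blast
  define A0 where "A0 y = St y + (\<Sum>i<n. cinner y (f i) *\<^sub>C g i)" for y
  have coer: "2 * \<kappa> * (norm y)\<^sup>2 \<le> Re (cinner (T \<mu> y) y + cinner (V y) y)" if \<mu>: "\<mu> \<in> \<Omega>" for \<mu> y
  proof -
    consider "\<bar>Im \<mu>\<bar> < s * \<bar>Re \<mu>\<bar>" | "cmod \<mu> \<le> \<rho>" using \<mu> by (auto simp: \<Omega>_def cone_ball_def)
    then show ?thesis
    proof cases
      case 1
      have "2 * \<kappa> * (norm y)\<^sup>2 \<le> 2 * \<kappa> * ((cmod \<mu>)\<^sup>2 * (norm (J y))\<^sup>2 + (norm y)\<^sup>2)"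
        using \<kappa>(1) by (intro mult_left_mono) auto
      then show ?thesis using cone[of \<mu> y] 1 unfolding \<kappa>(2) by linarith
    next
      case 2
      then show ?thesis using disk[of \<mu> y] unfolding \<kappa>(2) by simp
    qed
  qed
  have fr: "finite_rank_perturbation A0 (\<lambda>y. J (G1 y)) (\<lambda>y. J (F (J y))) \<Omega> \<kappa>"
  proof
    show "bounded_clinear A0" unfolding A0_def by (intro bounded_clinear_intros St)
    show "bounded_clinear (\<lambda>y. J (G1 y))" by (rule bounded_clinear_compose[OF clin G1(1)])
    show "bounded_clinear (\<lambda>y. J (F (J y)))"
      by (rule bounded_clinear_compose[OF clin bounded_clinear_compose[OF F clin]])
    show "\<kappa> > 0" by (rule \<kappa>)
    fix \<mu> y assume \<mu>: "\<mu> \<in> \<Omega>"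
    define p where "p = (\<Sum>i<n. cinner y (f i) *\<^sub>C g i)"
    have "\<mu>\<^sup>2 *\<^sub>C J (F (J y)) + \<mu> *\<^sub>C J (G1 y) + A0 y = T \<mu> y + V y - (V y - p)"
      by (simp add: T_def A0_def p_def)
    then have eq: "cinner (\<mu>\<^sup>2 *\<^sub>C J (F (J y)) + \<mu> *\<^sub>C J (G1 y) + A0 y) y
        = cinner (T \<mu> y) y + cinner (V y) y - cinner (V y - p) y"
      by (simp only: cinner_add_left cinner_diff_left)
    have "Re (cinner (V y - p) y) \<le> norm (V y - p) * norm y"
      using complex_Re_le_cmod Cauchy_Schwarz_cinner order_trans by blast
    also have "\<dots> \<le> (\<kappa> * norm y) * norm y" unfolding p_def by (intro mult_right_mono fg) simp
    finally have "Re (cinner (V y - p) y) \<le> \<kappa> * (norm y)\<^sup>2" by (simp add: power2_eq_square)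
    then show "\<kappa> * (norm y)\<^sup>2 \<le> Re (cinner (\<mu>\<^sup>2 *\<^sub>C J (F (J y)) + \<mu> *\<^sub>C J (G1 y) + A0 y) y)"
      unfolding eq using coer[OF \<mu>, of y] by simp
  qed
  define D where "D = finite_rank_perturbation.d A0 (\<lambda>y. J (G1 y)) (\<lambda>y. J (F (J y))) n f g"
  define \<nu> where "\<nu> = complex_of_real r"
  have \<nu>: "\<nu> \<in> \<Omega>" "D \<nu> \<noteq> 0"
  proof -
    show \<nu>\<Omega>: "\<nu> \<in> \<Omega>" using r s by (simp add: \<Omega>_def cone_ball_def \<nu>_def)
    interpret fr: finite_rank_perturbation A0 "\<lambda>y. J (G1 y)" "\<lambda>y. J (F (J y))" \<Omega> \<kappa> n f g by (rule fr)
    show "D \<nu> \<noteq> 0"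
    proof
      assume "D \<nu> = 0"
      then obtain y where y: "y \<noteq> 0" "fr.Q \<nu> y = 0" using fr.Q_kernel[OF \<nu>\<Omega>] unfolding D_def by metis
      have "T \<nu> y = 0" using y(2) by (simp add: fr.Q_def fr.L_def A0_def T_def)
      then have "\<nu> \<notin> resolvent_set F G H S" using eigenvalue_if_reduced_kernel(2) y(1) by blast
      moreover have "\<nu> \<in> resolvent_set F G H S" using r s by (intro estimate(1)) (auto simp: \<nu>_def)
      ultimately show False by simp
    qed
  qed
  note dichotomy = normal_eigenvalue_if_determinant_zero[OF fr A0_def \<Omega> \<nu>(1) \<nu>(2)[unfolded D_def], folded D_def]
  \<comment> \<open>Half the aperture and half the radius make \<open>K\<close> a compact subset of the open set \<open>\<Omega>\<close>; points of the
    smaller sector outside \<open>K\<close> have modulus at least \<open>r\<close>.\<close>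
  define K where "K = ({z. \<bar>Im z\<bar> \<le> s / 2 * \<bar>Re z\<bar>} \<inter> cball 0 r) \<union> cball 0 (\<rho> / 2)"
  have K: "compact K" "K \<subseteq> \<Omega>" unfolding K_def \<Omega>_def by (rule compact_in_cone_ball[OF s \<rho>])+
  define E where "E = {z \<in> K. D z = 0}"
  have finite_E: "finite E"
  proof (cases "E = {}")
    case False
    then obtain z where "z \<in> \<Omega>" "D z = 0" using K(2) by (auto simp: E_def)
    then have "\<not> D constant_on \<Omega>" using \<nu> unfolding constant_on_def by metis
    moreover have "D holomorphic_on \<Omega>"
    proof -
      interpret fr: finite_rank_perturbation A0 "\<lambda>y. J (G1 y)" "\<lambda>y. J (F (J y))" \<Omega> \<kappa> n f g by (rule fr)
      show ?thesis unfolding D_def by (rule fr.d_holomorphic)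
    qed
    ultimately show ?thesis unfolding E_def using \<Omega> K by (intro holomorphic_compact_finite_zeros[of D \<Omega>])
  qed simp
  have normal_E: "E \<subseteq> normal_eigenvalues F G H S" using dichotomy(2) K(2) unfolding E_def by blast
  define \<phi> where "\<phi> = min (pi / 3) (s / 4)"
  have \<phi>: "\<phi> \<le> pi / 2" "\<phi> \<le> pi / 3" "0 < \<phi>" "2 * \<phi> \<le> s / 2"
  proof -
    show *: "\<phi> \<le> pi / 3" by (simp add: \<phi>_def)
    have "pi / 3 \<le> pi / 2" by simp
    with * show "\<phi> \<le> pi / 2" by (rule order_trans)
  qed (use s in \<open>auto simp: \<phi>_def\<close>)
  have sector: "\<bar>Im z\<bar> \<le> s / 2 * \<bar>Re z\<bar>" if "z \<in> double_sector \<phi>" for z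
    using double_sector_subset_cone[OF that \<phi>(2)] mult_right_mono[OF \<phi>(4), of "\<bar>Re z\<bar>"] by simp
  have sector': "\<bar>Im z\<bar> \<le> s * \<bar>Re z\<bar>" if "z \<in> double_sector \<phi>" for z
    using sector[OF that] s mult_right_mono[of "s / 2" s "\<bar>Re z\<bar>"] by simp
  have both: "z \<in> resolvent_set F G H S \<and> z \<in> gen_resolvent_set F G H S"
    if z: "z \<in> double_sector \<phi> \<union> cball 0 (\<rho> / 2)" "z \<notin> E" for z
  proof (cases "z \<in> K")
    case True
    then show ?thesis using dichotomy(1)[of z] z(2) K(2) unfolding E_def by blast
  next
    case False
    then have "z \<in> double_sector \<phi>" "r \<le> cmod z" using z(1) sector by (auto simp: K_def)
    then show ?thesis using estimate(1,2) sector' by blast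
  qed
  have "\<exists>E. finite E \<and> E \<subseteq> normal_eigenvalues F G H S \<and>
       (double_sector \<phi> \<union> cball 0 (\<rho> / 2)) - E \<subseteq> resolvent_set F G H S \<and>
       (double_sector \<phi> \<union> cball 0 (\<rho> / 2)) - E \<subseteq> gen_resolvent_set F G H S"
    using finite_E normal_E both by (intro exI[of _ E]) blast
  moreover have "\<forall>r0\<ge>r. \<exists>C::real. \<forall>z\<in>double_sector \<phi>. cmod z > r0 \<longrightarrow>
       z \<in> resolvent_set F G H S \<and> z \<in> gen_resolvent_set F G H S \<and>
       weighted_resolvent_norm F G H S z \<le> ennreal C"
  proof (intro allI impI exI[of _ "3 / \<kappa>"] ballI conjI)
    fix r0 z assume r0: "r \<le> r0" and z: "z \<in> double_sector \<phi>" "r0 < cmod z"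
    then have "r \<le> cmod z" by simp
    note * = estimate[OF sector'[OF z(1)] this]
    show "z \<in> resolvent_set F G H S" "z \<in> gen_resolvent_set F G H S"
      "weighted_resolvent_norm F G H S z \<le> ennreal (3 / \<kappa>)"
      by (rule *)+
  qed
  moreover have "0 < \<rho> / 2" using \<rho> by simp
  ultimately show ?thesis using \<phi>(1,3) r by blast
qed

end

theorem theorem12p2:
  fixes F :: "'a::chilbert_space \<Rightarrow> 'a" and G H S :: "'a \<rightharpoonup> 'a"
  assumes "separable_space (euclidean :: 'a topology)"
    and "pencil_assms F G H S"
    and "strongly_elliptic F G H S"
  shows "\<exists>\<phi> \<delta>. 0 < \<phi> \<and> \<phi> \<le> pi / 2 \<and> 0 < \<delta> \<and>
    (\<exists>E. finite E \<and> E \<subseteq> normal_eigenvalues F G H S \<and>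
       (double_sector \<phi> \<union> cball 0 \<delta>) - E \<subseteq> resolvent_set F G H S \<and>
       (double_sector \<phi> \<union> cball 0 \<delta>) - E \<subseteq> gen_resolvent_set F G H S) \<and>
    (\<exists>r>0. \<forall>r0\<ge>r. \<exists>C::real. \<forall>z\<in>double_sector \<phi>. cmod z > r0 \<longrightarrow>
       z \<in> resolvent_set F G H S \<and> z \<in> gen_resolvent_set F G H S \<and>
       ennreal ((cmod z)\<^sup>2) * op_norm UNIV norm norm (pencil_inv F G H S z)
       + ennreal (cmod z) * op_norm UNIV norm (norm1 H) (pencil_inv F G H S z)
       + op_norm (space_dual H) (norm_dual H) (norm1 H) (gen_pencil_inv F G H S z) \<le> ennreal C)"
proof -
  obtain J G1 St where "reduced_pencil H J F G S G1 St"
    using pencil_reduction_exists[OF assms(2)] by blast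
  then interpret reduced_pencil H J F G S G1 St .
  show ?thesis
    by (rule spectrum_in_double_sector[OF assms(3), unfolded weighted_resolvent_norm_def])
qed

end
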